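(* Approximating modularity clustering within any positive factor in unweighted graphs (with multiple edges allowed) is $\mathbf{NP}$-hard. That is, for every $\rho>0$, the following problem is $\mathbf{NP}$-hard (under polynomial-time Turing reductions): given an unweighted undirected multigraph $G$, output a community structure $\mathcal C$ of $G$ with $Q(\mathcal C)\ge\rho\, Q_{OPT}(G)$.
   Context: Graphs are finite, undirected, unweighted, with parallel edges allowed; the input lists every edge individually, so the input size is polynomial in the number of vertices and the number of edges counted with multiplicity. Let $M>0$ be the number of edges (counted with multiplicity) and $d_v$ the degree of vertex $v$ (counted with multiplicity). A community structure of $G=(V,E)$ is a partition $\mathcal C=\{C_1,\dots,C_l\}$ of $V$ into disjoint nonempty subsets with union $V$; the number $l\ge1$ of communities is not prescribed. The modularity of $\mathcal C$ is $$Q(\mathcal C)=\sum_{t=1}^{l}\left(\frac{E(C_t)}{M}-\frac{vol(C_t)^2}{4M^2}\right),$$ where $E(C_t)$ is the number of edges (with multiplicity) with both endpoints in $C_t$ and $vol(C_t)=\sum_{v\in C_t}d_v$. $Q_{OPT}(G)$ is the maximum of $Q(\mathcal C)$ over all community structures $\mathcal C$ of $G$. The modularity clustering problem asks for a community structure of maximum modularity. *)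

theory Defs
  imports
    Complex_Main
    "HOL-Library.Multiset"
    "HOL-Library.Disjoint_Sets"
    "HOL-Computational_Algebra.Polynomial"
begin

section \<open>Multigraphs and modularity\<close>

text \<open>An edge is a two-element set of vertices (no loops); parallel edges are
  repeated members of the edge multiset.\<close>

record 'a multigraph =
  verts :: "'a set"
  edges :: "'a set multiset"

definition multigraph :: "'a multigraph \<Rightarrow> bool" where
  "multigraph G \<longleftrightarrow> finite (verts G) \<and> (\<forall>e \<in># edges G. e \<subseteq> verts G \<and> card e = 2)"

definition num_edges :: "'a multigraph \<Rightarrow> nat" where
  "num_edges G = size (edges G)"

definition degree_of :: "'a multigraph \<Rightarrow> 'a \<Rightarrow> nat" where
  "degree_of G v = size {#e \<in># edges G. v \<in> e#}"

definition edges_within :: "'a multigraph \<Rightarrow> 'a set \<Rightarrow> nat" where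
  "edges_within G C = size {#e \<in># edges G. e \<subseteq> C#}"

definition vol :: "'a multigraph \<Rightarrow> 'a set \<Rightarrow> nat" where
  "vol G C = (\<Sum>v\<in>C. degree_of G v)"

definition community_structure :: "'a multigraph \<Rightarrow> 'a set set \<Rightarrow> bool" where
  "community_structure G \<C> \<longleftrightarrow> partition_on (verts G) \<C>"

definition modularity :: "'a multigraph \<Rightarrow> 'a set set \<Rightarrow> real" where
  "modularity G \<C> =
     (\<Sum>C\<in>\<C>. real (edges_within G C) / real (num_edges G)
             - (real (vol G C))\<^sup>2 / (4 * (real (num_edges G))\<^sup>2))"

definition Q_opt :: "'a multigraph \<Rightarrow> real" where
  "Q_opt G = Max {modularity G \<C> | \<C>. community_structure G \<C>}"

text \<open>The maximum is taken over a finite nonempty set, so it is attained.\<close>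

lemma Q_opt_attained:
  assumes "multigraph G" and "verts G \<noteq> {}"
  shows "\<exists>\<C>. community_structure G \<C> \<and> modularity G \<C> = Q_opt G"
    and "community_structure G \<C> \<Longrightarrow> modularity G \<C> \<le> Q_opt G"
proof -
  let ?S = "{modularity G \<C> | \<C>. community_structure G \<C>}"
  have eq: "?S = modularity G ` {\<C>. partition_on (verts G) \<C>}"
    by (auto simp: community_structure_def)
  have fin: "finite ?S"
    unfolding eq using assms(1)
    by (intro finite_imageI finitely_many_partition_on) (simp add: multigraph_def)
  have "community_structure G {verts G}"
    using assms(2) by (simp add: community_structure_def partition_on_space)
  hence ne: "?S \<noteq> {}" by blast
  show "\<exists>\<C>. community_structure G \<C> \<and> modularity G \<C> = Q_opt G"
    using Max_in[OF fin ne] unfolding Q_opt_def by auto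
  show "modularity G \<C> \<le> Q_opt G" if "community_structure G \<C>"
    unfolding Q_opt_def using fin that by (intro Max_ge) auto
qed


section \<open>Deterministic multitape Turing machines\<close>

text \<open>Tapes are two-way infinite. Symbols are natural numbers: 0 is the blank,
  1 and 2 represent the bits \<^const>\<open>False\<close> and \<^const>\<open>True\<close>; further work symbols are allowed.
  States are natural numbers as well, with fixed numbers for the distinguished ones.\<close>

datatype move = Move_Left | Move_Right | Stay

record tm =
  num_tapes :: nat
  num_symbols :: nat
  num_states :: nat
  delta :: "nat \<Rightarrow> nat list \<Rightarrow> nat \<times> (nat \<times> move) list"

definition start_state :: nat where "start_state = 0"
definition accept_state :: nat where "accept_state = 1"
definition reject_state :: nat where "reject_state = 2"

text \<open>The values of \<^const>\<open>delta\<close> outside the finite domain considered here are never used,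
  hence a well-formed machine is a finite object.\<close>

definition wf_tm :: "tm \<Rightarrow> bool" where
  "wf_tm M \<longleftrightarrow>
     num_symbols M \<ge> 3 \<and> num_states M \<ge> 3 \<and>
     (\<forall>q < num_states M. \<forall>syms.
        length syms = num_tapes M \<and> (\<forall>s \<in> set syms. s < num_symbols M) \<longrightarrow>
        (case delta M q syms of (q', acts) \<Rightarrow>
           q' < num_states M \<and> length acts = num_tapes M \<and>
           (\<forall>(s, m) \<in> set acts. s < num_symbols M)))"

type_synonym tape = "(int \<Rightarrow> nat) \<times> int"
type_synonym config = "nat \<times> tape list"

definition head_symbol :: "tape \<Rightarrow> nat" where
  "head_symbol = (\<lambda>(t, h). t h)"

fun move_head :: "move \<Rightarrow> int \<Rightarrow> int" where
  "move_head Move_Left h = h - 1"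
| "move_head Move_Right h = h + 1"
| "move_head Stay h = h"

definition act :: "nat \<times> move \<Rightarrow> tape \<Rightarrow> tape" where
  "act = (\<lambda>(s, m) (t, h). (t(h := s), move_head m h))"

definition halted :: "config \<Rightarrow> bool" where
  "halted c \<longleftrightarrow> fst c = accept_state \<or> fst c = reject_state"

definition step :: "tm \<Rightarrow> config \<Rightarrow> config" where
  "step M c =
     (if halted c then c
      else case c of (q, ts) \<Rightarrow>
        (case delta M q (map head_symbol ts) of (q', acts) \<Rightarrow> (q', map2 act acts ts)))"

text \<open>A tape carrying a bit string in the cells \<open>0, 1, \<dots>\<close>, blank elsewhere, with the head
  on cell 0.\<close>

definition bit_symbol :: "bool \<Rightarrow> nat" where
  "bit_symbol b = (if b then 2 else 1)"

definition string_tape :: "bool list \<Rightarrow> tape" where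
  "string_tape w =
     (\<lambda>i. if 0 \<le> i \<and> i < int (length w) then bit_symbol (w ! nat i) else 0, 0)"

text \<open>One input string per tape on the first tapes; the remaining tapes are blank.\<close>

definition init_config :: "tm \<Rightarrow> bool list list \<Rightarrow> config" where
  "init_config M ws =
     (start_state,
      map (\<lambda>i. string_tape (if i < length ws then ws ! i else [])) [0..<num_tapes M])"

text \<open>Halting configurations are fixed points of \<^const>\<open>step\<close>, so ``the state after \<open>n\<close> steps is
  accepting (rejecting)'' means that the machine accepts (rejects) within \<open>n\<close> steps.\<close>

definition accepts_within :: "tm \<Rightarrow> bool list list \<Rightarrow> nat \<Rightarrow> bool" where
  "accepts_within M ws n \<longleftrightarrow> fst ((step M ^^ n) (init_config M ws)) = accept_state"

definition rejects_within :: "tm \<Rightarrow> bool list list \<Rightarrow> nat \<Rightarrow> bool" where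
  "rejects_within M ws n \<longleftrightarrow> fst ((step M ^^ n) (init_config M ws)) = reject_state"


section \<open>The class NP\<close>

text \<open>Languages with polynomial-time verifiers: the word is given on tape 0 and the
  certificate, of polynomially bounded length, on tape 1. The running time is polynomial in
  the length of the word.\<close>

definition NP :: "bool list set set" where
  "NP = {L. \<exists>(M :: tm) (p :: nat poly) (q :: nat poly).
      wf_tm M \<and> num_tapes M \<ge> 2 \<and>
      (\<forall>x u. length u \<le> poly q (length x) \<longrightarrow>
         accepts_within M [x, u] (poly p (length x)) \<or>
         rejects_within M [x, u] (poly p (length x))) \<and>
      (\<forall>x. x \<in> L \<longleftrightarrow>
         (\<exists>u. length u \<le> poly q (length x) \<and> accepts_within M [x, u] (poly p (length x))))}"


section \<open>Oracle machines\<close>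

text \<open>An oracle is a function \<open>f :: bool list \<Rightarrow> bool list option\<close>; \<^const>\<open>None\<close> stands for
  the answer ``no solution''. An oracle Turing machine has the query tape 1 and the answer
  tape 2. From the query state it moves, in one step, to one of two answer states depending on
  whether the oracle returns a string; if it does, that string becomes the contents of the
  answer tape, otherwise the answer tape becomes blank.\<close>

definition query_state :: nat where "query_state = 3"
definition answer_state :: nat where "answer_state = 4"
definition no_answer_state :: nat where "no_answer_state = 5"

definition wf_oracle_tm :: "tm \<Rightarrow> bool" where
  "wf_oracle_tm M \<longleftrightarrow> wf_tm M \<and> num_tapes M \<ge> 3 \<and> num_states M \<ge> 6"

text \<open>The string on a tape is the maximal block of bits starting at cell 0. On the tapes of a
  reachable configuration only finitely many cells are nonblank, so the least index exists.\<close>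

definition tape_string :: "tape \<Rightarrow> bool list" where
  "tape_string = (\<lambda>(t, h).
     map (\<lambda>i. t (int i) = bit_symbol True)
       [0..<(LEAST i :: nat. t (int i) \<notin> range bit_symbol)])"

definition oracle_step ::
    "tm \<Rightarrow> (bool list \<Rightarrow> bool list option) \<Rightarrow> config \<Rightarrow> config" where
  "oracle_step M f c =
     (case c of (q, ts) \<Rightarrow>
        if q = query_state then
          (case f (tape_string (ts ! 1)) of
             Some y \<Rightarrow> (answer_state, ts[2 := string_tape y])
           | None \<Rightarrow> (no_answer_state, ts[2 := string_tape []]))
        else step M c)"

definition oracle_accepts_within ::
    "tm \<Rightarrow> (bool list \<Rightarrow> bool list option) \<Rightarrow> bool list \<Rightarrow> nat \<Rightarrow> bool" where
  "oracle_accepts_within M f x n \<longleftrightarrow>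
     fst ((oracle_step M f ^^ n) (init_config M [x])) = accept_state"

definition oracle_rejects_within ::
    "tm \<Rightarrow> (bool list \<Rightarrow> bool list option) \<Rightarrow> bool list \<Rightarrow> nat \<Rightarrow> bool" where
  "oracle_rejects_within M f x n \<longleftrightarrow>
     fst ((oracle_step M f ^^ n) (init_config M [x])) = reject_state"

lemma tape_string_string_tape: "tape_string (string_tape w) = w"
proof -
  have b: "bit_symbol b \<noteq> 0" for b by (simp add: bit_symbol_def)
  hence z: "(0::nat) \<notin> range bit_symbol" by (metis rangeE)
  have c: "fst (string_tape w) (int i) \<in> range bit_symbol \<longleftrightarrow> i < length w" for i
    using z by (simp add: string_tape_def)
  have l: "(LEAST i. fst (string_tape w) (int i) \<notin> range bit_symbol) = length w"
    by (rule Least_equality) (simp_all only: c not_less order_refl)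
  have "tape_string (string_tape w) =
      map (\<lambda>i. fst (string_tape w) (int i) = bit_symbol True) [0..<length w]"
    by (simp only: tape_string_def case_prod_beta l)
  also have "\<dots> = map ((!) w) [0..<length w]"
    by (simp add: string_tape_def bit_symbol_def)
  finally show ?thesis by (simp only: map_nth)
qed


section \<open>NP-hardness of search problems\<close>

text \<open>A search problem consists of the strings that are instances and, for every instance, the
  set of admissible outputs.\<close>

record search_problem =
  instances :: "bool list set"
  solutions :: "bool list \<Rightarrow> bool list set"

text \<open>A solver returns an admissible output for every instance that has one and reports
  \<^const>\<open>None\<close> for every instance that has none. Its behaviour on strings that are not instances
  is arbitrary.\<close>

definition solves :: "(bool list \<Rightarrow> bool list option) \<Rightarrow> search_problem \<Rightarrow> bool" where
  "solves f P \<longleftrightarrow>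
     (\<forall>x \<in> instances P.
        (case f x of Some y \<Rightarrow> y \<in> solutions P x | None \<Rightarrow> solutions P x = {}))"

text \<open>Polynomial-time Turing reductions: one machine and one polynomial serve all
  solvers.\<close>

definition turing_reduces :: "bool list set \<Rightarrow> search_problem \<Rightarrow> bool" where
  "turing_reduces L P \<longleftrightarrow>
     (\<exists>(M :: tm) (p :: nat poly). wf_oracle_tm M \<and>
        (\<forall>f. solves f P \<longrightarrow>
           (\<forall>x. (x \<in> L \<longrightarrow> oracle_accepts_within M f x (poly p (length x))) \<and>
                (x \<notin> L \<longrightarrow> oracle_rejects_within M f x (poly p (length x))))))"

definition NP_hard :: "search_problem \<Rightarrow> bool" where
  "NP_hard P \<longleftrightarrow> (\<forall>L \<in> NP. turing_reduces L P)"


section \<open>Encodings\<close>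

text \<open>Self-delimiting encodings. Numbers are written in unary: vertex names are below the
  number \<open>n\<close> of vertices, so this keeps the length of an encoded graph polynomial in \<open>n\<close> and
  the number of edges.\<close>

definition enc_nat :: "nat \<Rightarrow> bool list" where
  "enc_nat n = replicate n True @ [False]"

definition enc_pair :: "nat \<times> nat \<Rightarrow> bool list" where
  "enc_pair = (\<lambda>(u, v). enc_nat u @ enc_nat v)"

definition enc_list :: "('a \<Rightarrow> bool list) \<Rightarrow> 'a list \<Rightarrow> bool list" where
  "enc_list enc xs = concat (map (\<lambda>x. True # enc x) xs) @ [False]"

definition enc_graph :: "nat \<Rightarrow> (nat \<times> nat) list \<Rightarrow> bool list" where
  "enc_graph n es = enc_nat n @ enc_list enc_pair es"

definition enc_communities :: "nat list list \<Rightarrow> bool list" where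
  "enc_communities = enc_list (enc_list enc_nat)"

definition graph_of :: "nat \<Rightarrow> (nat \<times> nat) list \<Rightarrow> nat multigraph" where
  "graph_of n es = \<lparr>verts = {0..<n}, edges = mset (map (\<lambda>(u, v). {u, v}) es)\<rparr>"

text \<open>Strings encoding a multigraph with at least one edge, and the strings encoding a
  community structure. Distinctness says that every vertex is listed once, which also bounds
  the length of the output.\<close>

definition encodes_graph :: "bool list \<Rightarrow> nat multigraph \<Rightarrow> bool" where
  "encodes_graph x G \<longleftrightarrow>
     (\<exists>n es. x = enc_graph n es \<and> G = graph_of n es \<and> multigraph G \<and> num_edges G > 0)"

definition encodes_communities :: "bool list \<Rightarrow> nat set set \<Rightarrow> bool" where
  "encodes_communities y \<C> \<longleftrightarrow>
     (\<exists>Cs. y = enc_communities Cs \<and> distinct (concat Cs) \<and> [] \<notin> set Cs \<and> \<C> = set ` set Cs)"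

text \<open>The encodings are prefix-free, hence a string encodes at most one graph and at most one
  community structure.\<close>

definition prefix_free :: "('a \<Rightarrow> bool list) \<Rightarrow> bool" where
  "prefix_free enc \<longleftrightarrow> (\<forall>x y r s. enc x @ r = enc y @ s \<longrightarrow> x = y \<and> r = s)"

lemma prefix_freeD: "prefix_free enc \<Longrightarrow> enc x @ r = enc y @ s \<Longrightarrow> x = y \<and> r = s"
  by (auto simp: prefix_free_def)

lemma prefix_free_enc_nat: "prefix_free enc_nat"
proof -
  have "enc_nat x @ r = enc_nat y @ s \<Longrightarrow> x = y \<and> r = s" for x y r s
  proof (induction x arbitrary: y)
    case 0
    then show ?case by (cases y) (auto simp: enc_nat_def)
  next
    case (Suc x)
    then show ?case by (cases y) (auto simp: enc_nat_def)
  qed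
  thus ?thesis unfolding prefix_free_def by blast
qed

lemma prefix_free_enc_pair: "prefix_free enc_pair"
proof -
  have "a = c \<and> b = d \<and> r = s"
    if "enc_nat a @ (enc_nat b @ r) = enc_nat c @ (enc_nat d @ s)" for a b c d r s
    using prefix_freeD[OF prefix_free_enc_nat that] prefix_freeD[OF prefix_free_enc_nat]
    by blast
  hence "enc_pair x @ r = enc_pair y @ s \<Longrightarrow> x = y \<and> r = s" for x y r s
    by (cases x; cases y) (simp only: enc_pair_def prod.case append_assoc prod.inject; blast)
  thus ?thesis unfolding prefix_free_def by blast
qed

lemma prefix_free_enc_list:
  assumes "prefix_free enc"
  shows "prefix_free (enc_list enc)"
proof -
  have "enc_list enc xs @ r = enc_list enc ys @ s \<Longrightarrow> xs = ys \<and> r = s" for xs ys r s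
  proof (induction xs arbitrary: ys)
    case Nil
    then show ?case by (cases ys) (auto simp: enc_list_def)
  next
    case (Cons x xs)
    show ?case
    proof (cases ys)
      case Nil
      then show ?thesis using Cons.prems by (auto simp: enc_list_def)
    next
      case (Cons y ys')
      have "enc x @ (enc_list enc xs @ r) = enc y @ (enc_list enc ys' @ s)"
        using Cons.prems Cons by (simp add: enc_list_def)
      from prefix_freeD[OF assms this] Cons.IH Cons show ?thesis by auto
    qed
  qed
  thus ?thesis unfolding prefix_free_def by blast
qed

lemma encodes_graph_unique:
  assumes "encodes_graph x G" and "encodes_graph x H"
  shows "G = H"
proof -
  obtain n es m fs where *: "x = enc_graph n es" "G = graph_of n es"
      "x = enc_graph m fs" "H = graph_of m fs"
    using assms unfolding encodes_graph_def by blast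
  hence "enc_nat n @ enc_list enc_pair es = enc_nat m @ enc_list enc_pair fs"
    by (simp add: enc_graph_def)
  from prefix_freeD[OF prefix_free_enc_nat this]
  have "n = m" "enc_list enc_pair es = enc_list enc_pair fs" by auto
  with prefix_freeD[OF prefix_free_enc_list[OF prefix_free_enc_pair], of es "[]" fs "[]"] *
  show ?thesis by auto
qed

lemma encodes_communities_unique:
  assumes "encodes_communities y \<C>" and "encodes_communities y \<D>"
  shows "\<C> = \<D>"
proof -
  obtain Cs Ds where *: "y = enc_communities Cs" "\<C> = set ` set Cs"
      "y = enc_communities Ds" "\<D> = set ` set Ds"
    using assms unfolding encodes_communities_def by blast
  hence "Cs = Ds"
    using prefix_freeD[OF prefix_free_enc_list[OF prefix_free_enc_list[OF prefix_free_enc_nat]],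
        of Cs "[]" Ds "[]"]
    by (simp add: enc_communities_def)
  with * show ?thesis by simp
qed


section \<open>Approximate modularity clustering\<close>

definition modularity_approximation :: "real \<Rightarrow> search_problem" where
  "modularity_approximation \<rho> =
     \<lparr>instances = {x. \<exists>G. encodes_graph x G},
      solutions = (\<lambda>x. {y. \<exists>G \<C>. encodes_graph x G \<and> encodes_communities y \<C> \<and>
                             community_structure G \<C> \<and> modularity G \<C> \<ge> \<rho> * Q_opt G})\<rparr>"

end

theory Submission
  imports Defs
begin

text \<open>For a community \<open>C\<close> let \<open>x\<close> be \<open>1\<close> on \<open>C\<close> and \<open>-1\<close> elsewhere. Its contribution to the
  modularity is \<open>(4 M P - S\<^sup>2) / (16 M\<^sup>2)\<close> where \<open>P\<close> sums \<open>x u * x v\<close> and \<open>S\<close> sums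
  \<open>x u + x v\<close> over the edges \<open>uv\<close>. Given a language in NP we construct a multigraph such that
  some proper nonempty \<open>C\<close> has a positive contribution if the word belongs to the language, and all
  such \<open>C\<close> have negative contributions otherwise. In the second case the optimum is 0 and
  attained only by the partition into one community, in the first case every approximate solution
  has positive modularity and thus several communities. So, whatever the factor, one query followed
  by counting communities decides the language.

  The vertices come in pairs, and \<open>K\<close> parallel edges join any two vertices of different pairs. For
  large \<open>K\<close> this makes the contribution of every proper nonempty \<open>C\<close> negative unless \<open>C\<close> contains
  exactly one vertex of each pair. For the remaining \<open>C\<close> we have \<open>S = 0\<close>, the \<open>K\<close>-fold edges
  cancel, and \<open>P\<close> is the value of a quadratic form in one spin per pair, whose coefficients are
  determined by a few additional edges. The form encodes a constraint satisfaction problem, namely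
  the tableau of a verifier: cells are assigned tiles, subject to constraints on pairs of cells. A
  row carries the state and the scanned symbols in every cell, so that the constraints are local
  even for several tapes.

  The reduction is carried out by a machine whose tapes serve as counters, with nested loops over
  counters as the only control structure.\<close>

section \<open>Modularity and spin sums\<close>

text \<open>Why pairs work: for a cut let S be the sum of the signs of the pairs with equal spins
  and k the number of such pairs, among m pairs. The edges between different pairs, taken once, have
  gain \<open>16 * (m - 1) * (S\<^sup>2 - m * k)\<close>. Now S^2 \<le> k^2 \<le> m k, with equality
  throughout only if k = 0 or if all vertices have the same spin. By integrality all other cuts have
  gain at most -16 (m - 1). With K parallel copies this gap grows like K^2, whereas the additional
  edges disturb it by terms at most linear in K, so a polynomial K suffices. On antipodal cuts the
  additional edges decide alone. They give both vertices of a pair the same degree, which is why the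
  volume term vanishes there and only a quadratic form remains. The form is normalised to take the
  value 4 on satisfying assignments and at most -4 if there are none. The constraints are binary
  over an alphabet fixed by the verifier, so that all tables of forbidden combinations are part of
  the program text. At run time only cell numbers are computed, by addition and multiplication of
  counters.\<close>

definition psum :: "(nat \<times> nat) list \<Rightarrow> (nat \<Rightarrow> int) \<Rightarrow> int" where
  "psum es x = (\<Sum>(u, v)\<leftarrow>es. x u * x v)"

definition lsum :: "(nat \<times> nat) list \<Rightarrow> (nat \<Rightarrow> int) \<Rightarrow> int" where
  "lsum es x = (\<Sum>(u, v)\<leftarrow>es. x u + x v)"

definition spin :: "nat set \<Rightarrow> nat \<Rightarrow> int" where
  "spin C v = (if v \<in> C then 1 else -1)"

definition gain :: "(nat \<times> nat) list \<Rightarrow> (nat \<Rightarrow> int) \<Rightarrow> int" where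
  "gain es x = 4 * int (length es) * psum es x - (lsum es x)\<^sup>2"

definition valid_edges :: "nat \<Rightarrow> (nat \<times> nat) list \<Rightarrow> bool" where
  "valid_edges n es \<longleftrightarrow> (\<forall>(u, v) \<in> set es. u < n \<and> v < n \<and> u \<noteq> v)"

lemma multigraph_graph_of: "valid_edges n es \<Longrightarrow> multigraph (graph_of n es)"
  by (auto simp: valid_edges_def multigraph_def graph_of_def)

lemma num_edges_graph_of: "num_edges (graph_of n es) = length es"
  by (simp add: num_edges_def graph_of_def)

lemma verts_graph_of [simp]: "verts (graph_of n es) = {0..<n}"
  by (simp add: graph_of_def)

lemma edges_within_graph_of:
  "int (edges_within (graph_of n es) C) = (\<Sum>(u, v)\<leftarrow>es. of_bool (u \<in> C) * of_bool (v \<in> C))"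
  unfolding edges_within_def graph_of_def
  by (induction es) (auto simp: case_prod_beta)

lemma vol_graph_of:
  assumes "finite C" "valid_edges n es"
  shows "int (vol (graph_of n es) C) = (\<Sum>(u, v)\<leftarrow>es. of_bool (u \<in> C) + of_bool (v \<in> C))"
  using assms(2)
proof (induction es)
  case Nil
  show ?case by (simp add: vol_def degree_of_def graph_of_def)
next
  case (Cons e es)
  obtain u v where e: "e = (u, v)" by (cases e)
  have "u \<noteq> v" using Cons.prems e by (auto simp: valid_edges_def)
  have "degree_of (graph_of n (e # es)) w =
      degree_of (graph_of n es) w + (of_bool (w = u) + of_bool (w = v))" for w
    using \<open>u \<noteq> v\<close> by (auto simp: degree_of_def graph_of_def e)
  hence "vol (graph_of n (e # es)) C =
      vol (graph_of n es) C + ((\<Sum>w\<in>C. of_bool (w = u)) + (\<Sum>w\<in>C. of_bool (w = v)))"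
    unfolding vol_def sum.distrib[symmetric] by (intro sum.cong) auto
  moreover have "(\<Sum>w\<in>C. of_bool (w = a)) = (of_bool (a \<in> C) :: nat)" for a
    using assms(1) unfolding of_bool_def by (simp add: sum.delta)
  ultimately have "int (vol (graph_of n (e # es)) C) =
      int (vol (graph_of n es) C) + (of_bool (u \<in> C) + of_bool (v \<in> C))"
    by simp
  moreover have "valid_edges n es" using Cons.prems by (auto simp: valid_edges_def)
  ultimately show ?case using Cons.IH e by simp
qed

text \<open>With E inner edges, volume V and M edges in total, the substitution
  \<open>2 * of_bool - 1\<close> for spins gives P = 4 E - 2 V + M and S = 2 V - 2 M. In 4 M P - S^2
  the terms in M V and M^2 cancel.\<close>

lemma community_gain:
  assumes "finite C" "valid_edges n es"
  shows "gain es (spin C) = 16 * int (length es) * int (edges_within (graph_of n es) C)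
           - 4 * (int (vol (graph_of n es) C))\<^sup>2"
proof -
  let ?E = "\<Sum>(u, v)\<leftarrow>es. of_bool (u \<in> C) * of_bool (v \<in> C) :: int"
  let ?V = "\<Sum>(u, v)\<leftarrow>es. of_bool (u \<in> C) + of_bool (v \<in> C) :: int"
  have p: "psum es (spin C) = 4 * ?E - 2 * ?V + int (length es)"
    unfolding psum_def by (induction es) (auto simp: spin_def)
  have l: "lsum es (spin C) = 2 * ?V - 2 * int (length es)"
    unfolding lsum_def by (induction es) (auto simp: spin_def)
  show ?thesis
    unfolding gain_def p l edges_within_graph_of vol_graph_of[OF assms]
    by (simp add: algebra_simps power2_eq_square)
qed

lemma modularity_gain:
  assumes C: "community_structure (graph_of n es) \<C>" and es: "valid_edges n es" "es \<noteq> []"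
  shows "modularity (graph_of n es) \<C> =
    (\<Sum>C\<in>\<C>. real_of_int (gain es (spin C))) / (16 * (real (length es))\<^sup>2)"
  unfolding modularity_def sum_divide_distrib
proof (rule sum.cong)
  fix C assume "C \<in> \<C>"
  hence "C \<subseteq> {0..<n}"
    using C by (auto simp: community_structure_def partition_on_def)
  hence fin: "finite C" by (rule finite_subset) simp
  let ?E = "real (edges_within (graph_of n es) C)" and ?V = "real (vol (graph_of n es) C)"
    and ?M = "real (length es)"
  have g: "real_of_int (gain es (spin C)) = 16 * ?M * ?E - 4 * ?V\<^sup>2"
    unfolding community_gain[OF fin es(1)] by simp
  have "?M > 0" using es(2) by simp
  thus "?E / real (num_edges (graph_of n es))
        - ?V\<^sup>2 / (4 * (real (num_edges (graph_of n es)))\<^sup>2) =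
      real_of_int (gain es (spin C)) / (16 * ?M\<^sup>2)"
    unfolding num_edges_graph_of g by (simp add: field_simps power2_eq_square)
qed simp

lemma gain_whole:
  assumes "valid_edges n es"
  shows "gain es (spin {0..<n}) = 0"
proof -
  have "psum es (spin {0..<n}) = int (length es) \<and> lsum es (spin {0..<n}) = 2 * int (length es)"
    using assms
    by (induction es) (auto simp: psum_def lsum_def spin_def valid_edges_def)
  thus ?thesis by (simp add: gain_def power2_eq_square)
qed

definition positive_cut :: "nat \<Rightarrow> (nat \<times> nat) list \<Rightarrow> bool" where
  "positive_cut n es \<longleftrightarrow> (\<exists>C. C \<subset> {0..<n} \<and> C \<noteq> {} \<and> gain es (spin C) > 0)"

definition negative_cuts :: "nat \<Rightarrow> (nat \<times> nat) list \<Rightarrow> bool" where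
  "negative_cuts n es \<longleftrightarrow> (\<forall>C. C \<subset> {0..<n} \<longrightarrow> C \<noteq> {} \<longrightarrow> gain es (spin C) < 0)"

lemma trivial_community_structure:
  "0 < n \<Longrightarrow> community_structure (graph_of n es) {{0..<n}}"
  by (simp add: community_structure_def partition_on_space)

lemma modularity_trivial:
  assumes "valid_edges n es" "es \<noteq> []" "0 < n"
  shows "modularity (graph_of n es) {{0..<n}} = 0"
  using modularity_gain[OF trivial_community_structure[OF assms(3)] assms(1,2)]
    gain_whole[OF assms(1)] by simp

text \<open>A set and its complement have opposite spins, hence equal gains.\<close>

lemma Q_opt_pos:
  assumes "positive_cut n es" and es: "valid_edges n es" "es \<noteq> []"
  shows "Q_opt (graph_of n es) > 0"
proof -
  obtain C where C: "C \<subset> {0..<n}" "C \<noteq> {}" "gain es (spin C) > 0"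
    using assms(1) by (auto simp: positive_cut_def)
  define D where "D = {0..<n} - C"
  have part: "community_structure (graph_of n es) {C, D}"
    using C by (auto simp: community_structure_def partition_on_def disjoint_def D_def)
  have "psum es (spin D) = psum es (spin C) \<and> lsum es (spin D) = - lsum es (spin C)"
    using es(1) by (induction es) (auto simp: psum_def lsum_def spin_def valid_edges_def D_def)
  hence "gain es (spin D) = gain es (spin C)" by (simp add: gain_def)
  moreover have "C \<noteq> D" using C D_def by auto
  ultimately have "modularity (graph_of n es) {C, D} =
      2 * real_of_int (gain es (spin C)) / (16 * (real (length es))\<^sup>2)"
    using modularity_gain[OF part es] by simp
  also have "\<dots> > 0" using C(3) es(2) by simp
  finally have "modularity (graph_of n es) {C, D} > 0" .
  also have "modularity (graph_of n es) {C, D} \<le> Q_opt (graph_of n es)"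
    using part C(1) by (intro Q_opt_attained multigraph_graph_of es) auto
  finally show ?thesis .
qed

text \<open>A partition with the whole vertex set as a member has no other member. Hence all
  communities here are proper and nonempty, and every summand is negative, however many there
  are.\<close>

lemma modularity_neg:
  assumes "negative_cuts n es" and es: "valid_edges n es" "es \<noteq> []"
    and C: "community_structure (graph_of n es) \<C>" "\<C> \<noteq> {{0..<n}}" and n: "0 < n"
  shows "modularity (graph_of n es) \<C> < 0"
proof -
  have part: "partition_on {0..<n} \<C>" using C(1) by (simp add: community_structure_def)
  hence fin: "finite \<C>" by (intro finite_elements) auto
  have ne: "\<C> \<noteq> {}" using part n by (auto simp: partition_on_def)
  have "gain es (spin C) < 0" if "C \<in> \<C>" for C
  proof -
    have sub: "C \<subseteq> {0..<n}" "C \<noteq> {}" using part that by (auto simp: partition_on_def)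
    moreover have "C \<noteq> {0..<n}"
    proof
      assume eq: "C = {0..<n}"
      have "D = C" if "D \<in> \<C>" for D
      proof (rule ccontr)
        assume "D \<noteq> C"
        hence "D \<inter> C = {}" using part that \<open>C \<in> \<C>\<close> by (auto simp: partition_on_def disjoint_def)
        moreover have "D \<subseteq> C" "D \<noteq> {}" using part that eq by (auto simp: partition_on_def)
        ultimately show False by blast
      qed
      hence "\<C> = {{0..<n}}" using that eq by blast
      thus False using C(2) by simp
    qed
    ultimately show ?thesis using assms(1) by (auto simp: negative_cuts_def)
  qed
  hence "(\<Sum>C\<in>\<C>. real_of_int (gain es (spin C))) < 0"
    using fin ne sum_strict_mono[of \<C> "\<lambda>C. real_of_int (gain es (spin C))" "\<lambda>_. 0"] by simp
  thus ?thesis unfolding modularity_gain[OF C(1) es] using es(2)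
    by (simp add: divide_neg_pos)
qed

lemma Q_opt_zero:
  assumes "negative_cuts n es" and es: "valid_edges n es" "es \<noteq> []" and n: "0 < n"
  shows "Q_opt (graph_of n es) = 0"
proof -
  obtain \<C> where "community_structure (graph_of n es) \<C>"
      "modularity (graph_of n es) \<C> = Q_opt (graph_of n es)"
    using Q_opt_attained(1)[OF multigraph_graph_of[OF es(1)]] n by auto
  moreover have "0 \<le> Q_opt (graph_of n es)"
    using Q_opt_attained(2)[OF multigraph_graph_of[OF es(1)] _ trivial_community_structure[OF n]]
      modularity_trivial[OF es n] n by simp
  ultimately show ?thesis
    using modularity_neg[OF assms(1) es _ _ n] modularity_trivial[OF es n] by force
qed

section \<open>Queries and answers as strings\<close>

lemma encodes_graph_enc_graph:
  assumes "valid_edges n es" "es \<noteq> []"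
  shows "encodes_graph (enc_graph n es) G \<longleftrightarrow> G = graph_of n es"
proof -
  have "encodes_graph (enc_graph n es) (graph_of n es)"
    unfolding encodes_graph_def num_edges_graph_of
    by (rule exI[of _ n], rule exI[of _ es]) (simp add: num_edges_graph_of multigraph_graph_of assms)
  thus ?thesis using encodes_graph_unique by blast
qed

lemma in_instances:
  "valid_edges n es \<Longrightarrow> es \<noteq> [] \<Longrightarrow> enc_graph n es \<in> instances (modularity_approximation \<rho>)"
  using encodes_graph_enc_graph[of n es "graph_of n es"]
  by (auto simp: modularity_approximation_def)

lemma in_solutions:
  assumes "valid_edges n es" "es \<noteq> []"
  shows "y \<in> solutions (modularity_approximation \<rho>) (enc_graph n es) \<longleftrightarrow>
    (\<exists>\<C>. encodes_communities y \<C> \<and> community_structure (graph_of n es) \<C> \<and>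
      modularity (graph_of n es) \<C> \<ge> \<rho> * Q_opt (graph_of n es))"
  by (simp add: modularity_approximation_def encodes_graph_enc_graph[OF assms])

text \<open>When \<open>\<rho> > 1\<close> the set of solutions may be empty, but only if the optimum is positive.\<close>

lemma solver_answer:
  assumes f: "solves f (modularity_approximation \<rho>)" and \<rho>: "\<rho> > 0"
    and es: "valid_edges n es" "es \<noteq> []"
    and cuts: "if yes then positive_cut n es else negative_cuts n es"
  shows "f (enc_graph n es) = None \<and> yes \<or>
    (\<exists>C Cs. f (enc_graph n es) = Some (enc_communities (C # Cs)) \<and> (Cs = [] \<longleftrightarrow> \<not> yes) \<and>
       distinct C \<and> set C \<subseteq> {0..<n})"
proof -
  let ?G = "graph_of n es" and ?w = "enc_graph n es" and ?sol = "solutions (modularity_approximation \<rho>)"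
  have n: "0 < n" using es by (cases es) (auto simp: valid_edges_def)
  have zero: "Q_opt ?G = 0" if "\<not> yes" using Q_opt_zero[OF _ es n] cuts that by simp
  have "[] \<noteq> [0..<n]" using n upt_eq_Nil_conv[of 0 n] by (metis not_gr_zero le_zero_eq)
  hence "encodes_communities (enc_communities [[0..<n]]) {{0..<n}}"
    unfolding encodes_communities_def by (intro exI[of _ "[[0..<n]]"]) simp
  \<comment> \<open>In the no-case the single community attains the optimum 0 and is admissible for
    every factor, so \<open>None\<close> is never a correct answer there.\<close>
  hence triv: "enc_communities [[0..<n]] \<in> ?sol ?w" if "\<not> yes"
    unfolding in_solutions[OF es] zero[OF that]
    using trivial_community_structure[OF n, of es] modularity_trivial[OF es n]
    by (intro exI[of _ "{{0..<n}}"]) simp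
  have case_f: "case f ?w of Some y \<Rightarrow> y \<in> ?sol ?w | None \<Rightarrow> ?sol ?w = {}"
    using f in_instances[OF es] unfolding solves_def by blast
  show ?thesis
  proof (cases "f ?w")
    case None
    thus ?thesis using triv case_f by auto
  next
    case (Some y)
    then obtain \<C> where C: "encodes_communities y \<C>" "community_structure ?G \<C>"
        "modularity ?G \<C> \<ge> \<rho> * Q_opt ?G"
      using case_f unfolding in_solutions[OF es] by auto
    then obtain Cs where Cs: "y = enc_communities Cs" "distinct (concat Cs)" "\<C> = set ` set Cs"
        "[] \<notin> set Cs"
      by (auto simp: encodes_communities_def)
    have part: "partition_on {0..<n} \<C>" using C(2) by (simp add: community_structure_def)
    obtain D Ds where D: "Cs = D # Ds"
      using part n Cs(3) by (cases Cs) (auto simp: partition_on_def)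
    have "modularity ?G \<C> > 0" if yes
      using C(3) mult_pos_pos[OF \<rho> Q_opt_pos[OF _ es]] cuts that by (meson less_le_trans)
    moreover have "modularity ?G \<C> \<ge> 0" if "\<not> yes" using C(3) zero[OF that] by simp
    ultimately have whole: "\<C> = {{0..<n}} \<longleftrightarrow> \<not> yes"
      using modularity_neg[OF _ es C(2) _ n] modularity_trivial[OF es n] cuts
      by (metis less_irrefl not_le)
    \<comment> \<open>Counting lists amounts to counting communities:
      \<open>distinct (concat Cs)\<close> rules out that a nonempty community is listed
      twice.\<close>
    have "Ds = [] \<longleftrightarrow> \<C> = {{0..<n}}"
    proof
      assume "Ds = []"
      thus "\<C> = {{0..<n}}" using part Cs(3) D by (auto simp: partition_on_def)
    next
      assume eq: "\<C> = {{0..<n}}"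
      show "Ds = []"
      proof (cases Ds)
        case (Cons E Es)
        hence "set D = {0..<n}" "set E = {0..<n}" using eq Cs(3) D by auto
        moreover have "set D \<inter> set E = {}" using Cs(2) D Cons by auto
        ultimately show ?thesis using n by simp
      qed
    qed
    moreover have "distinct D" "set D \<subseteq> {0..<n}"
      using Cs part D by (auto simp: partition_on_def)
    ultimately show ?thesis using Some Cs(1) D whole by blast
  qed
qed

section \<open>From constraint satisfaction to cuts\<close>

text \<open>The vertices \<open>(a, 0)\<close> and \<open>(a, 1)\<close> form the pair \<open>a\<close>. If they have opposite spins
  \<open>y a\<close> and \<open>- y a\<close>, and \<open>z a\<close> is 1 or 0 depending on whether \<open>y a = y 0\<close>, then the sum of the
  products of spins is \<open>- 8 * z a * z b\<close> for the edges \<open>pen_edges 0 a b\<close>, \<open>- 8 * z a\<close> for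
  \<open>forbid_edges 0 a\<close>, and \<open>8 * z a - 4 + 4 * y 0 * y 1\<close> for \<open>reward_edges 0 1 a\<close>; each of the
  \<open>const_edges\<close> contributes \<open>- 1\<close>. The second auxiliary pair 1 makes it possible to add positive
  constants.\<close>

type_synonym 'a pedge = "('a \<times> nat) \<times> ('a \<times> nat)"

definition plus_edges :: "'a \<Rightarrow> 'a \<Rightarrow> 'a pedge list" where
  "plus_edges a b = [((a, 0), (b, 1)), ((a, 1), (b, 0))]"

definition minus_edges :: "'a \<Rightarrow> 'a \<Rightarrow> 'a pedge list" where
  "minus_edges a b = [((a, 0), (b, 0)), ((a, 1), (b, 1))]"

definition const_edges :: "'a \<Rightarrow> nat \<Rightarrow> 'a pedge list" where
  "const_edges z k = replicate k ((z, 0), (z, 1))"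

definition pen_edges :: "'a \<Rightarrow> 'a \<Rightarrow> 'a \<Rightarrow> 'a pedge list" where
  "pen_edges z a b = plus_edges a b @ plus_edges a z @ plus_edges b z @ const_edges z 2"

definition forbid_edges :: "'a \<Rightarrow> 'a \<Rightarrow> 'a pedge list" where
  "forbid_edges z a = plus_edges a z @ plus_edges a z @ const_edges z 4"

definition bonus_edges :: "'a \<Rightarrow> 'a \<Rightarrow> 'a pedge list" where
  "bonus_edges z z' = minus_edges z z' @ minus_edges z z'"

definition reward_edges :: "'a \<Rightarrow> 'a \<Rightarrow> 'a \<Rightarrow> 'a pedge list" where
  "reward_edges z z' a = minus_edges a z @ minus_edges a z @ bonus_edges z z'"

definition cross_edges :: "'a \<Rightarrow> 'a \<Rightarrow> 'a pedge list" where
  "cross_edges a b = minus_edges a b @ plus_edges a b"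

definition violations :: "nat \<Rightarrow> (nat \<Rightarrow> nat \<Rightarrow> bool) \<Rightarrow> (nat \<times> nat) list" where
  "violations s R = filter (\<lambda>(a, b). \<not> R a b) (List.product [0..<s] [0..<s])"

definition bin_edges :: "nat \<Rightarrow> 'a \<Rightarrow> (nat \<Rightarrow> 'a) \<Rightarrow> (nat \<Rightarrow> 'a) \<Rightarrow> (nat \<Rightarrow> nat \<Rightarrow> bool) \<Rightarrow> 'a pedge list"
  where
  "bin_edges s z p q R = concat (map (\<lambda>ab. pen_edges z (p (fst ab)) (q (snd ab))) (violations s R))"

definition un_edges :: "nat \<Rightarrow> 'a \<Rightarrow> (nat \<Rightarrow> 'a) \<Rightarrow> (nat \<Rightarrow> bool) \<Rightarrow> 'a pedge list" where
  "un_edges s z p U = concat (map (\<lambda>a. forbid_edges z (p a)) (filter (\<lambda>a. \<not> U a) [0..<s]))"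

definition cell_edges :: "nat \<Rightarrow> 'a \<Rightarrow> 'a \<Rightarrow> (nat \<Rightarrow> 'a) \<Rightarrow> 'a pedge list" where
  "cell_edges s z z' p = concat (map (\<lambda>a. reward_edges z z' (p a)) [0..<s]) @
     bin_edges s z p p (=) @ const_edges z 8"

lemmas gadget_defs = plus_edges_def minus_edges_def const_edges_def pen_edges_def
  forbid_edges_def bonus_edges_def reward_edges_def cross_edges_def

definition vertex_id :: "nat \<times> nat \<Rightarrow> nat" where
  "vertex_id = (\<lambda>(a, i). 2 * a + i)"

definition edge_id :: "nat pedge \<Rightarrow> nat \<times> nat" where
  "edge_id = map_prod vertex_id vertex_id"

text \<open>The complete multipartite graph whose parts are the pairs. The four products of spins
  between two pairs factor, so only the spin sum of each pair matters.\<close>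

definition all_cross :: "nat \<Rightarrow> nat pedge list" where
  "all_cross m = concat (map (\<lambda>a. concat (map (\<lambda>b. cross_edges a b) [0..<a])) [0..<m])"

lemma psum_append [simp]: "psum (xs @ ys) x = psum xs x + psum ys x"
  by (simp add: psum_def)

lemma lsum_append [simp]: "lsum (xs @ ys) x = lsum xs x + lsum ys x"
  by (simp add: lsum_def)

lemma psum_concat: "psum (map edge_id (concat (map F xs))) x = (\<Sum>a\<leftarrow>xs. psum (map edge_id (F a)) x)"
  by (induction xs) (auto simp: psum_def)

lemma lsum_concat: "lsum (map edge_id (concat (map F xs))) x = (\<Sum>a\<leftarrow>xs. lsum (map edge_id (F a)) x)"
  by (induction xs) (auto simp: lsum_def)

lemma sum_below: "2 * (\<Sum>a<m. \<Sum>b<a. f a * f b) = (\<Sum>a<m. f a)\<^sup>2 - (\<Sum>a<m. (f a)\<^sup>2)"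
  for f :: "nat \<Rightarrow> int"
  by (induction m) (auto simp: power2_eq_square algebra_simps sum_distrib_left)

lemma sum_below_lin: "(\<Sum>a<m. \<Sum>b<a. f a + f b) = (int m - 1) * (\<Sum>a<m. f a)" for f :: "nat \<Rightarrow> int"
  by (induction m) (auto simp: algebra_simps sum.distrib)

text \<open>A spin assignment has \<open>s a = \<plusminus>1\<close> on the pairs \<open>a\<close> with equal spins and \<open>s a = 0\<close> on the
  antipodal pairs.\<close>

lemma all_cross_sums:
  assumes "\<And>a. a < m \<Longrightarrow> x (2 * a) + x (2 * a + 1) = 2 * s a"
  defines "S \<equiv> \<Sum>a<m. s a" and "k \<equiv> \<Sum>a<m. (s a)\<^sup>2"
  shows "psum (map edge_id (all_cross m)) x = 2 * (S\<^sup>2 - k)"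
    and "lsum (map edge_id (all_cross m)) x = 4 * (int m - 1) * S"
    and "int (length (all_cross m)) = 2 * int m * (int m - 1)"
proof -
  have pl: "psum (map edge_id (cross_edges a b)) x = 4 * (s a * s b)"
    "lsum (map edge_id (cross_edges a b)) x = 4 * (s a + s b)" if "a < m" "b < m" for a b
  proof -
    have "psum (map edge_id (cross_edges a b)) x =
        (x (2 * a) + x (2 * a + 1)) * (x (2 * b) + x (2 * b + 1))"
      "lsum (map edge_id (cross_edges a b)) x =
        2 * (x (2 * a) + x (2 * a + 1)) + 2 * (x (2 * b) + x (2 * b + 1))"
      by (simp_all add: psum_def lsum_def gadget_defs edge_id_def vertex_id_def algebra_simps)
    thus "psum (map edge_id (cross_edges a b)) x = 4 * (s a * s b)"
      "lsum (map edge_id (cross_edges a b)) x = 4 * (s a + s b)"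
      unfolding assms(1)[OF that(1)] assms(1)[OF that(2)] by simp_all
  qed
  have "psum (map edge_id (all_cross m)) x = (\<Sum>a<m. \<Sum>b<a. psum (map edge_id (cross_edges a b)) x)"
    by (simp add: all_cross_def psum_concat interv_sum_list_conv_sum_set_nat atLeast0LessThan)
  also have "\<dots> = (\<Sum>a<m. \<Sum>b<a. 4 * (s a * s b))"
    using pl(1) by (intro sum.cong) auto
  also have "\<dots> = 2 * (2 * (\<Sum>a<m. \<Sum>b<a. s a * s b))" by (simp add: sum_distrib_left)
  finally show "psum (map edge_id (all_cross m)) x = 2 * (S\<^sup>2 - k)"
    unfolding sum_below S_def k_def .
  have "lsum (map edge_id (all_cross m)) x = (\<Sum>a<m. \<Sum>b<a. lsum (map edge_id (cross_edges a b)) x)"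
    by (simp add: all_cross_def lsum_concat interv_sum_list_conv_sum_set_nat atLeast0LessThan)
  also have "\<dots> = (\<Sum>a<m. \<Sum>b<a. 4 * (s a + s b))"
    using pl(2) by (intro sum.cong) auto
  also have "\<dots> = 4 * (\<Sum>a<m. \<Sum>b<a. s a + s b)" by (simp add: sum_distrib_left)
  finally show "lsum (map edge_id (all_cross m)) x = 4 * (int m - 1) * S"
    unfolding sum_below_lin S_def by simp
  have "int (length (all_cross m)) = (\<Sum>a<m. int (4 * a))"
    by (simp add: all_cross_def length_concat comp_def gadget_defs sum_list_triv
        interv_sum_list_conv_sum_set_nat atLeast0LessThan mult.commute)
  also have "\<dots> = 2 * int m * (int m - 1)"
    by (induction m) (auto simp: algebra_simps)
  finally show "int (length (all_cross m)) = 2 * int m * (int m - 1)" .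
qed

text \<open>The part of the difference quadratic in \<open>K\<close> is
  \<open>16 * K\<^sup>2 * (m - 1) * (m * k - S\<^sup>2)\<close>, hence at least 16 K^2. The
  \<open>r\<close> additional edges, with sums \<open>p\<close> and \<open>l\<close>, contribute at
  worst -32 K m^2 R \<ge> -8 K^2 and -4 R^2 \<ge> -K^2; this is where the bound on \<open>K\<close>
  comes from.\<close>

lemma gain_inequality:
  fixes K m R S k p l r :: int
  assumes m: "m \<ge> 2" and R: "R \<ge> 1" and K: "K \<ge> 4 * m\<^sup>2 * R"
    and S: "\<bar>S\<bar> \<le> k" "k \<le> m" "S\<^sup>2 + 1 \<le> m * k"
    and r: "0 \<le> r" "r \<le> R" "\<bar>p\<bar> \<le> r" "\<bar>l\<bar> \<le> 2 * r"
  shows "4 * (K * (2 * m * (m - 1)) + r) * (K * (2 * (S\<^sup>2 - k)) + p) < (K * (4 * (m - 1) * S) + l)\<^sup>2"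
proof -
  have K0: "K > 0" using K m R by (smt (verit) mult_pos_pos zero_less_power)
  have "S\<^sup>2 \<le> m\<^sup>2" using S by (metis abs_le_square_iff abs_of_nonneg abs_ge_zero order_trans)
  have k2: "k \<le> m\<^sup>2" using S m by (smt (verit) mult_le_cancel_right1 power2_eq_square)
  have Sk: "\<bar>S\<^sup>2 - k\<bar> \<le> m\<^sup>2" using \<open>S\<^sup>2 \<le> m\<^sup>2\<close> k2 S by (smt (verit) zero_le_power2)
  have eq: "(K * (4 * (m - 1) * S) + l)\<^sup>2 - 4 * (K * (2 * m * (m - 1)) + r) * (K * (2 * (S\<^sup>2 - k)) + p)
     = 16 * K\<^sup>2 * (m - 1) * (m * k - S\<^sup>2) + K * (8 * ((m - 1) * S * l) - 8 * (m * (m - 1) * p)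
         - 8 * (r * (S\<^sup>2 - k))) + (l\<^sup>2 - 4 * r * p)"
    by (simp add: algebra_simps power2_eq_square)
  have m2: "(m - 1) * m \<le> m\<^sup>2" by (simp add: power2_eq_square algebra_simps)
      (use m in linarith)
  have b1: "\<bar>(m - 1) * S * l\<bar> \<le> 2 * (m\<^sup>2 * R)"
  proof -
    have "\<bar>(m - 1) * S * l\<bar> = ((m - 1) * \<bar>S\<bar>) * \<bar>l\<bar>" using m by (simp add: abs_mult)
    also have "\<dots> \<le> ((m - 1) * m) * (2 * R)"
      using S r m by (intro mult_mono) auto
    also have "\<dots> \<le> m\<^sup>2 * (2 * R)" using m2 R by (intro mult_right_mono) auto
    finally show ?thesis by simp
  qed
  have b2: "\<bar>m * (m - 1) * p\<bar> \<le> m\<^sup>2 * R"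
  proof -
    have "\<bar>m * (m - 1) * p\<bar> = ((m - 1) * m) * \<bar>p\<bar>" using m by (simp add: abs_mult)
    also have "\<dots> \<le> m\<^sup>2 * R" using m2 r m by (intro mult_mono) auto
    finally show ?thesis .
  qed
  have b3: "\<bar>r * (S\<^sup>2 - k)\<bar> \<le> m\<^sup>2 * R"
  proof -
    have "\<bar>r * (S\<^sup>2 - k)\<bar> = \<bar>S\<^sup>2 - k\<bar> * r" using r by (simp add: abs_mult)
    also have "\<dots> \<le> m\<^sup>2 * R" using Sk r by (intro mult_mono) auto
    finally show ?thesis .
  qed
  have b4: "\<bar>r * p\<bar> \<le> R * R"
    unfolding abs_mult using r by (intro mult_mono) auto
  have "m\<^sup>2 * R \<ge> 1 * R" using m R by (intro mult_right_mono) (auto simp: power2_eq_square intro: order_trans[OF _ mult_mono[of 1 m 1 m]])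
  hence RK: "R \<le> K" using K R by linarith
  have "R * R \<le> K * R" using RK R by (intro mult_right_mono) auto
  moreover have "4 * R \<le> K"
  proof -
    have "4 * R \<le> 4 * m\<^sup>2 * R" using \<open>m\<^sup>2 * R \<ge> 1 * R\<close> by simp
    thus ?thesis using K by linarith
  qed
  hence "K * (4 * R) \<le> K * K" using K0 by (intro mult_left_mono) auto
  ultimately have c4: "4 * (R * R) \<le> K * K" by linarith
  define X where "X = 16 * K\<^sup>2 * (m - 1) * (m * k - S\<^sup>2)"
  define Y where "Y = K * (8 * ((m - 1) * S * l) - 8 * (m * (m - 1) * p) - 8 * (r * (S\<^sup>2 - k)))"
  have "Y \<ge> K * (- 32 * (m\<^sup>2 * R))"
    unfolding Y_def using b1 b2 b3 K0 by (intro mult_left_mono) linarith+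
  moreover have "K * (32 * (m\<^sup>2 * R)) \<le> K * (8 * K)"
    using K K0 by (intro mult_left_mono) (auto simp: algebra_simps)
  ultimately have Y: "Y \<ge> - 8 * (K * K)" by (simp only: mult_minus_right mult_minus_left)
  have "X \<ge> 16 * K\<^sup>2 * 1 * 1"
    unfolding X_def using m S by (intro mult_mono) auto
  hence X: "X \<ge> 16 * (K * K)" by (simp add: power2_eq_square)
  have "K * K > 0" "l\<^sup>2 \<ge> 0" using K0 by simp_all
  hence "0 < X + Y + (l\<^sup>2 - 4 * r * p)" using X Y b4 c4 by linarith
  thus ?thesis unfolding X_def Y_def eq[symmetric] by linarith
qed


lemma abs_sum_list_le: "\<bar>\<Sum>e\<leftarrow>es. f e\<bar> \<le> c * int (length es)" if "\<And>e. \<bar>f e\<bar> \<le> c" for f :: "'a \<Rightarrow> int"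
proof (induction es)
  case (Cons e es)
  thus ?case using that[of e] by (simp add: algebra_simps)
qed simp

lemma replicate_sums:
  "psum (map edge_id (concat (replicate K es))) x = int K * psum (map edge_id es) x"
  "lsum (map edge_id (concat (replicate K es))) x = int K * lsum (map edge_id es) x"
  "length (concat (replicate K es)) = K * length es"
  by (induction K) (auto simp: psum_def lsum_def algebra_simps)

definition graph_edges :: "nat \<Rightarrow> nat \<Rightarrow> nat pedge list \<Rightarrow> (nat \<times> nat) list" where
  "graph_edges K m terms = map edge_id (concat (replicate K (all_cross m)) @ terms)"

text \<open>The pair \<open>a0\<close> yields k \<ge> 1, while \<open>u\<close> and \<open>v\<close>
  exclude the constant spins. These are the two ways in which the cross edges could have gain
  0.\<close>

lemma gain_not_antipodal:
  assumes m: "m \<ge> 2" and K: "K \<ge> 4 * m\<^sup>2 * length terms" and terms: "terms \<noteq> []"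
    and x: "\<And>v. x v = 1 \<or> x v = -1"
    and anti: "a0 < m" "x (2 * a0 + 1) \<noteq> - x (2 * a0)"
    and const: "u < 2 * m" "x u = 1" "v < 2 * m" "x v = -1"
  shows "gain (graph_edges K m terms) x < 0"
proof -
  define s where "s a = (if x (2 * a) = x (2 * a + 1) then x (2 * a) else 0)" for a
  have s: "x (2 * a) + x (2 * a + 1) = 2 * s a" for a
    using x[of "2 * a"] x[of "2 * a + 1"] by (auto simp: s_def)
  have s1: "s a = 1 \<or> s a = 0 \<or> s a = -1" for a using x[of "2 * a"] by (auto simp: s_def)
  define S where "S = (\<Sum>a<m. s a)"
  define k where "k = (\<Sum>a<m. (s a)\<^sup>2)"
  note sums = all_cross_sums[of m x s, OF s, folded S_def k_def]
  have sq: "(s a)\<^sup>2 = \<bar>s a\<bar>" "\<bar>s a\<bar> \<le> 1" for a using s1[of a] by auto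
  have absS: "\<bar>S\<bar> \<le> k"
    unfolding S_def k_def sq by (rule sum_abs)
  have km: "k \<le> int m"
    unfolding k_def sq using sum_mono[of "{..<m}" "\<lambda>a. \<bar>s a\<bar>" "\<lambda>_. 1"] sq by simp
  have "s a0 \<noteq> 0" using anti x[of "2 * a0"] x[of "2 * a0 + 1"] by (auto simp: s_def)
  hence "1 \<le> (s a0)\<^sup>2" using s1[of a0] by auto
  also have "\<dots> \<le> k" unfolding k_def using anti(1) by (intro member_le_sum) auto
  finally have k1: "1 \<le> k" .
  have not_const: "\<exists>a<m. s a \<noteq> c" if "c = 1 \<or> c = -1" for c
  proof (rule ccontr)
    assume "\<not> (\<exists>a<m. s a \<noteq> c)"
    hence c: "\<And>a. a < m \<Longrightarrow> s a = c" by blast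
    have "x w = c" if "w < 2 * m" for w
    proof -
      have "s (w div 2) = c" using c[of "w div 2"] that by simp
      hence "x (2 * (w div 2)) = c" "x (2 * (w div 2) + 1) = c"
        using \<open>c = 1 \<or> c = -1\<close> by (auto simp: s_def split: if_splits)
      thus ?thesis by (cases "even w") (auto elim!: evenE oddE)
    qed
    from this[OF const(1)] this[OF const(3)] const show False by simp
  qed
  \<comment> \<open>If k = m, then all pairs have signs, not all equal, so \<bar>S\<bar> \<le> m -
    1. If k < m, then k (m - k) \<ge> 1 separates k^2, and with it S^2, from m k.\<close>
  have mk: "S\<^sup>2 + 1 \<le> int m * k"
  proof (cases "k = int m")
    case True
    have lt: "c * S < int m" if c: "c = 1 \<or> c = -1" for c
    proof -
      obtain a where a: "a < m" "c * s a < 1" using not_const[OF c] s1 c by force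
      have "\<forall>a\<in>{..<m}. c * s a \<le> 1" using sq(2) c by (auto simp: abs_le_iff)
      hence "c * S < (\<Sum>a<m. 1)" unfolding S_def sum_distrib_left
        using a by (intro sum_strict_mono_ex1) auto
      thus ?thesis by simp
    qed
    have "\<bar>S\<bar> \<le> int m - 1" using lt[of 1] lt[of "-1"] by linarith
    hence "S\<^sup>2 \<le> (int m - 1)\<^sup>2" using m by (intro abs_le_square_iff[THEN iffD1]) simp
    also have "(int m - 1)\<^sup>2 = int m * int m - 2 * int m + 1"
      by (simp add: power2_eq_square algebra_simps)
    finally show ?thesis using True m by simp
  next
    case False
    hence "k * (int m - k) \<ge> 1 * 1" using km k1 by (intro mult_mono) auto
    moreover have "S\<^sup>2 \<le> k\<^sup>2" using absS k1 by (intro abs_le_square_iff[THEN iffD1]) simp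
    ultimately show ?thesis by (simp add: power2_eq_square algebra_simps)
  qed
  let ?r = "int (length terms)"
  have p: "\<bar>psum (map edge_id terms) x\<bar> \<le> ?r"
  proof -
    have b: "\<bar>case e of (u, v) \<Rightarrow> x u * x v\<bar> \<le> 1" for e
      using x by (cases e) (simp add: abs_mult, metis abs_minus_cancel abs_one mult_1 order_refl)
    from abs_sum_list_le[OF b, where es = "map edge_id terms"] show ?thesis by (simp add: psum_def)
  qed
  have l: "\<bar>lsum (map edge_id terms) x\<bar> \<le> 2 * ?r"
  proof -
    have x1: "\<bar>x w\<bar> \<le> 1" for w using x[of w] by auto
    have b: "\<bar>case e of (u, v) \<Rightarrow> x u + x v\<bar> \<le> 2" for e
      using x1[of "fst e"] x1[of "snd e"] by (simp add: case_prod_beta)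
    from abs_sum_list_le[OF b, where es = "map edge_id terms"] show ?thesis by (simp add: lsum_def)
  qed
  have "int K \<ge> int (4 * m\<^sup>2 * length terms)" using K by (simp only: of_nat_le_iff)
  hence K': "int K \<ge> 4 * (int m)\<^sup>2 * ?r" by simp
  have "?r \<ge> 1" using terms by (cases terms) auto
  from gain_inequality[OF _ this K' absS km mk _ order_refl p l] m
  show ?thesis
    unfolding gain_def graph_edges_def
    by (simp add: replicate_sums sums mult.assoc)
qed

text \<open>Every pair has spin sum 0, so the cross edges contribute nothing to either sum. They
  enter only through the number of edges, a positive factor.\<close>

lemma gain_antipodal:
  assumes "\<And>a. a < m \<Longrightarrow> x (2 * a + 1) = - x (2 * a)" "lsum (map edge_id terms) x = 0"
  shows "gain (graph_edges K m terms) x =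
    4 * int (length (graph_edges K m terms)) * psum (map edge_id terms) x"
proof -
  have "x (2 * a) + x (2 * a + 1) = 2 * 0" if "a < m" for a using assms(1)[OF that] by simp
  note sums = all_cross_sums[of m x "\<lambda>_. 0", OF this]
  show ?thesis
    unfolding gain_def graph_edges_def by (simp add: replicate_sums sums assms(2))
qed

section \<open>Constraints as quadratic forms in spins\<close>

datatype item = Binary nat nat "nat \<Rightarrow> nat \<Rightarrow> bool" | Unary nat "nat \<Rightarrow> bool"

definition pair_of :: "nat \<Rightarrow> nat \<Rightarrow> nat \<Rightarrow> nat" where
  "pair_of s i a = 2 + (i * s + a)"

lemma pair_of_less: "i < N \<Longrightarrow> a < s \<Longrightarrow> pair_of s i a < 2 + N * s"
proof -
  assume "i < N" "a < s"
  hence "i * s + a < (i + 1) * s" by simp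
  also have "\<dots> \<le> N * s" using \<open>i < N\<close> by (intro mult_le_mono1) simp
  finally show ?thesis by (simp add: pair_of_def)
qed

fun item_edges :: "nat \<Rightarrow> item \<Rightarrow> nat pedge list" where
  "item_edges s (Binary i j R) = bin_edges s 0 (pair_of s i) (pair_of s j) R"
| "item_edges s (Unary i U) = un_edges s 0 (pair_of s i) U"

fun item_sat :: "(nat \<Rightarrow> nat) \<Rightarrow> item \<Rightarrow> bool" where
  "item_sat f (Binary i j R) \<longleftrightarrow> R (f i) (f j)"
| "item_sat f (Unary i U) \<longleftrightarrow> U (f i)"

fun item_within :: "nat \<Rightarrow> item \<Rightarrow> bool" where
  "item_within N (Binary i j R) \<longleftrightarrow> i < N \<and> j < N \<and> i \<noteq> j"
| "item_within N (Unary i U) \<longleftrightarrow> i < N"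

definition satisfies :: "nat \<Rightarrow> nat \<Rightarrow> item list \<Rightarrow> (nat \<Rightarrow> nat) \<Rightarrow> bool" where
  "satisfies N s items f \<longleftrightarrow> (\<forall>i<N. f i < s) \<and> (\<forall>it\<in>set items. item_sat f it)"

text \<open>Cells and items alone have value at most 0. The final \<open>bonus_edges\<close> lift
  the satisfying case to 4, yet less than the 8 that a single violation costs.\<close>

definition csp_edges :: "nat \<Rightarrow> nat \<Rightarrow> item list \<Rightarrow> nat pedge list" where
  "csp_edges N s items = concat (map (\<lambda>i. cell_edges s 0 1 (pair_of s i)) [0..<N]) @
     concat (map (item_edges s) items) @ bonus_edges 0 1"

text \<open>The value \<open>z\<close> is measured relative to pair 0, so a cut and its complement
  encode the same choice of tiles. Since \<open>z 0 = 1\<close>, pair 0 acts as the constant true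
  and turns products of spins into linear terms.\<close>

context
  fixes x :: "nat \<Rightarrow> int" and z :: "nat \<Rightarrow> int"
  assumes x: "\<And>v. x v = 1 \<or> x v = -1"
  defines "z \<equiv> \<lambda>a. of_bool (x (2 * a) = x 0)"
begin

abbreviation "anti a \<equiv> x (2 * a + 1) = - x (2 * a)"

text \<open>The condition on \<open>lsum\<close> is carried along because it makes the squared term
  of the gain vanish. Each gadget satisfies it, as it gives both vertices of a pair the same
  degree.\<close>

definition has_value :: "nat pedge list \<Rightarrow> int \<Rightarrow> bool" where
  "has_value es p \<longleftrightarrow> psum (map edge_id es) x = p \<and> lsum (map edge_id es) x = 0"

lemma value_append: "has_value es p \<Longrightarrow> has_value es' p' \<Longrightarrow> has_value (es @ es') (p + p')"
  by (simp add: has_value_def)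

lemma value_concat:
  "(\<And>a. a \<in> set xs \<Longrightarrow> has_value (F a) (p a)) \<Longrightarrow> has_value (concat (map F xs)) (\<Sum>a\<leftarrow>xs. p a)"
proof (induction xs)
  case (Cons a xs)
  thus ?case using value_append[of "F a" "p a"] by simp
qed (simp add: has_value_def psum_def lsum_def)

lemma spin_product: "x (2 * a) * x (2 * b) = (2 * z a - 1) * (2 * z b - 1)"
  using x[of "2 * a"] x[of "2 * b"] x[of 0] by (auto simp: z_def)

lemma z0: "z 0 = 1"
  by (simp add: z_def)

lemma basic_values:
  assumes "anti a" "anti b"
  shows "has_value (plus_edges a b) (- 2 * ((2 * z a - 1) * (2 * z b - 1)))"
    and "has_value (minus_edges a b) (2 * ((2 * z a - 1) * (2 * z b - 1)))"
  unfolding spin_product[symmetric] using assms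
  by (simp_all add: has_value_def gadget_defs psum_def lsum_def edge_id_def vertex_id_def)

lemma const_value: "anti 0 \<Longrightarrow> has_value (const_edges 0 k) (- int k)"
  using x[of 0] unfolding has_value_def const_edges_def
  by (induction k) (auto simp: psum_def lsum_def edge_id_def vertex_id_def)

lemma bonus_value: "anti 0 \<Longrightarrow> anti 1 \<Longrightarrow> has_value (bonus_edges 0 1) (4 * (2 * z 1 - 1))"
  using value_append[OF basic_values(2)[of 0 1] basic_values(2)[of 0 1]]
  by (simp add: bonus_edges_def z0)

lemma pen_value:
  assumes "anti 0" "anti a" "anti b"
  shows "has_value (pen_edges 0 a b) (- 8 * (z a * z b))"
  using value_append[OF basic_values(1)[OF assms(2,3)] value_append[OF basic_values(1)[OF assms(2,1)]
    value_append[OF basic_values(1)[OF assms(3,1)] const_value[OF assms(1), of 2]]]]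
  by (simp add: pen_edges_def z0 algebra_simps)

lemma forbid_value:
  assumes "anti 0" "anti a"
  shows "has_value (forbid_edges 0 a) (- 8 * z a)"
  using value_append[OF basic_values(1)[OF assms(2,1)] value_append[OF basic_values(1)[OF assms(2,1)]
    const_value[OF assms(1), of 4]]]
  by (simp add: forbid_edges_def z0 algebra_simps)

lemma reward_value:
  assumes "anti 0" "anti 1" "anti a"
  shows "has_value (reward_edges 0 1 a) (8 * z a + 8 * (z 1 - 1))"
  using value_append[OF basic_values(2)[OF assms(3,1)] value_append[OF basic_values(2)[OF assms(3,1)]
    bonus_value[OF assms(1,2)]]]
  by (simp add: reward_edges_def z0 algebra_simps)

lemma bin_value:
  assumes "anti 0" "\<And>a. a < s \<Longrightarrow> anti (p a) \<and> anti (q a)"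
  shows "has_value (bin_edges s 0 p q R) (- 8 * (\<Sum>(a, b)\<leftarrow>violations s R. z (p a) * z (q b)))"
proof -
  have "has_value (bin_edges s 0 p q R)
      (\<Sum>ab\<leftarrow>violations s R. - 8 * (z (p (fst ab)) * z (q (snd ab))))"
    unfolding bin_edges_def using assms
    by (intro value_concat pen_value) (auto simp: violations_def)
  thus ?thesis by (simp add: sum_list_const_mult case_prod_unfold del: mult_minus_left)
qed

lemma un_value:
  assumes "anti 0" "\<And>a. a < s \<Longrightarrow> anti (p a)"
  shows "has_value (un_edges s 0 p U) (- 8 * (\<Sum>a\<leftarrow>filter (\<lambda>a. \<not> U a) [0..<s]. z (p a)))"
proof -
  have "has_value (un_edges s 0 p U) (\<Sum>a\<leftarrow>filter (\<lambda>a. \<not> U a) [0..<s]. - 8 * z (p a))"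
    unfolding un_edges_def using assms by (intro value_concat forbid_value) auto
  thus ?thesis by (simp add: sum_list_const_mult del: mult_minus_left)
qed

text \<open>With \<open>n\<close> chosen tiles the rewards and penalties of a cell add up to
  \<open>8 n - 8 n (n - 1) - 8 = - 8 (n - 1)\<^sup>2\<close>.\<close>

lemma cell_value:
  assumes "anti 0" "anti 1" "\<And>a. a < s \<Longrightarrow> anti (p a)"
  shows "has_value (cell_edges s 0 1 p)
    (- 8 * ((\<Sum>a<s. z (p a)) - 1)\<^sup>2 + 8 * int s * (z 1 - 1))"
proof -
  let ?n = "\<Sum>a<s. z (p a)"
  have r: "has_value (concat (map (\<lambda>a. reward_edges 0 1 (p a)) [0..<s]))
      (\<Sum>a\<leftarrow>[0..<s]. 8 * z (p a) + 8 * (z 1 - 1))"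
    using assms by (intro value_concat reward_value) auto
  have rn: "(\<Sum>a\<leftarrow>[0..<s]. 8 * z (p a) + 8 * (z 1 - 1)) = 8 * ?n + 8 * int s * (z 1 - 1)"
    by (simp add: interv_sum_list_conv_sum_set_nat atLeast0LessThan sum.distrib sum_distrib_left)
  have zz: "z a * z a = z a" for a by (simp add: z_def)
  have "distinct (violations s (=))" by (simp add: violations_def distinct_product)
  moreover have "set (violations s (=)) = {..<s} \<times> {..<s} - (\<lambda>a. (a, a)) ` {..<s}"
    by (auto simp: violations_def)
  ultimately have "(\<Sum>(a, b)\<leftarrow>violations s (=). z (p a) * z (p b)) =
      (\<Sum>(a, b)\<in>{..<s} \<times> {..<s} - (\<lambda>a. (a, a)) ` {..<s}. z (p a) * z (p b))"
    by (simp add: sum_list_distinct_conv_sum_set)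
  also have "\<dots> = (\<Sum>(a, b)\<in>{..<s} \<times> {..<s}. z (p a) * z (p b)) -
      (\<Sum>(a, b)\<in>(\<lambda>a. (a, a)) ` {..<s}. z (p a) * z (p b))"
    by (rule sum_diff) auto
  also have "(\<Sum>(a, b)\<in>(\<lambda>a. (a, a)) ` {..<s}. z (p a) * z (p b)) = ?n"
    by (subst sum.reindex) (auto simp: inj_on_def zz)
  also have "(\<Sum>(a, b)\<in>{..<s} \<times> {..<s}. z (p a) * z (p b)) = ?n * ?n"
    by (simp add: sum_product sum.cartesian_product)
  finally have "has_value (bin_edges s 0 p p (=)) (- 8 * (?n * ?n - ?n))"
    using bin_value[of s p p "(=)"] assms by simp
  from value_append[OF r[unfolded rn] value_append[OF this const_value[OF assms(1), of 8]]]
  show ?thesis by (simp add: cell_edges_def power2_eq_square algebra_simps)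
qed

fun violation :: "nat \<Rightarrow> item \<Rightarrow> int" where
  "violation s (Binary i j R) = (\<Sum>(a, b)\<leftarrow>violations s R. z (pair_of s i a) * z (pair_of s j b))"
| "violation s (Unary i U) = (\<Sum>a\<leftarrow>filter (\<lambda>a. \<not> U a) [0..<s]. z (pair_of s i a))"

lemma csp_value:
  assumes anti: "\<And>a. a < 2 + N * s \<Longrightarrow> anti a"
    and items: "\<And>it. it \<in> set items \<Longrightarrow> item_within N it"
  shows "has_value (csp_edges N s items) (- 8 * (\<Sum>i<N. ((\<Sum>a<s. z (pair_of s i a)) - 1)\<^sup>2)
      - 8 * (\<Sum>it\<leftarrow>items. violation s it) + 8 * int (N * s) * (z 1 - 1) + 4 * (2 * z 1 - 1))"
proof -
  have a0: "anti 0" "anti 1" using anti[of 0] anti[of 1] by simp_all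
  have pair: "anti (pair_of s i a)" if "i < N" "a < s" for i a
    using that by (intro anti pair_of_less)
  have 1: "has_value (concat (map (\<lambda>i. cell_edges s 0 1 (pair_of s i)) [0..<N]))
      (\<Sum>i\<leftarrow>[0..<N]. - 8 * ((\<Sum>a<s. z (pair_of s i a)) - 1)\<^sup>2 + 8 * int s * (z 1 - 1))"
    by (intro value_concat cell_value a0 pair) auto
  have 2: "has_value (concat (map (item_edges s) items)) (\<Sum>it\<leftarrow>items. - 8 * violation s it)"
  proof (rule value_concat)
    fix it assume "it \<in> set items"
    from items[OF this] show "has_value (item_edges s it) (- 8 * violation s it)"
    proof (cases it)
      case (Binary i j R)
      thus ?thesis using items[OF \<open>it \<in> set items\<close>] bin_value[OF a0(1)] pair by simp
    next
      case (Unary i U)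
      thus ?thesis using items[OF \<open>it \<in> set items\<close>] un_value[OF a0(1)] pair by simp
    qed
  qed
  have e1: "(\<Sum>i\<leftarrow>[0..<N]. - 8 * ((\<Sum>a<s. z (pair_of s i a)) - 1)\<^sup>2 + 8 * int s * (z 1 - 1)) =
      - 8 * (\<Sum>i<N. ((\<Sum>a<s. z (pair_of s i a)) - 1)\<^sup>2) + 8 * int (N * s) * (z 1 - 1)"
    by (simp add: interv_sum_list_conv_sum_set_nat atLeast0LessThan sum_subtractf sum_distrib_left
        sum_negf)
  have e2: "(\<Sum>it\<leftarrow>items. - 8 * violation s it) = - 8 * (\<Sum>it\<leftarrow>items. violation s it)"
    by (simp add: sum_list_const_mult del: mult_minus_left)
  show ?thesis
    using value_append[OF 1[unfolded e1] value_append[OF 2[unfolded e2] bonus_value[OF a0]]]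
    by (simp add: csp_edges_def algebra_simps)
qed

end

lemma violation_nonneg: "0 \<le> violation x s it" if "\<And>v. x v = 1 \<or> x v = -1"
  using that
  by (cases it) (auto intro!: sum_list_nonneg simp: violation.simps[OF that])

text \<open>If each cell had exactly one chosen tile and no item were violated, the choice would
  satisfy the constraints. So some penalty of 8 is due, against a bonus of at most 4. Giving pair 1
  the value 0 only decreases the sum.\<close>

lemma csp_negative:
  assumes x: "\<And>v. x v = 1 \<or> x v = -1"
    and anti: "\<And>a. a < 2 + N * s \<Longrightarrow> x (2 * a + 1) = - x (2 * a)"
    and items: "\<And>it. it \<in> set items \<Longrightarrow> item_within N it"
    and unsat: "\<not> (\<exists>f. satisfies N s items f)"
  shows "psum (map edge_id (csp_edges N s items)) x < 0"
proof -
  define z :: "nat \<Rightarrow> int" where "z a = of_bool (x (2 * a) = x 0)" for a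
  define n where "n i = (\<Sum>a<s. z (pair_of s i a))" for i
  define V where "V = (\<Sum>it\<leftarrow>items. violation x s it)"
  have P: "psum (map edge_id (csp_edges N s items)) x = - 8 * (\<Sum>i<N. (n i - 1)\<^sup>2) - 8 * V
      + 8 * int (N * s) * (z 1 - 1) + 4 * (2 * z 1 - 1)"
    using csp_value[of x N s items, OF x anti items]
    by (simp add: has_value_def[OF x] n_def z_def V_def)
  have w: "z 1 \<le> 1" by (simp add: z_def)
  hence "int (N * s) * (z 1 - 1) \<le> 0" by (intro mult_nonneg_nonpos) auto
  moreover have "(\<Sum>i<N. (n i - 1)\<^sup>2) + V \<ge> 1"
  proof (rule ccontr)
    have S0: "(\<Sum>i<N. (n i - 1)\<^sup>2) \<ge> 0" by (intro sum_nonneg) auto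
    have V0: "V \<ge> 0" unfolding V_def using violation_nonneg[of x, OF x] by (intro sum_list_nonneg) auto
    assume "\<not> (\<Sum>i<N. (n i - 1)\<^sup>2) + V \<ge> 1"
    hence S: "(\<Sum>i<N. (n i - 1)\<^sup>2) = 0" and V: "V = 0" using S0 V0 by auto
    have n1: "n i = 1" if "i < N" for i
      using S that by (subst (asm) sum_nonneg_eq_0_iff) auto
    have ex: "\<exists>a<s. z (pair_of s i a) = 1" if "i < N" for i
    proof (rule ccontr)
      assume "\<not> (\<exists>a<s. z (pair_of s i a) = 1)"
      hence "n i = 0" unfolding n_def by (intro sum.neutral) (auto simp: z_def)
      thus False using n1[OF that] by simp
    qed
    then obtain f where f: "\<And>i. i < N \<Longrightarrow> f i < s \<and> z (pair_of s i (f i)) = 1" by metis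
    have "item_sat f it" if it: "it \<in> set items" for it
    proof -
      have "violation x s it = 0"
        using V it violation_nonneg[of x, OF x] unfolding V_def
        by (subst (asm) sum_list_nonneg_eq_0_iff) auto
      note v0 = this
      show ?thesis
      proof (cases it)
        case (Binary i j R)
        hence ij: "i < N" "j < N" using items[OF it] by auto
        hence "\<forall>(a, b)\<in>set (violations s R). z (pair_of s i a) * z (pair_of s j b) = 0"
          using v0 Binary unfolding violation.simps[OF x] z_def[symmetric] Binary
          by (subst (asm) sum_list_nonneg_eq_0_iff) (auto simp: z_def)
        thus ?thesis using Binary f[OF ij(1)] f[OF ij(2)] by (force simp: violations_def)
      next
        case (Unary i U)
        hence i: "i < N" using items[OF it] by auto
        hence "\<forall>a\<in>set (filter (\<lambda>a. \<not> U a) [0..<s]). z (pair_of s i a) = 0"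
          using v0 unfolding Unary violation.simps[OF x] z_def[symmetric]
          by (subst (asm) sum_list_nonneg_eq_0_iff) (auto simp: z_def)
        thus ?thesis using Unary f[OF i] by force
      qed
    qed
    thus False using unsat f unfolding satisfies_def by blast
  qed
  ultimately show ?thesis unfolding P using w by (simp add: mult.assoc)
qed

lemma sum_list_neutral: "(\<And>e. e \<in> set es \<Longrightarrow> f e = 0) \<Longrightarrow> (\<Sum>e\<leftarrow>es. f e) = 0"
  for f :: "'a \<Rightarrow> int"
  by (induction es) auto

lemma csp_positive:
  assumes items: "\<And>it. it \<in> set items \<Longrightarrow> item_within N it"
    and sat: "satisfies N s items f"
  obtains x where "\<And>v. x v = 1 \<or> x v = -1" "\<And>a. x (2 * a + 1) = - x (2 * a)" "x 0 = 1"
    "psum (map edge_id (csp_edges N s items)) x = 4"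
proof -
  \<comment> \<open>This inverts \<open>pair_of\<close>: the quotient of \<open>p - 2\<close> by
    \<open>s\<close> is the cell and the remainder is the tile. Both auxiliary pairs get spin 1, so
    that all rewards count.\<close>
  define Y :: "nat \<Rightarrow> int" where
    "Y p = (if p < 2 \<or> f ((p - 2) div s) = (p - 2) mod s then 1 else -1)" for p
  define x :: "nat \<Rightarrow> int" where "x v = (if even v then Y (v div 2) else - Y (v div 2))" for v
  have x: "x v = 1 \<or> x v = -1" for v by (auto simp: x_def Y_def)
  have anti: "x (2 * a + 1) = - x (2 * a)" for a by (simp add: x_def)
  have f: "f i < s" if "i < N" for i using sat that by (simp add: satisfies_def)
  have Y: "Y (pair_of s i a) = (if f i = a then 1 else -1)" if "a < s" for i a
    using that by (simp add: Y_def pair_of_def)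
  have z: "(of_bool (x (2 * pair_of s i a) = x 0) :: int) = of_bool (f i = a)" if "a < s" for i a
    using Y[OF that, of i] by (simp add: x_def) (simp add: Y_def)
  have z': "(of_bool (x (2 * pair_of s i a) = x 0) :: int) = (if a = f i then 1 else 0)" if "a < s" for i a
    using z[OF that, of i] by auto
  have n: "(\<Sum>a<s. of_bool (x (2 * pair_of s i a) = x 0) :: int) = 1" if "i < N" for i
  proof -
    have "(\<Sum>a<s. of_bool (x (2 * pair_of s i a) = x 0) :: int) = (\<Sum>a<s. if a = f i then 1 else 0)"
      by (intro sum.cong refl z') auto
    thus ?thesis using f[OF that] by simp
  qed
  have v: "violation x s it = 0" if it: "it \<in> set items" for it
  proof (cases it)
    case (Binary i j R)
    have "R (f i) (f j)" using sat it Binary by (auto simp: satisfies_def)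
    thus ?thesis
      using Binary by (force simp: violation.simps[OF x] violations_def z intro!: sum_list_neutral)
  next
    case (Unary i U)
    have "U (f i)" using sat it Unary by (auto simp: satisfies_def)
    thus ?thesis using Unary by (auto simp: violation.simps[OF x] z intro!: sum_list_neutral)
  qed
  have "(\<Sum>it\<leftarrow>items. violation x s it) = 0" using v by (intro sum_list_neutral) auto
  moreover have "x 0 = 1" "x 2 = 1" by (simp_all add: x_def Y_def)
  ultimately have "psum (map edge_id (csp_edges N s items)) x = 4"
    using csp_value[of x N s items, OF x anti items] n by (simp add: has_value_def[OF x])
  thus thesis using that x anti \<open>x 0 = 1\<close> by blast
qed

definition valid_pedge :: "nat \<Rightarrow> nat pedge \<Rightarrow> bool" where
  "valid_pedge m = (\<lambda>((a, i), (b, j)). a < m \<and> b < m \<and> i < 2 \<and> j < 2 \<and> (a \<noteq> b \<or> i \<noteq> j))"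

lemma vertex_id_inj: "i < 2 \<Longrightarrow> j < 2 \<Longrightarrow> vertex_id (a, i) = vertex_id (b, j) \<longleftrightarrow> a = b \<and> i = j"
  unfolding vertex_id_def prod.case by presburger

lemma valid_edges_map:
  assumes "\<And>e. e \<in> set es \<Longrightarrow> valid_pedge m e"
  shows "valid_edges (2 * m) (map edge_id es)"
  unfolding valid_edges_def
proof
  fix uv assume "uv \<in> set (map edge_id es)"
  then obtain a i b j where e: "((a, i), (b, j)) \<in> set es"
      "uv = (vertex_id (a, i), vertex_id (b, j))"
    by (auto simp: edge_id_def)
  have "a < m" "b < m" "i < 2" "j < 2" "a \<noteq> b \<or> i \<noteq> j"
    using assms[OF e(1)] by (auto simp: valid_pedge_def)
  moreover from this have "vertex_id (a, i) \<noteq> vertex_id (b, j)" using vertex_id_inj by auto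
  ultimately show "case uv of (u, v) \<Rightarrow> u < 2 * m \<and> v < 2 * m \<and> u \<noteq> v"
    unfolding e(2) by (simp add: vertex_id_def)
qed

lemma valid_gadgets:
  assumes "a < m" "2 \<le> m"
  shows "2 \<le> a \<Longrightarrow> b < m \<Longrightarrow> 2 \<le> b \<Longrightarrow> a \<noteq> b \<Longrightarrow> list_all (valid_pedge m) (pen_edges 0 a b)"
    "2 \<le> a \<Longrightarrow> list_all (valid_pedge m) (forbid_edges 0 a)"
    "2 \<le> a \<Longrightarrow> list_all (valid_pedge m) (reward_edges 0 1 a)"
    "list_all (valid_pedge m) (bonus_edges 0 1)"
    "list_all (valid_pedge m) (const_edges 0 k)"
    "b < a \<Longrightarrow> list_all (valid_pedge m) (cross_edges a b)"
  using assms by (auto simp: gadget_defs valid_pedge_def list_all_iff)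

lemma pair_of_inj: "a < s \<Longrightarrow> b < s \<Longrightarrow> pair_of s i a = pair_of s j b \<longleftrightarrow> i = j \<and> a = b"
proof
  assume s: "a < s" "b < s" and "pair_of s i a = pair_of s j b"
  hence "(i * s + a) div s = (j * s + b) div s" "(i * s + a) mod s = (j * s + b) mod s"
    by (auto simp: pair_of_def)
  thus "i = j \<and> a = b" using s by simp
qed simp

lemma list_all_concat: "list_all Q (concat xss) \<longleftrightarrow> (\<forall>xs\<in>set xss. list_all Q xs)"
  by (induction xss) auto

lemma valid_csp:
  assumes items: "\<And>it. it \<in> set items \<Longrightarrow> item_within N it"
  shows "valid_edges (2 * (2 + N * s)) (graph_edges K (2 + N * s) (csp_edges N s items))"
proof -
  let ?m = "2 + N * s" and ?v = "list_all (valid_pedge (2 + N * s))"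
  have p: "pair_of s i a < ?m" "2 \<le> pair_of s i a" if "i < N" "a < s" for i a
    using pair_of_less[OF that] by (auto simp: pair_of_def)
  have bin: "?v (bin_edges s 0 (pair_of s i) (pair_of s j) R)"
    if "i < N" "j < N" "i \<noteq> j \<or> R = (=)" for i j R
    using that p
    by (auto simp: bin_edges_def list_all_concat violations_def pair_of_inj intro!: valid_gadgets(1))
  have "?v (cell_edges s 0 1 (pair_of s i))" if "i < N" for i
    using that p bin by (auto simp: cell_edges_def list_all_concat simp del: One_nat_def intro!: valid_gadgets(3) valid_gadgets(5)[of 0])
  moreover have "?v (item_edges s it)" if "it \<in> set items" for it
    using items[OF that] p bin
    by (cases it) (auto simp: un_edges_def list_all_concat intro!: valid_gadgets(2))
  ultimately have "?v (csp_edges N s items)"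
    using valid_gadgets(4)[of 0 ?m] by (auto simp: csp_edges_def list_all_concat)
  moreover have "?v (concat (replicate K (all_cross ?m)))"
    by (auto simp: list_all_concat all_cross_def intro!: valid_gadgets(6))
  ultimately show ?thesis
    unfolding graph_edges_def by (intro valid_edges_map) (auto simp: list_all_iff)
qed

lemma gain_cong:
  assumes "valid_edges n es" "\<And>v. v < n \<Longrightarrow> x v = x' v"
  shows "gain es x = gain es x'"
proof -
  have "psum es x = psum es x' \<and> lsum es x = lsum es x'"
    using assms(1) by (induction es) (auto simp: psum_def lsum_def valid_edges_def assms(2))
  thus ?thesis by (simp add: gain_def)
qed

text \<open>The bound on \<open>K\<close> is that of \<open>gain_inequality\<close> with
  \<open>R\<close> the number of constraint edges. The two cases of the last claim are the antipodal
  cuts, decided by \<open>csp_negative\<close>, and the other cuts, decided by the cross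
  edges.\<close>

theorem csp_graph:
  assumes items: "\<And>it. it \<in> set items \<Longrightarrow> item_within N it"
    and K: "K \<ge> 4 * (2 + N * s)\<^sup>2 * length (csp_edges N s items)"
  defines "m \<equiv> 2 + N * s" and "es \<equiv> graph_edges K (2 + N * s) (csp_edges N s items)"
  shows "valid_edges (2 * m) es" and "es \<noteq> []"
    and "satisfies N s items f \<Longrightarrow> positive_cut (2 * m) es"
    and "\<not> (\<exists>f. satisfies N s items f) \<Longrightarrow> negative_cuts (2 * m) es"
proof -
  show valid: "valid_edges (2 * m) es" unfolding m_def es_def using items by (rule valid_csp)
  show ne: "es \<noteq> []" by (simp add: es_def graph_edges_def csp_edges_def gadget_defs)
  have M: "0 < 4 * int (length es)" using ne by simp
  {
    assume "satisfies N s items f"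
    then obtain x where x: "\<And>v. x v = 1 \<or> x v = -1" "\<And>a. x (2 * a + 1) = - x (2 * a)" "x 0 = 1"
        "psum (map edge_id (csp_edges N s items)) x = 4"
      using csp_positive[OF items] by metis
    define C where "C = {v. v < 2 * m \<and> x v = 1}"
    have "lsum (map edge_id (csp_edges N s items)) x = 0"
      using csp_value[of x N s items, OF x(1,2) items] has_value_def[of x, OF x(1)] by simp
    hence "gain es x = 4 * int (length es) * 4"
      using gain_antipodal[of m x "csp_edges N s items" K] x(2,4) by (simp add: es_def m_def)
    moreover have "spin C v = x v" if "v < 2 * m" for v
      using that x(1)[of v] by (auto simp: spin_def C_def)
    hence "gain es (spin C) = gain es x" by (rule gain_cong[OF valid])
    moreover have "0 \<in> C" "1 \<notin> C" using x(3) x(2)[of 0] by (auto simp: C_def m_def)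
    moreover have "C \<subseteq> {0..<2 * m}" "1 \<in> {0..<2 * m}" by (auto simp: C_def m_def)
    ultimately show "positive_cut (2 * m) es"
      unfolding positive_cut_def using M by (intro exI[of _ C]) auto
  }
  assume unsat: "\<not> (\<exists>f. satisfies N s items f)"
  show "negative_cuts (2 * m) es"
    unfolding negative_cuts_def
  proof (intro allI impI)
    fix C assume C: "C \<subset> {0..<2 * m}" "C \<noteq> {}"
    let ?x = "spin C"
    have x: "?x v = 1 \<or> ?x v = -1" for v by (simp add: spin_def)
    obtain u v where uv: "u < 2 * m" "?x u = 1" "v < 2 * m" "?x v = -1"
      using C by (auto simp: spin_def subset_eq psubset_eq) (metis atLeastLessThan_iff)
    show "gain es ?x < 0"
    proof (cases "\<forall>a<m. ?x (2 * a + 1) = - ?x (2 * a)")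
      case True
      hence anti: "\<And>a. a < 2 + N * s \<Longrightarrow> ?x (2 * a + 1) = - ?x (2 * a)" by (simp add: m_def)
      have "lsum (map edge_id (csp_edges N s items)) ?x = 0"
        using csp_value[of ?x N s items, OF x anti items] has_value_def[of ?x, OF x] by simp
      hence "gain es ?x = 4 * int (length es) * psum (map edge_id (csp_edges N s items)) ?x"
        using gain_antipodal[of m ?x "csp_edges N s items" K] True by (simp add: es_def m_def)
      moreover have "psum (map edge_id (csp_edges N s items)) ?x < 0"
        by (rule csp_negative[of ?x N s items, OF x anti items unsat])
      ultimately show ?thesis using M by (simp add: mult_pos_neg)
    next
      case False
      then obtain a0 where a0: "a0 < m" "?x (2 * a0 + 1) \<noteq> - ?x (2 * a0)" by auto
      have "csp_edges N s items \<noteq> []" by (simp add: csp_edges_def gadget_defs)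
      from gain_not_antipodal[of m "csp_edges N s items" K ?x, OF _ _ this x a0 uv] K
      show ?thesis by (simp add: es_def m_def)
    qed
  qed
qed

section \<open>Counter programs on oracle machines\<close>

type_synonym ins = "nat \<times> (nat \<Rightarrow> nat \<times> nat \<times> move)"
type_synonym frag = "nat \<Rightarrow> ins list"

text \<open>States 4 and 6 to 8 form an automaton that decides whether the answer lists more than one
  community; the program occupies the states from 9 on.\<close>

definition ins_at :: "ins list \<Rightarrow> nat \<Rightarrow> ins" where
  "ins_at code q =
     (if q = 0 then (0, \<lambda>s. (9, s, Stay))
      else if q = 4 then (2, \<lambda>s. (6, s, Move_Right))
      else if q = 5 then (0, \<lambda>s. (1, s, Stay))
      else if q = 6 then (2, \<lambda>s. (if s = 2 then 7 else 8, s, Move_Right))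
      else if q = 7 then (2, \<lambda>s. (if s = 2 then 7 else 6, s, Move_Right))
      else if q = 8 then (2, \<lambda>s. (if s = 2 then 1 else 2, s, Stay))
      else if 9 \<le> q \<and> q < 9 + length code then code ! (q - 9)
      else (0, \<lambda>s. (q, s, Stay)))"

text \<open>An instruction acts on one tape and leaves the others alone. Targets and symbols out of
  range are replaced by 0, which makes the machine well-formed for any code; that they are in range
  is a condition of the step lemmas.\<close>

definition tm_of :: "nat \<Rightarrow> ins list \<Rightarrow> tm" where
  "tm_of nc code =
     \<lparr>num_tapes = 3 + nc, num_symbols = 4, num_states = 10 + length code,
      delta = (\<lambda>q syms. case ins_at code q of (j, g) \<Rightarrow>
        (case g (syms ! j) of (q', s', m) \<Rightarrow>
          (if q' < 10 + length code then q' else 0,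
           map (\<lambda>i. if i = j then (if s' < 4 then s' else 0, m) else (syms ! i, Stay))
             [0..<3 + nc])))\<rparr>"

lemma wf_tm_of: "wf_oracle_tm (tm_of nc code)"
proof -
  have "case delta (tm_of nc code) q syms of (q', acts) \<Rightarrow>
      q' < num_states (tm_of nc code) \<and> length acts = num_tapes (tm_of nc code) \<and>
      (\<forall>(s, m) \<in> set acts. s < num_symbols (tm_of nc code))"
    if syms: "length syms = num_tapes (tm_of nc code)"
      "\<forall>s\<in>set syms. s < num_symbols (tm_of nc code)" for q syms
  proof -
    obtain j g where jg: "ins_at code q = (j, g)" by fastforce
    obtain q' s' m where g: "g (syms ! j) = (q', s', m)" by (cases "g (syms ! j)") auto
    have "syms ! i < 4" if "i < 3 + nc" for i
      using syms that by (auto simp: tm_of_def all_set_conv_all_nth)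
    thus ?thesis by (auto simp: tm_of_def jg g)
  qed
  thus ?thesis unfolding wf_oracle_tm_def wf_tm_def by (auto simp: tm_of_def)
qed

lemma act_head: "act (head_symbol t, Stay) t = t"
  by (cases t) (simp add: act_def head_symbol_def)

lemma oracle_step_tm_of:
  assumes "ins_at code q = (j, g)" "q \<noteq> 1" "q \<noteq> 2" "q \<noteq> 3"
    and "length ts = 3 + nc" "j < 3 + nc"
    and "g (head_symbol (ts ! j)) = (q', s', m)" "q' < 10 + length code" "s' < 4"
  shows "oracle_step (tm_of nc code) f (q, ts) = (q', ts[j := act (s', m) (ts ! j)])"
proof -
  have "step (tm_of nc code) (q, ts) = (q', ts[j := act (s', m) (ts ! j)])"
    using assms
    by (auto simp: step_def halted_def accept_state_def reject_state_def tm_of_def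
        nth_list_update act_head intro!: nth_equalityI)
  thus ?thesis using assms(4) by (simp add: oracle_step_def query_state_def)
qed

definition input_symbol :: "bool list \<Rightarrow> nat \<Rightarrow> nat" where
  "input_symbol x p = (if p < length x then bit_symbol (x ! p) else 0)"

text \<open>Counter \<open>r\<close> lives on tape \<open>3 + r\<close>: its value is the position of the head, and
  cell 0 carries the mark 3.\<close>

definition counter_tape :: "int \<Rightarrow> nat" where
  "counter_tape = (\<lambda>i. if i = 0 then 3 else 0)"

type_synonym cstate = "(nat \<Rightarrow> nat) \<times> bool list \<times> int"

text \<open>The head of the query tape always stands behind the last bit written, so output is
  append-only. The answer tape is blank until the query.\<close>

definition tapes :: "nat \<Rightarrow> bool list \<Rightarrow> cstate \<Rightarrow> tape list" where
  "tapes nc x = (\<lambda>(c, o', h).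
     (fst (string_tape x), h) # (fst (string_tape o'), int (length o')) # string_tape [] #
     map (\<lambda>r. (counter_tape, int (c r))) [0..<nc])"

lemma length_tapes [simp]: "length (tapes nc x s) = 3 + nc"
  by (cases s) (simp add: tapes_def)

text \<open>The strict inequality makes the exit \<open>p + length xs\<close> a legal state;
  otherwise \<open>tm_of\<close> would redirect the final jump to 0. The offset 9 is the first state
  of the program.\<close>

definition code_at :: "ins list \<Rightarrow> nat \<Rightarrow> ins list \<Rightarrow> bool" where
  "code_at code p xs \<longleftrightarrow> 9 \<le> p \<and> p + length xs < 10 + length code \<and>
     (\<forall>i<length xs. code ! (p - 9 + i) = xs ! i)"

lemma code_at_append:
  assumes "code_at code p (xs @ ys)"
  shows "code_at code p xs" "code_at code (p + length xs) ys"
proof -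
  have p: "9 \<le> p" "p + (length xs + length ys) < 10 + length code"
    and nth: "\<And>i. i < length xs + length ys \<Longrightarrow> code ! (p - 9 + i) = (xs @ ys) ! i"
    using assms by (auto simp: code_at_def)
  show "code_at code p xs"
    unfolding code_at_def
  proof (intro conjI allI impI)
    fix i assume "i < length xs"
    thus "code ! (p - 9 + i) = xs ! i" using nth[of i] by (simp add: nth_append)
  qed (use p in auto)
  show "code_at code (p + length xs) ys"
    unfolding code_at_def
  proof (intro conjI allI impI)
    fix i assume "i < length ys"
    hence "code ! (p - 9 + (length xs + i)) = ys ! i" 
      using nth[of "length xs + i"] by simp
    moreover have "p + length xs - 9 + i = p - 9 + (length xs + i)" using p by simp
    ultimately show "code ! (p + length xs - 9 + i) = ys ! i" by (simp add: add.assoc)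
  qed (use p in auto)
qed

text \<open>A Hoare triple for total correctness with a time bound. It quantifies over the
  surrounding code, the position and the oracle, so fragments can be placed anywhere and composed
  before the solver is known.\<close>

definition triple :: "nat \<Rightarrow> bool list \<Rightarrow> frag \<Rightarrow> cstate \<Rightarrow> nat \<Rightarrow> cstate \<Rightarrow> bool" where
  "triple nc x F s t s' \<longleftrightarrow>
     (\<forall>code p f. code_at code p (F p) \<longrightarrow>
        (\<exists>t'\<le>t. (oracle_step (tm_of nc code) f ^^ t') (p, tapes nc x s) =
               (p + length (F p), tapes nc x s')))"


lemma tripleI:
  assumes "\<And>code p f. code_at code p (F p) \<Longrightarrow>
     \<exists>t'\<le>t. (oracle_step (tm_of nc code) f ^^ t') (p, tapes nc x s) = (p + length (F p), tapes nc x s')"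
  shows "triple nc x F s t s'"
  using assms by (auto simp: triple_def)

lemma tripleD:
  assumes "triple nc x F s t s'" "code_at code p (F p)"
  obtains t' where "t' \<le> t" "(oracle_step (tm_of nc code) f ^^ t') (p, tapes nc x s) =
    (p + length (F p), tapes nc x s')"
  using assms unfolding triple_def by blast

lemma triple_mono: "triple nc x F s t s' \<Longrightarrow> t \<le> t' \<Longrightarrow> triple nc x F s t' s'"
  unfolding triple_def by (meson order_trans)

lemma ins_at_code:
  assumes "code_at code p xs" "i < length xs"
  shows "ins_at code (p + i) = xs ! i"
proof -
  have "code ! (p + i - 9) = code ! (p - 9 + i)" using assms by (simp add: code_at_def)
  thus ?thesis using assms by (auto simp: code_at_def ins_at_def)
qed

lemma string_tape_sym: "fst (string_tape x) h < 3"
  by (auto simp: string_tape_def bit_symbol_def)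

lemma string_tape_snoc:
  "(fst (string_tape w))(int (length w) := bit_symbol b) = fst (string_tape (w @ [b]))"
  by (rule ext) (auto simp: string_tape_def nth_append)

lemma step_input:
  assumes "code_at code p xs" "i < length xs" "xs ! i = (0, g)"
    and "g (fst (string_tape x) h) = (q', fst (string_tape x) h, m)" "q' < 10 + length code"
  shows "oracle_step (tm_of nc code) f (p + i, tapes nc x (c, w, h)) =
         (q', tapes nc x (c, w, move_head m h))"
proof -
  have "9 \<le> p" using assms by (simp add: code_at_def)
  have s: "head_symbol (tapes nc x (c, w, h) ! 0) = fst (string_tape x) h"
    by (simp add: tapes_def head_symbol_def)
  have "oracle_step (tm_of nc code) f (p + i, tapes nc x (c, w, h)) =
        (q', (tapes nc x (c, w, h))[0 := act (fst (string_tape x) h, m) (tapes nc x (c, w, h) ! 0)])"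
    using assms \<open>9 \<le> p\<close> string_tape_sym[of x h]
    by (intro oracle_step_tm_of[of _ _ 0 g]) (auto simp: ins_at_code s)
  thus ?thesis by (simp add: tapes_def act_def)
qed

text \<open>The contents of a counter tape never change, only its head moves; seeing the mark 3 is
  the test for zero.\<close>

lemma step_counter:
  assumes "code_at code p xs" "i < length xs" "xs ! i = (3 + r, g)" "r < nc"
    and "g (if c r = 0 then 3 else 0) = (q', if c r = 0 then 3 else 0, m)" "q' < 10 + length code"
    and "int v = move_head m (int (c r))"
  shows "oracle_step (tm_of nc code) f (p + i, tapes nc x (c, w, h)) =
         (q', tapes nc x (c(r := v), w, h))"
proof -
  have "9 \<le> p" using assms by (simp add: code_at_def)
  have n: "tapes nc x (c, w, h) ! (3 + r) = (counter_tape, int (c r))"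
    using assms(4) by (simp add: tapes_def)
  have s: "head_symbol (tapes nc x (c, w, h) ! (3 + r)) = (if c r = 0 then 3 else 0)"
    unfolding n by (simp add: head_symbol_def counter_tape_def)
  have "oracle_step (tm_of nc code) f (p + i, tapes nc x (c, w, h)) =
        (q', (tapes nc x (c, w, h))
           [3 + r := act (if c r = 0 then 3 else 0, m) (tapes nc x (c, w, h) ! (3 + r))])"
    using assms \<open>9 \<le> p\<close>
    by (intro oracle_step_tm_of[of _ _ "3 + r" g]) (auto simp: ins_at_code s)
  moreover have "counter_tape(int (c r) := if c r = 0 then 3 else 0) = counter_tape"
    by (auto simp: counter_tape_def)
  ultimately have "oracle_step (tm_of nc code) f (p + i, tapes nc x (c, w, h)) =
        (q', (tapes nc x (c, w, h))[3 + r := (counter_tape, int v)])"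
    unfolding n using assms(7) by (simp add: act_def)
  also have "(tapes nc x (c, w, h))[3 + r := (counter_tape, int v)] = tapes nc x (c(r := v), w, h)"
    using assms(4)
    by (auto intro!: nth_equalityI simp: tapes_def nth_list_update numeral_3_eq_3)
  finally show ?thesis .
qed

lemma step_output:
  assumes "code_at code p xs" "i < length xs" "xs ! i = (1, g)"
    and "g 0 = (q', bit_symbol b, Move_Right)" "q' < 10 + length code"
  shows "oracle_step (tm_of nc code) f (p + i, tapes nc x (c, w, h)) =
         (q', tapes nc x (c, w @ [b], h))"
proof -
  have "9 \<le> p" using assms by (simp add: code_at_def)
  have s: "head_symbol (tapes nc x (c, w, h) ! 1) = 0"
    by (simp add: tapes_def head_symbol_def string_tape_def)
  have b: "bit_symbol b < 4" by (simp add: bit_symbol_def)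
  have "oracle_step (tm_of nc code) f (p + i, tapes nc x (c, w, h)) =
        (q', (tapes nc x (c, w, h))
           [1 := act (bit_symbol b, Move_Right) (tapes nc x (c, w, h) ! 1)])"
    using assms \<open>9 \<le> p\<close>
    by (intro oracle_step_tm_of[of _ _ 1 g]) (use s b in \<open>auto simp: ins_at_code\<close>)
  thus ?thesis by (simp add: tapes_def act_def string_tape_snoc)
qed

definition f_inc :: "nat \<Rightarrow> frag" where
  "f_inc r = (\<lambda>p. [(3 + r, \<lambda>s. (p + 1, s, Move_Right))])"

definition f_emit :: "bool \<Rightarrow> frag" where
  "f_emit b = (\<lambda>p. [(1, \<lambda>s. (p + 1, bit_symbol b, Move_Right))])"

definition f_move :: "move \<Rightarrow> frag" where
  "f_move m = (\<lambda>p. [(0, \<lambda>s. (p + 1, s, m))])"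

definition f_skip :: frag where
  "f_skip = (\<lambda>p. [])"

definition f_seq :: "frag \<Rightarrow> frag \<Rightarrow> frag" (infixr ";;" 60) where
  "f ;; g = (\<lambda>p. f p @ g (p + length (f p)))"

definition f_rep :: "nat \<Rightarrow> frag \<Rightarrow> frag" where
  "f_rep r f = (\<lambda>p. [(3 + r, \<lambda>s. if s = 3 then (p + 2 + length (f (p + 1)), s, Stay)
                                  else (p + 1, s, Move_Left))] @
                    f (p + 1) @ [(0, \<lambda>s. (p, s, Stay))])"

definition f_if :: "nat \<Rightarrow> frag \<Rightarrow> frag \<Rightarrow> frag" where
  "f_if a f g = (\<lambda>p.
     let q = p + 2 + length (f (p + 1)); e = q + length (g q)
     in [(0, \<lambda>s. (if s = a then p + 1 else q, s, Stay))] @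
        f (p + 1) @ [(0, \<lambda>s. (e, s, Stay))] @ g q)"

lemma triple_skip: "triple nc x f_skip s 0 s"
  by (rule tripleI) (auto simp: f_skip_def)

lemma triple_single:
  assumes F: "\<And>p. F p = [(j, g p)]"
    and step: "\<And>code p f. code_at code p [(j, g p)] \<Longrightarrow> p + 1 < 10 + length code \<Longrightarrow>
      oracle_step (tm_of nc code) f (p + 0, tapes nc x s) = (p + 1, tapes nc x s')"
  shows "triple nc x F s 1 s'"
proof (rule tripleI)
  fix code p f
  assume "code_at code p (F p)"
  thus "\<exists>t'\<le>1. (oracle_step (tm_of nc code) f ^^ t') (p, tapes nc x s) =
     (p + length (F p), tapes nc x s')"
    using step[of code p f] by (intro exI[of _ 1]) (simp add: F code_at_def)
qed

lemma triple_inc: "r < nc \<Longrightarrow> triple nc x (f_inc r) (c, w, h) 1 (c(r := c r + 1), w, h)"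
  by (rule triple_single[OF f_inc_def[THEN fun_cong]])
    (rule step_counter[where m = Move_Right], assumption, simp, rule nth_Cons_0, simp_all)

lemma triple_emit: "triple nc x (f_emit b) (c, w, h) 1 (c, w @ [b], h)"
  by (rule triple_single[OF f_emit_def[THEN fun_cong]])
    (rule step_output, assumption, simp, rule nth_Cons_0, simp_all)

lemma triple_move: "triple nc x (f_move m) (c, w, h) 1 (c, w, move_head m h)"
  by (rule triple_single[OF f_move_def[THEN fun_cong]])
    (rule step_input, assumption, simp, rule nth_Cons_0, simp_all)

lemma triple_seq:
  assumes "triple nc x f s t s'" "triple nc x g s' t' s''"
  shows "triple nc x (f ;; g) s (t + t') s''"
proof (rule tripleI)
  fix code p orc
  assume "code_at code p ((f ;; g) p)"
  hence "code_at code p (f p @ g (p + length (f p)))" by (simp add: f_seq_def)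
  note c = code_at_append[OF this]
  obtain a where a: "a \<le> t" "(oracle_step (tm_of nc code) orc ^^ a) (p, tapes nc x s) =
      (p + length (f p), tapes nc x s')"
    using assms(1) c(1) unfolding triple_def by blast
  obtain b where b: "b \<le> t'" "(oracle_step (tm_of nc code) orc ^^ b)
      (p + length (f p), tapes nc x s') =
      (p + length (f p) + length (g (p + length (f p))), tapes nc x s'')"
    using assms(2) c(2) unfolding triple_def by blast
  have "(oracle_step (tm_of nc code) orc ^^ (b + a)) (p, tapes nc x s) =
      (p + length ((f ;; g) p), tapes nc x s'')"
    unfolding funpow_add comp_def a(2) b(2) by (simp add: f_seq_def)
  thus "\<exists>u\<le>t + t'. (oracle_step (tm_of nc code) orc ^^ u) (p, tapes nc x s) =
      (p + length ((f ;; g) p), tapes nc x s'')"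
    using a(1) b(1) by (intro exI[of _ "b + a"]) simp
qed

text \<open>Here \<open>c i\<close> are the counters before round \<open>i\<close>. The test
  decrements \<open>r\<close> before the body runs, hence \<open>n - i - 1\<close>. A round costs
  the test, the body and the jump back, and the failing test costs one more step.\<close>

lemma triple_rep:
  assumes r: "r < nc"
    and cnt: "\<And>i. i \<le> n \<Longrightarrow> c i r = n - i"
    and body: "\<And>i. i < n \<Longrightarrow>
      triple nc x f ((c i)(r := n - i - 1), w i, h i) t (c (i + 1), w (i + 1), h (i + 1))"
  shows "triple nc x (f_rep r f) (c 0, w 0, h 0) (n * (t + 2) + 1) (c n, w n, h n)"
proof (rule tripleI)
  fix code p orc
  let ?st = "oracle_step (tm_of nc code) orc"
  let ?xs = "f_rep r f p"
  let ?s = "\<lambda>i. tapes nc x (c i, w i, h i)"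
  let ?l = "length (f (p + 1))"
  assume c: "code_at code p ?xs"
  have len: "length ?xs = ?l + 2" by (simp add: f_rep_def)
  have fits: "p + ?l + 2 < 10 + length code" "9 \<le> p" using c by (auto simp: code_at_def len)
  have head: "?xs ! 0 = (3 + r, \<lambda>s. if s = 3 then (p + 2 + ?l, s, Stay)
                                  else (p + 1, s, Move_Left))"
    by (simp add: f_rep_def)
  have last: "?xs ! (1 + ?l) = (0, \<lambda>s. (p, s, Stay))" by (simp add: f_rep_def nth_append)
  have "code_at code (p + 1) (f (p + 1) @ [(0, \<lambda>s. (p, s, Stay))])"
    using c code_at_append(2)[of code p "[(3 + r, \<lambda>s. if s = 3 then (p + 2 + ?l, s, Stay)
                                  else (p + 1, s, Move_Left))]"]
    by (simp add: f_rep_def)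
  hence cb: "code_at code (p + 1) (f (p + 1))" by (rule code_at_append)
  have iter: "\<exists>u \<le> i * (t + 2). (?st ^^ u) (p, ?s 0) = (p, ?s i)" if "i \<le> n" for i
    using that
  proof (induction i)
    case 0
    show ?case by (intro exI[of _ 0]) simp
  next
    case (Suc i)
    then obtain u where u: "u \<le> i * (t + 2)" "(?st ^^ u) (p, ?s 0) = (p, ?s i)" by auto
    have 1: "?st (p + 0, ?s i) = (p + 1, tapes nc x ((c i)(r := n - i - 1), w i, h i))"
      using Suc.prems cnt[of i] r fits
      by (intro step_counter[OF c _ head, where m = Move_Left]) (auto simp: len)
    obtain v where v: "v \<le> t" "(?st ^^ v)
        (p + 1, tapes nc x ((c i)(r := n - i - 1), w i, h i)) = (p + 1 + ?l, ?s (Suc i))"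
      using tripleD[OF body[of i] cb] Suc.prems by (metis Suc_eq_plus1 Suc_le_lessD)
    have 2: "?st (p + (1 + ?l), ?s (Suc i)) = (p, ?s (Suc i))"
      using step_input[OF c _ last, of x "h (Suc i)" p Stay nc orc] fits by (simp add: len)
    have "(?st ^^ (Suc (v + Suc u))) (p, ?s 0) = ?st ((?st ^^ v) (?st ((?st ^^ u) (p, ?s 0))))"
      by (simp only: funpow_add funpow.simps comp_def)
    also have "\<dots> = (p, ?s (Suc i))" using 1 2 u v by (simp add: add.assoc)
    finally show ?case using u(1) v(1)
      by (intro exI[of _ "Suc (v + Suc u)"]) auto
  qed
  obtain u where u: "u \<le> n * (t + 2)" "(?st ^^ u) (p, ?s 0) = (p, ?s n)" using iter by blast
  have "c n r = 0" using cnt[of n] by simp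
  hence "?st (p + 0, ?s n) = (p + 2 + ?l, tapes nc x ((c n)(r := c n r), w n, h n))"
    using r fits by (intro step_counter[OF c _ head, where m = Stay]) (auto simp: len)
  hence "(?st ^^ Suc u) (p, ?s 0) = (p + length ?xs, ?s n)"
    using u by (simp add: len add.assoc add.commute)
  thus "\<exists>t'\<le>n * (t + 2) + 1. (?st ^^ t') (p, ?s 0) = (p + length ?xs, ?s n)"
    using u(1) by (intro exI[of _ "Suc u"]) auto
qed


lemma triple_if:
  assumes "fst (string_tape x) h = a \<Longrightarrow> triple nc x f (c, w, h) t s'"
    and "fst (string_tape x) h \<noteq> a \<Longrightarrow> triple nc x g (c, w, h) t s'"
  shows "triple nc x (f_if a f g) (c, w, h) (t + 2) s'"
proof (rule tripleI)
  fix code p orc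
  let ?st = "oracle_step (tm_of nc code) orc"
  let ?xs = "f_if a f g p"
  define l where "l = length (f (p + 1))"
  define q where "q = p + 2 + l"
  define e where "e = q + length (g q)"
  let ?br = "(0, \<lambda>s. (if s = a then p + 1 else q, s, Stay)) :: ins"
  let ?j = "(0, \<lambda>s. (e, s, Stay)) :: ins"
  assume c: "code_at code p ?xs"
  have xs: "?xs = [?br] @ (f (p + 1) @ ([?j] @ g q))"
    unfolding f_if_def Let_def e_def q_def l_def by simp
  have e: "e = p + length ?xs" unfolding xs by (simp add: e_def q_def l_def)
  have fits: "e < 10 + length code" "9 \<le> p" using c e by (auto simp: code_at_def)
  note c' = code_at_append(2)[OF c[unfolded xs]]
  have cf: "code_at code (p + 1) (f (p + 1))" using code_at_append(1)[OF c'] by simp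
  have cg: "code_at code q (g q)"
    using code_at_append(2)[OF code_at_append(2)[OF c']]
    by (simp add: q_def l_def add.commute add.left_commute)
  have first: "?st (p + 0, tapes nc x (c, w, h)) =
     (if fst (string_tape x) h = a then p + 1 else q, tapes nc x (c, w, move_head Stay h))"
    using fits by (intro step_input[OF c, of _ "snd ?br"]) (auto simp: xs e_def q_def)
  have fin: "\<exists>t'\<le>t + 2. (?st ^^ t') (p, tapes nc x (c, w, h)) = (p + length ?xs, tapes nc x s')"
    if "v \<le> t + 1" "?st (p, tapes nc x (c, w, h)) = s1" "(?st ^^ v) s1 = (e, tapes nc x s')" for v s1
    using that e by (intro exI[of _ "Suc v"]) (simp add: funpow_swap1)
  show "\<exists>t'\<le>t + 2. (?st ^^ t') (p, tapes nc x (c, w, h)) = (p + length ?xs, tapes nc x s')"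
  proof (cases "fst (string_tape x) h = a")
    case True
    obtain v where v: "v \<le> t" "(?st ^^ v) (p + 1, tapes nc x (c, w, h)) = (p + (1 + l), tapes nc x s')"
      using tripleD[OF assms(1)[OF True] cf] unfolding l_def by (metis add.assoc)
    have "?st (p + (1 + l), tapes nc x s') = (e, tapes nc x s')"
    proof -
      obtain c' w' h' where "s' = (c', w', h')" by (cases s') auto
      moreover have "?st (p + (1 + l), tapes nc x (c', w', h')) =
          (e, tapes nc x (c', w', move_head Stay h'))"
        using fits by (intro step_input[OF c, of _ "snd ?j"]) (auto simp: xs l_def nth_append)
      ultimately show ?thesis by simp
    qed
    thus ?thesis using fin[of "Suc v"] first v True by simp
  next
    case False
    obtain v where v: "v \<le> t" "(?st ^^ v) (q, tapes nc x (c, w, h)) = (e, tapes nc x s')"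
      using tripleD[OF assms(2)[OF False] cg] unfolding e_def by metis
    show ?thesis using fin[of v] first v False by simp
  qed
qed

text \<open>While \<open>f\<close> runs, counter \<open>u\<close>, initially 0, holds the number of the iteration, and \<open>r\<close> the
  number of iterations still to come after this one. Both counters are restored in the end.\<close>

definition f_for :: "nat \<Rightarrow> nat \<Rightarrow> frag \<Rightarrow> frag" where
  "f_for r u f = f_rep r (f ;; f_inc u) ;; f_rep u (f_inc r)"

text \<open>The overhead 6 per round consists of the increment of \<open>u\<close>, two steps of the
  first loop, and three steps in the second loop, which drains \<open>u\<close> back into
  \<open>r\<close>.\<close>

lemma triple_for:
  assumes ru: "r < nc" "u < nc" "r \<noteq> u"
    and body: "\<And>i. i < n \<Longrightarrow> triple nc x f ((c i)(r := n - i - 1, u := i), w i, h i) t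
      ((c (i + 1))(r := n - i - 1, u := i), w (i + 1), h (i + 1))"
  shows "triple nc x (f_for r u f) ((c 0)(r := n, u := 0), w 0, h 0) (n * (t + 6) + 2)
    ((c n)(r := n, u := 0), w n, h n)"
proof -
  let ?c1 = "\<lambda>i. (c i)(r := n - i, u := i)" and ?c2 = "\<lambda>i. (c n)(r := i, u := n - i)"
  have "triple nc x (f_rep r (f ;; f_inc u)) (?c1 0, w 0, h 0) (n * (t + 1 + 2) + 1) (?c1 n, w n, h n)"
  proof (rule triple_rep)
    fix i assume "i < n"
    have "(?c1 i)(r := n - i - 1) = (c i)(r := n - i - 1, u := i)" using ru by auto
    moreover have "((c (i + 1))(r := n - i - 1, u := i))(u := i + 1) = ?c1 (i + 1)" by auto
    ultimately show "triple nc x (f ;; f_inc u) ((?c1 i)(r := n - i - 1), w i, h i) (t + 1)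
        (?c1 (i + 1), w (i + 1), h (i + 1))"
      using triple_seq[OF body[OF \<open>i < n\<close>] triple_inc[OF ru(2)]] by simp
  qed (use ru in auto)
  moreover have "triple nc x (f_rep u (f_inc r)) (?c2 0, w n, h n) (n * (1 + 2) + 1) (?c2 n, w n, h n)"
  proof (rule triple_rep)
    fix i assume "i < n"
    have "((c n)(r := i, u := n - i - 1))(r := i + 1) = ?c2 (i + 1)" using ru by auto
    moreover have "(?c2 i)(u := n - i - 1) = (c n)(r := i, u := n - i - 1)" by auto
    ultimately show "triple nc x (f_inc r) ((?c2 i)(u := n - i - 1), w n, h n) 1
        (?c2 (i + 1), w n, h n)"
      using triple_inc[OF ru(1), of x "(c n)(r := i, u := n - i - 1)" "w n" "h n"] ru(3) by simp
  qed (use ru in auto)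
  ultimately show ?thesis
    unfolding f_for_def using ru(3)
    by (auto intro!: triple_mono[OF triple_seq] simp: algebra_simps)
qed

lemma triple_shift:
  assumes ru: "r < nc" "u < nc" "r \<noteq> u" "c u = 0"
    and h: "\<And>i. move_head m (h i) = h (i + 1)"
  shows "triple nc x (f_for r u (f_move m)) (c, w, h 0) (c r * 7 + 2) (c, w, h (c r))"
proof -
  have c: "c(r := c r, u := 0) = c" using ru by auto
  have "triple nc x (f_for r u (f_move m)) (c(r := c r, u := 0), w, h 0)
      (c r * (1 + 6) + 2) (c(r := c r, u := 0), w, h (c r))"
    using triple_move[of nc x m _ w "h _"] unfolding h by (intro triple_for ru)
  thus ?thesis unfolding c by (simp add: mult.commute)
qed

lemma triple_forward:
  assumes "r < nc" "u < nc" "r \<noteq> u" "c u = 0"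
  shows "triple nc x (f_for r u (f_move Move_Right)) (c, w, 0) (c r * 7 + 2) (c, w, int (c r))"
  using triple_shift[where c = c, OF assms, of Move_Right int x w] by (simp add: add.commute)

lemma triple_rewind:
  assumes "r < nc" "u < nc" "r \<noteq> u" "c u = 0"
  shows "triple nc x (f_for r u (f_move Move_Left)) (c, w, int (c r)) (c r * 7 + 2) (c, w, 0)"
  using triple_shift[where c = c, OF assms, of Move_Left "\<lambda>i. int (c r) - int i" x w] by simp

section \<open>Programs that write output\<close>

definition zeros :: "nat set \<Rightarrow> (nat \<Rightarrow> nat) \<Rightarrow> bool" where
  "zeros Z c \<longleftrightarrow> (\<forall>r\<in>Z. c r = 0)"

text \<open>The polynomial depends on the program only and is applied to a bound on the counters. The
  counters in \<open>Z\<close> are auxiliary.\<close>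

definition emits :: "nat \<Rightarrow> ('a \<Rightarrow> bool list) \<Rightarrow> frag \<Rightarrow> nat set \<Rightarrow>
    (bool list \<Rightarrow> (nat \<Rightarrow> nat) \<Rightarrow> 'a list) \<Rightarrow> bool" where
  "emits nc h f Z I \<longleftrightarrow> (\<exists>tf :: nat poly. \<forall>x c B w. zeros Z c \<longrightarrow> (\<forall>r. c r \<le> B) \<longrightarrow>
     triple nc x f (c, w, 0) (poly tf B) (c, w @ concat (map h (I x c)), 0))"

lemma emits_weaken:
  assumes "emits nc h f Z I" "Z \<subseteq> Z'" "\<And>x c. zeros Z' c \<Longrightarrow> I x c = J x c"
  shows "emits nc h f Z' J"
proof -
  have "zeros Z' c \<Longrightarrow> zeros Z c" for c using assms(2) by (auto simp: zeros_def)
  thus ?thesis using assms unfolding emits_def by metis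
qed

lemma emits_subset: "emits nc h f Z I \<Longrightarrow> Z \<subseteq> Z' \<Longrightarrow> emits nc h f Z' I"
  by (elim emits_weaken) auto

lemma emits_emit: "emits nc (\<lambda>b. [b]) (f_emit b) Z (\<lambda>_ _. [b])"
  unfolding emits_def by (rule exI[of _ 1]) (simp add: triple_emit[simplified])

lemma emits_seq:
  assumes "emits nc h f Z I" "emits nc h g Z J"
  shows "emits nc h (f ;; g) Z (\<lambda>x c. I x c @ J x c)"
proof -
  obtain tf where tf: "\<And>x c B w. zeros Z c \<Longrightarrow> (\<forall>r. c r \<le> B) \<Longrightarrow>
     triple nc x f (c, w, 0) (poly tf B) (c, w @ concat (map h (I x c)), 0)"
    using assms(1) unfolding emits_def by blast
  obtain tg where tg: "\<And>x c B w. zeros Z c \<Longrightarrow> (\<forall>r. c r \<le> B) \<Longrightarrow>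
     triple nc x g (c, w, 0) (poly tg B) (c, w @ concat (map h (J x c)), 0)"
    using assms(2) unfolding emits_def by blast
  have "triple nc x (f ;; g) (c, w, 0) (poly (tf + tg) B) (c, w @ concat (map h (I x c @ J x c)), 0)"
    if "zeros Z c" "\<forall>r. c r \<le> B" for x c B w
    using triple_seq[OF tf[OF that] tg[OF that]] by simp
  thus ?thesis unfolding emits_def by blast
qed

definition f_seqs :: "frag list \<Rightarrow> frag" where
  "f_seqs fs = foldr (;;) fs f_skip"

lemma emits_seqs:
  assumes "\<And>y. y \<in> set ys \<Longrightarrow> emits nc h (F y) Z (I y)"
  shows "emits nc h (f_seqs (map F ys)) Z (\<lambda>x c. concat (map (\<lambda>y. I y x c) ys))"
  using assms
proof (induction ys)
  case Nil
  show ?case unfolding emits_def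
    by (rule exI[of _ 0]) (simp add: triple_skip f_seqs_def)
next
  case (Cons y ys)
  thus ?case using emits_seq[of nc h "F y" Z "I y"] by (simp add: f_seqs_def)
qed

lemma concat_map_concat:
  "concat (map h (concat (map F xs))) = concat (map (\<lambda>y. concat (map h (F y))) xs)"
  by (induction xs) auto

text \<open>Inside the body \<open>u\<close> is the index, so it leaves the set of counters known to
  be zero. Both loop counters stay below \<open>c r \<le> B\<close> during the loop, so
  \<open>poly tf B\<close> bounds every round.\<close>

lemma emits_for:
  assumes ru: "r < nc" "u < nc" "r \<noteq> u" "u \<in> Z" "r \<notin> Z"
    and f: "emits nc h f (Z - {u}) I"
  shows "emits nc h (f_for r u f) Z
     (\<lambda>x c. concat (map (\<lambda>i. I x (c(r := c r - i - 1, u := i))) [0..<c r]))"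
proof -
  obtain tf where tf: "\<And>x c B w. zeros (Z - {u}) c \<Longrightarrow> (\<forall>r. c r \<le> B) \<Longrightarrow>
     triple nc x f (c, w, 0) (poly tf B) (c, w @ concat (map h (I x c)), 0)"
    using f unfolding emits_def by blast
  have "triple nc x (f_for r u f) (c, w, 0) (poly ([:2:] + [:0, 1:] * (tf + [:6:])) B) (c, w @ concat
     (map h (concat (map (\<lambda>i. I x (c(r := c r - i - 1, u := i))) [0..<c r]))), 0)"
    if Z: "zeros Z c" and B: "\<forall>r. c r \<le> B" for x c B w
  proof -
    let ?w = "\<lambda>k. w @ concat (map h (concat (map (\<lambda>i. I x (c(r := c r - i - 1, u := i))) [0..<k])))"
    have "triple nc x (f_for r u f) (c(r := c r, u := 0), ?w 0, 0) (c r * (poly tf B + 6) + 2)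
       (c(r := c r, u := 0), ?w (c r), 0)"
    proof (rule triple_for[OF ru(1-3)])
      fix i assume i: "i < c r"
      have "\<forall>s. (c(r := c r - i - 1, u := i)) s \<le> B"
        using B i by (metis diff_le_self fun_upd_apply le_trans less_imp_le_nat)
      moreover have "zeros (Z - {u}) (c(r := c r - i - 1, u := i))"
        using Z ru(5) by (auto simp: zeros_def)
      ultimately show "triple nc x f (c(r := c r - i - 1, u := i), ?w i, 0) (poly tf B)
          (c(r := c r - i - 1, u := i), ?w (i + 1), 0)"
        using tf[of "c(r := c r - i - 1, u := i)" B x "?w i"] by (simp del: fun_upd_apply)
    qed
    moreover have "c(r := c r, u := 0) = c" using Z ru(4) by (auto simp: zeros_def)
    moreover have "c r * (poly tf B + 6) + 2 \<le> poly ([:2:] + [:0, 1:] * (tf + [:6:])) B"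
      using B by simp
    ultimately show ?thesis by (auto elim: triple_mono)
  qed
  thus ?thesis unfolding emits_def by blast
qed

text \<open>The control state remembers the symbol read, so the input head can return to cell 0
  before the selected fragment runs. Thus all fragments start and end with the head on cell
  0.\<close>

definition f_read :: "nat \<Rightarrow> nat \<Rightarrow> frag \<Rightarrow> frag \<Rightarrow> frag \<Rightarrow> frag" where
  "f_read r u f0 f1 f2 =
     (let back = f_for r u (f_move Move_Left)
      in f_for r u (f_move Move_Right) ;; f_if 0 (back ;; f0) (f_if 1 (back ;; f1) (back ;; f2)))"

lemma emits_read:
  assumes ru: "r < nc" "u < nc" "r \<noteq> u" "u \<in> Z"
    and f: "\<And>a. a < 3 \<Longrightarrow> emits nc h (f a) Z (I a)"
  shows "emits nc h (f_read r u (f 0) (f 1) (f 2)) Z (\<lambda>x c. I (input_symbol x (c r)) x c)"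
proof -
  have "\<forall>a. \<exists>tf :: nat poly. a < 3 \<longrightarrow> (\<forall>x c B w. zeros Z c \<longrightarrow> (\<forall>r. c r \<le> B) \<longrightarrow>
     triple nc x (f a) (c, w, 0) (poly tf B) (c, w @ concat (map h (I a x c)), 0))"
    using f unfolding emits_def by blast
  then obtain t where t: "\<And>a x c B w. a < 3 \<Longrightarrow> zeros Z c \<Longrightarrow> (\<forall>r. c r \<le> B) \<Longrightarrow>
     triple nc x (f a) (c, w, 0) (poly (t a :: nat poly) B) (c, w @ concat (map h (I a x c)), 0)"
    by metis
  have "triple nc x (f_read r u (f 0) (f 1) (f 2)) (c, w, 0)
     (poly ([:8:] + [:0, 14:] + (t 0 + t 1 + t 2)) B)
     (c, w @ concat (map h (I (input_symbol x (c r)) x c)), 0)"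
    if Z: "zeros Z c" and B: "\<forall>r. c r \<le> B" for x c B w
  proof -
    let ?t = "c r * 7 + 2" and ?b = "f_for r u (f_move Move_Left)"
    have "c u = 0" using Z ru(4) by (simp add: zeros_def)
    note go = triple_forward[where c = c, OF ru(1-3) this, of x w]
      and ret = triple_rewind[where c = c, OF ru(1-3) this, of x w]
    have sym: "fst (string_tape x) (int (c r)) = input_symbol x (c r)"
      by (simp add: string_tape_def input_symbol_def)
    let ?T = "?t + poly (t 0 + t 1 + t 2) B"
    have input: "input_symbol x (c r) \<in> {0, 1, 2}" by (auto simp: input_symbol_def bit_symbol_def)
    have body: "triple nc x (?b ;; f a) (c, w, int (c r)) ?T (c, w @ concat (map h (I a x c)), 0)"
      if "a \<in> {0, 1, 2}" for a
      using that by (intro triple_mono[OF triple_seq[OF ret t[OF _ Z B]]]) auto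
    note body2 = triple_mono[OF body le_add1, of _ 2]
    have "triple nc x (f_if 0 (?b ;; f 0) (f_if 1 (?b ;; f 1) (?b ;; f 2))) (c, w, int (c r)) (?T + 2 + 2)
        (c, w @ concat (map h (I (input_symbol x (c r)) x c)), 0)"
      using input body body2 by (intro triple_if) (auto simp: sym)
    from triple_seq[OF go this]
    have "triple nc x (f_read r u (f 0) (f 1) (f 2)) (c, w, 0) (?t + (?T + 2 + 2))
        (c, w @ concat (map h (I (input_symbol x (c r)) x c)), 0)"
      by (simp add: f_read_def Let_def)
    moreover have "?t + (?T + 2 + 2) \<le> poly ([:8:] + [:0, 14:] + (t 0 + t 1 + t 2)) B"
      using B[rule_format, of r] by simp
    ultimately show ?thesis by (rule triple_mono)
  qed
  thus ?thesis unfolding emits_def by blast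
qed

text \<open>Changes the granularity: the same program may be seen as writing bits, edges or items.
  Loops are verified at the level at which their output is a simple list.\<close>

lemma emits_regroup:
  "emits nc h f Z (\<lambda>x c. concat (map g (I x c))) \<longleftrightarrow> emits nc (\<lambda>a. concat (map h (g a))) f Z I"
  unfolding emits_def by (simp add: concat_map_concat)

section \<open>Solving a problem with one query\<close>

text \<open>Time bounds are polynomials in a bound on the counters. Hence the computed counters need
  a polynomial bound \<open>gf\<close> too, and sequential composition composes polynomials.\<close>

definition setup_prog ::
    "nat \<Rightarrow> frag \<Rightarrow> ((nat \<Rightarrow> nat) \<Rightarrow> bool) \<Rightarrow> ((nat \<Rightarrow> nat) \<Rightarrow> nat \<Rightarrow> nat) \<Rightarrow> bool" where
  "setup_prog nc f P F \<longleftrightarrow> (\<exists>(tf :: nat poly) (gf :: nat poly). \<forall>x c B w.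
     P c \<longrightarrow> (\<forall>r. c r \<le> B) \<longrightarrow>
     triple nc x f (c, w, 0) (poly tf B) (F c, w, 0) \<and> (\<forall>r. F c r \<le> poly gf B))"

lemma setup_seq:
  assumes "setup_prog nc f P F" "setup_prog nc g Q G" "\<And>c. P c \<Longrightarrow> Q (F c)"
  shows "setup_prog nc (f ;; g) P (\<lambda>c. G (F c))"
proof -
  obtain tf gf :: "nat poly" where f: "\<And>x c B w. P c \<Longrightarrow> (\<forall>r. c r \<le> B) \<Longrightarrow>
     triple nc x f (c, w, 0) (poly tf B) (F c, w, 0) \<and> (\<forall>r. F c r \<le> poly gf B)"
    using assms(1) unfolding setup_prog_def by blast
  obtain tg gg :: "nat poly" where g: "\<And>x c B w. Q c \<Longrightarrow> (\<forall>r. c r \<le> B) \<Longrightarrow>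
     triple nc x g (c, w, 0) (poly tg B) (G c, w, 0) \<and> (\<forall>r. G c r \<le> poly gg B)"
    using assms(2) unfolding setup_prog_def by blast
  have "triple nc x (f ;; g) (c, w, 0) (poly (tf + pcompose tg gf) B) (G (F c), w, 0) \<and>
        (\<forall>r. G (F c) r \<le> poly (pcompose gg gf) B)" if "P c" "\<forall>r. c r \<le> B" for x c B w
    using triple_seq[of nc x f "(c, w, 0)" _ "(F c, w, 0)"] f[OF that] g[OF assms(3)[OF that(1)]]
    by (simp add: poly_pcompose)
  thus ?thesis unfolding setup_prog_def by blast
qed

lemma setup_skip: "setup_prog nc f_skip P (\<lambda>c. c)"
  unfolding setup_prog_def
  by (rule exI[of _ 0], rule exI[of _ "[:0, 1:]"]) (simp add: triple_skip)

lemma setup_inc: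
  assumes "s < nc"
  shows "setup_prog nc (f_inc s) P (\<lambda>c. c(s := c s + 1))"
  unfolding setup_prog_def
proof (rule exI[of _ 1], rule exI[of _ "[:1, 1:]"], intro allI impI conjI)
  fix x w B r and c :: "nat \<Rightarrow> nat"
  assume B: "\<forall>r. c r \<le> B"
  show "triple nc x (f_inc s) (c, w, 0) (poly 1 B) (c(s := c s + 1), w, 0)"
    using triple_inc[OF assms] by simp
  show "(c(s := c s + 1)) r \<le> poly [:1, 1:] B"
    using B by (simp add: le_SucI)
qed

definition f_add_const :: "nat \<Rightarrow> nat \<Rightarrow> frag" where
  "f_add_const s k = f_seqs (replicate k (f_inc s))"

lemma setup_add_const:
  assumes "s < nc"
  shows "setup_prog nc (f_add_const s k) P (\<lambda>c. c(s := c s + k))"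
proof (induction k arbitrary: P)
  case 0
  show ?case using setup_skip by (simp add: f_add_const_def f_seqs_def)
next
  case (Suc k)
  have "setup_prog nc (f_inc s ;; f_add_const s k) P (\<lambda>c. (c(s := c s + 1))(s := (c(s := c s + 1)) s + k))"
    by (rule setup_seq[OF setup_inc[OF assms] Suc.IH]) (rule TrueI)
  moreover have "(\<lambda>c. (c(s := c s + 1))(s := (c(s := c s + 1)) s + k)) = (\<lambda>c. c(s := c s + Suc k))"
    by (auto simp: fun_eq_iff)
  ultimately show ?case by (simp only: f_add_const_def f_seqs_def replicate.simps foldr.simps comp_def)
qed

definition f_add_prod :: "nat \<Rightarrow> nat \<Rightarrow> nat \<Rightarrow> nat \<Rightarrow> nat \<Rightarrow> frag" where
  "f_add_prod u v s a b = f_for a u (f_for b v (f_inc s))"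

lemma setup_add_prod:
  assumes nc: "u < nc" "v < nc" "s < nc" "a < nc" "b < nc"
    and d: "distinct [u, v, s, a, b]"
    and P: "\<And>c. P c \<Longrightarrow> c u = 0 \<and> c v = 0"
  shows "setup_prog nc (f_add_prod u v s a b) P (\<lambda>c. c(s := c s + c a * c b))"
  unfolding setup_prog_def
\<comment> \<open>The nested loops take a (7 b + 2 + 6) + 2 steps for factors a and b, and the new
  value of \<open>s\<close> is at most B + B^2.\<close>
proof (rule exI[of _ "[:2, 8, 7:]"], rule exI[of _ "[:0, 1, 1:]"], intro allI impI conjI)
  fix x c B w
  assume "P c" and B: "\<forall>r. c r \<le> B"
  note z = P[OF \<open>P c\<close>]
  let ?t = "c b * (1 + 6) + 2"
  have "triple nc x (f_add_prod u v s a b) ((c(s := c s + 0 * c b))(a := c a, u := 0), w, 0)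
     (c a * (?t + 6) + 2) ((c(s := c s + c a * c b))(a := c a, u := 0), w, 0)"
    unfolding f_add_prod_def
  proof (rule triple_for)
    fix i
    let ?c = "\<lambda>j. (c(s := c s + i * c b + j))(a := c a - i - 1, u := i)"
    have eq: "(?c j)(b := c b, v := 0) = ?c j" for j
      using d z by (auto simp: fun_eq_iff)
    have "triple nc x (f_for b v (f_inc s)) ((?c 0)(b := c b, v := 0), w, 0) ?t
      ((?c (c b))(b := c b, v := 0), w, 0)"
    proof (rule triple_for)
      fix j
      have "((?c j)(b := c b - j - 1, v := j))(s := ((?c j)(b := c b - j - 1, v := j)) s + 1) =
        (?c (j + 1))(b := c b - j - 1, v := j)"
        using d by (auto simp: fun_eq_iff)
      thus "triple nc x (f_inc s) ((?c j)(b := c b - j - 1, v := j), w, 0) 1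
        ((?c (j + 1))(b := c b - j - 1, v := j), w, 0)"
        using triple_inc[OF nc(3), of x "(?c j)(b := c b - j - 1, v := j)" w 0] by metis
    qed (use nc d in auto)
    from this[unfolded eq] show "triple nc x (f_for b v (f_inc s))
       ((c(s := c s + i * c b))(a := c a - i - 1, u := i), w, 0) ?t
       ((c(s := c s + (i + 1) * c b))(a := c a - i - 1, u := i), w, 0)"
      by (simp add: algebra_simps)
  qed (use nc d in auto)
  moreover have "(c(s := k))(a := c a, u := 0) = c(s := k)" "c(u := 0) = c" for k
    using d z by (auto simp: fun_eq_iff)
  moreover have "c a * (?t + 6) + 2 \<le> poly [:2, 8, 7:] B"
  proof -
    have "c a * (c b * 7 + 8) \<le> B * (B * 7 + 8)"
      using B by (intro mult_le_mono add_le_mono) auto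
    thus ?thesis by (simp add: algebra_simps)
  qed
  ultimately show "triple nc x (f_add_prod u v s a b) (c, w, 0) (poly [:2, 8, 7:] B)
     (c(s := c s + c a * c b), w, 0)"
    by (auto elim: triple_mono)
  fix r
  have "c s + c a * c b \<le> B + B * B" using B by (intro add_mono mult_mono) auto
  thus "(c(s := c s + c a * c b)) r \<le> poly [:0, 1, 1:] B"
    using B[rule_format, of r] by (auto simp: algebra_simps intro: trans_le_add1)
qed

definition f_scan :: "nat \<Rightarrow> frag" where
  "f_scan r = (\<lambda>p. [(0, \<lambda>s. (if s = 0 then p + 3 else p + 1, s, Stay)),
     (3 + r, \<lambda>s. (p + 2, s, Move_Right)), (0, \<lambda>s. (p, s, Move_Right))])"

lemma triple_scan:
  assumes "r < nc"
  shows "triple nc x (f_scan r) (c, w, 0) (3 * length x + 1)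
    (c(r := c r + length x), w, int (length x))"
proof (rule tripleI)
  fix code p orc
  let ?st = "oracle_step (tm_of nc code) orc"
  let ?xs = "f_scan r p"
  let ?s = "\<lambda>i. tapes nc x (c(r := c r + i), w, int i)"
  assume c: "code_at code p ?xs"
  hence fits: "p + 3 < 10 + length code" "9 \<le> p" by (auto simp: code_at_def f_scan_def)
  have x0: "?xs ! 0 = (0, \<lambda>s. (if s = 0 then p + 3 else p + 1, s, Stay))"
    and x1: "?xs ! 1 = (3 + r, \<lambda>s. (p + 2, s, Move_Right))"
    and x2: "?xs ! 2 = (0, \<lambda>s. (p, s, Move_Right))"
    and len: "length ?xs = 3"
    by (simp_all add: f_scan_def)
  have sym: "fst (string_tape x) (int i) = 0 \<longleftrightarrow> \<not> i < length x" for i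
    by (simp add: string_tape_def bit_symbol_def)
  have iter: "(?st ^^ (3 * i)) (p, ?s 0) = (p, ?s i)" if "i \<le> length x" for i
    using that
  proof (induction i)
    case 0
    show ?case by simp
  next
    case (Suc i)
    have IH: "(?st ^^ (3 * i)) (p, ?s 0) = (p, ?s i)"
      by (rule Suc.IH) (use Suc.prems in simp)
    have "?st (p + 0, ?s i) = (p + 1, tapes nc x (c(r := c r + i), w, move_head Stay (int i)))"
      using sym[of i] Suc.prems fits by (intro step_input[OF c _ x0]) (auto simp: len)
    hence 1: "?st (p, ?s i) = (p + 1, ?s i)" by (simp del: fun_upd_apply)
    have "?st (p + 1, ?s i) = (p + 2, tapes nc x ((c(r := c r + i))(r := c r + Suc i), w, int i))"
      using assms fits
      by (intro step_counter[OF c _ x1, where m = Move_Right]) (auto simp: len)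
    hence 2: "?st (p + 1, ?s i) = (p + 2, tapes nc x (c(r := c r + Suc i), w, int i))"
      by (simp del: fun_upd_apply)
    have "?st (p + 2, tapes nc x (c(r := c r + Suc i), w, int i)) =
        (p, tapes nc x (c(r := c r + Suc i), w, move_head Move_Right (int i)))"
      using fits by (intro step_input[OF c _ x2]) (auto simp: len)
    hence 3: "?st (p + 2, tapes nc x (c(r := c r + Suc i), w, int i)) = (p, ?s (Suc i))"
      by (simp del: fun_upd_apply add: add.commute)
    have "(?st ^^ (3 * Suc i)) (p, ?s 0) = ?st (?st (?st ((?st ^^ (3 * i)) (p, ?s 0))))"
      by (simp add: numeral_3_eq_3)
    also have "\<dots> = (p, ?s (Suc i))" unfolding IH 1 2 3 ..
    finally show ?case .
  qed
  have "?st (p + 0, ?s (length x)) =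
      (p + 3, tapes nc x (c(r := c r + length x), w, move_head Stay (int (length x))))"
    using sym[of "length x"] fits by (intro step_input[OF c _ x0]) (auto simp: len)
  hence "(?st ^^ Suc (3 * length x)) (p, ?s 0) = (p + 3, ?s (length x))"
    using iter[of "length x"] by simp
  thus "\<exists>t'\<le>3 * length x + 1. (?st ^^ t') (p, tapes nc x (c, w, 0)) =
      (p + length ?xs, tapes nc x (c(r := c r + length x), w, int (length x)))"
    by (intro exI[of _ "Suc (3 * length x)"]) (simp add: f_scan_def)
qed

text \<open>Counter tapes start blank, and zero tests work only once cell 0 is marked. Instruction
  \<open>r\<close> has state \<open>9 + r\<close>, hence the successor
  \<open>10 + r\<close>.\<close>

definition mark_code :: "nat \<Rightarrow> ins list" where
  "mark_code nc = map (\<lambda>r. (3 + r, \<lambda>s. (10 + r, 3, Stay))) [0..<nc]"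

lemma mark_counters:
  assumes pre: "take nc code = mark_code nc" "nc \<le> length code"
  shows "(oracle_step (tm_of nc code) f ^^ (nc + 1)) (init_config (tm_of nc code) [x]) =
    (9 + nc, tapes nc x (\<lambda>_. 0, [], 0))"
proof -
  let ?st = "oracle_step (tm_of nc code) f"
  let ?ts = "\<lambda>i. string_tape x # string_tape [] # string_tape [] #
    map (\<lambda>r. if r < i then (counter_tape, 0) else string_tape []) [0..<nc]"
  have init: "init_config (tm_of nc code) [x] = (0, ?ts 0)"
    by (auto simp: init_config_def tm_of_def start_state_def nth_Cons upt_rec[of 0] map_upt_Suc
        intro!: nth_equalityI split: nat.splits)
  have "?st (0, ?ts 0) = (9, (?ts 0)[0 := act (head_symbol (?ts 0 ! 0), Stay) (?ts 0 ! 0)])"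
    using string_tape_sym[of x 0]
    by (intro oracle_step_tm_of) (auto simp: ins_at_def head_symbol_def string_tape_def)
  hence start: "?st (0, ?ts 0) = (9, ?ts 0)"
    by (simp add: act_head)
  have "(?st ^^ (i + 1)) (0, ?ts 0) = (9 + i, ?ts i)" if "i \<le> nc" for i
    using that
  proof (induction i)
    case 0
    show ?case using start by simp
  next
    case (Suc i)
    have "code ! i = (3 + i, \<lambda>s. (10 + i, 3, Stay))"
      using Suc.prems nth_take[of i nc code] unfolding pre(1) by (simp add: mark_code_def)
    hence "ins_at code (9 + i) = (3 + i, \<lambda>s. (10 + i, 3, Stay))"
      using Suc.prems pre(2) by (simp add: ins_at_def)
    hence "?st (9 + i, ?ts i) = (10 + i, (?ts i)[3 + i := act (3, Stay) (?ts i ! (3 + i))])"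
      using Suc.prems pre(2) by (intro oracle_step_tm_of) auto
    also have "(?ts i)[3 + i := act (3, Stay) (?ts i ! (3 + i))] = ?ts (Suc i)"
      using Suc.prems
      by (auto intro!: nth_equalityI simp: numeral_3_eq_3 nth_list_update act_def
          string_tape_def counter_tape_def fun_eq_iff)
    finally show ?case using Suc by simp
  qed
  from this[of nc] have "(?st ^^ (nc + 1)) (0, ?ts 0) = (9 + nc, ?ts nc)" by simp
  moreover have "?ts nc = tapes nc x (\<lambda>_. 0, [], 0)"
    by (simp add: tapes_def string_tape_def)
  ultimately show ?thesis unfolding init by simp
qed


section \<open>Reading the answer\<close>

definition reads :: "nat \<Rightarrow> ins list \<Rightarrow> (bool list \<Rightarrow> bool list option) \<Rightarrow> tape list \<Rightarrow> bool list \<Rightarrow>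
    nat \<Rightarrow> bool list \<Rightarrow> nat \<Rightarrow> bool" where
  "reads nc code f ts y q w q' \<longleftrightarrow> (\<forall>i. (\<exists>rest. drop i y = w @ rest) \<longrightarrow>
     (oracle_step (tm_of nc code) f ^^ length w) (q, ts[2 := (fst (string_tape y), int i)]) =
     (q', ts[2 := (fst (string_tape y), int (i + length w))]))"

context
  fixes nc :: nat and code :: "ins list" and f :: "bool list \<Rightarrow> bool list option"
    and ts :: "tape list" and y :: "bool list"
  assumes len: "length ts = 3 + nc"
begin

abbreviation "rd \<equiv> reads nc code f ts y"

abbreviation "ostep \<equiv> oracle_step (tm_of nc code) f"

abbreviation "at_pos i \<equiv> ts[2 := (fst (string_tape y), i)]"

lemma reads_append:
  assumes "rd q w q'" "rd q' w' q''"
  shows "rd q (w @ w') q''"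
  unfolding reads_def
proof (intro allI impI)
  fix i assume "\<exists>rest. drop i y = (w @ w') @ rest"
  then obtain rest where r: "drop i y = w @ (w' @ rest)" by auto
  hence "drop (i + length w) y = w' @ rest"
    by (metis add.commute append_eq_conv_conj drop_drop)
  with r assms have "(ostep ^^ length w)
        (q, at_pos (int i)) =
        (q', at_pos (int (i + length w)))"
    "(ostep ^^ length w')
        (q', at_pos (int (i + length w))) =
        (q'', at_pos (int (i + length w + length w')))"
    unfolding reads_def by blast+
  moreover have "length (w @ w') = length w' + length w" by simp
  ultimately show "(ostep ^^ length (w @ w'))
        (q, at_pos (int i)) =
        (q'', at_pos (int (i + length (w @ w'))))"
    by (simp only: funpow_add comp_def add.assoc length_append)
qed

lemma step_answer:
  assumes "ins_at code q = (2, g)" "q \<notin> {1, 2, 3}"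
    and "g (input_symbol y i) = (q', input_symbol y i, m)" "q' < 10"
  shows "ostep (q, at_pos (int i)) =
    (q', at_pos (move_head m (int i)))"
proof -
  have s: "head_symbol (fst (string_tape y), int i) = input_symbol y i"
    by (simp add: head_symbol_def string_tape_def input_symbol_def)
  have b: "input_symbol y i < 4" by (simp add: input_symbol_def bit_symbol_def)
  have "ostep (q, at_pos (int i)) =
    (q', (at_pos (int i))
      [2 := act (input_symbol y i, m) (at_pos (int i) ! 2)])"
    using assms len b by (intro oracle_step_tm_of[of _ _ 2 g]) (auto simp: s)
  moreover have "(fst (string_tape y))(int i := input_symbol y i) = fst (string_tape y)"
    by (auto simp: string_tape_def input_symbol_def)
  ultimately show ?thesis using len by (simp add: act_def)
qed

lemma reads_single:
  assumes "ins_at code q = (2, g)" "q \<notin> {1, 2, 3}"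
    and "g (bit_symbol b) = (q', bit_symbol b, Move_Right)" "q' < 10"
  shows "rd q [b] q'"
  unfolding reads_def
proof (intro allI impI)
  fix i assume "\<exists>rest. drop i y = [b] @ rest"
  then obtain rest where r: "drop i y = b # rest" by auto
  hence "i < length y" by (metis drop_all list.discI not_le)
  moreover have "y ! i = b" using r \<open>i < length y\<close> by (metis Cons_nth_drop_Suc list.inject)
  ultimately have sym: "input_symbol y i = bit_symbol b" by (simp add: input_symbol_def)
  have "ostep (q, at_pos (int i)) =
    (q', at_pos (move_head Move_Right (int i)))"
    by (rule step_answer[OF assms(1,2)]) (use assms in \<open>auto simp: sym\<close>)
  thus "(ostep ^^ length [b]) (q, at_pos (int i)) =
     (q', at_pos (int (i + length [b])))"
    by (simp add: add.commute)
qed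

text \<open>State 4 consumes the bit announcing the first community. State 6 stands between its
  vertices, state 7 inside a unary number, and state 8 behind the community, where the next bit
  tells whether there is another one.\<close>

lemma reads_bits:
  "rd 4 [True] 6" "rd 6 [True] 7" "rd 6 [False] 8" "rd 7 [True] 7" "rd 7 [False] 6"
proof -
  have "ins_at code 4 = (2, \<lambda>s. (6, s, Move_Right))"
    "ins_at code 6 = (2, \<lambda>s. (if s = 2 then 7 else 8, s, Move_Right))"
    "ins_at code 7 = (2, \<lambda>s. (if s = 2 then 7 else 6, s, Move_Right))"
    by (simp_all add: ins_at_def)
  note i = this[THEN reads_single]
  show "rd 4 [True] 6" "rd 6 [True] 7" "rd 6 [False] 8" "rd 7 [True] 7" "rd 7 [False] 6"
    by (rule i; simp add: bit_symbol_def)+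
qed

lemma reads_enc_nat: "rd 7 (enc_nat v) 6"
proof (induction v)
  case 0
  show ?case using reads_bits(5) by (simp add: enc_nat_def)
next
  case (Suc v)
  thus ?case using reads_append[OF reads_bits(4) Suc] by (simp add: enc_nat_def)
qed

lemma reads_community: "rd 6 (enc_list enc_nat C) 8"
proof (induction C)
  case Nil
  show ?case using reads_bits(3) by (simp add: enc_list_def)
next
  case (Cons v C)
  have "rd 6 ([True] @ (enc_nat v @ enc_list enc_nat C)) 8"
    by (intro reads_append[OF reads_bits(2)] reads_append[OF reads_enc_nat] Cons)
  thus ?case by (simp add: enc_list_def)
qed

text \<open>Only the first community and one further bit are inspected, so the number of steps is
  governed by the first community alone.\<close>

lemma answer_run:
  assumes y: "y = enc_communities (C # Cs)"
  shows "fst ((ostep ^^ (length (enc_list enc_nat C) + 2))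
     (4, ts[2 := string_tape y])) = (if Cs = [] then reject_state else accept_state)"
proof -
  let ?w = "[True] @ enc_list enc_nat C"
  obtain rest where rest: "y = ?w @ rest" "Cs = [] \<Longrightarrow> rest = [False]"
      "Cs \<noteq> [] \<Longrightarrow> \<exists>r. rest = True # r"
    by (cases Cs) (auto simp: y enc_communities_def enc_list_def)
  have "rd 4 ?w 8" by (rule reads_append[OF reads_bits(1) reads_community])
  hence 1: "(ostep ^^ length ?w)
     (4, at_pos (int 0)) =
     (8, at_pos (int (0 + length ?w)))"
    using rest(1) unfolding reads_def by (metis drop0)
  have sym: "input_symbol y (length ?w) = (if Cs = [] then 1 else 2)"
    using rest(2,3)
    by (cases "Cs = []") (auto simp: rest(1) input_symbol_def nth_append bit_symbol_def)
  have 2: "ostep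
      (8, at_pos (int (length ?w))) =
      (if Cs = [] then 2 else 1, at_pos (move_head Stay (int (length ?w))))"
    by (rule step_answer[where g = "\<lambda>s. (if s = 2 then 1 else 2, s, Stay)"])
      (use sym in \<open>auto simp: ins_at_def split: if_splits\<close>)
  have l: "length (enc_list enc_nat C) + 2 = Suc (length ?w)" by simp
  have s: "string_tape y = (fst (string_tape y), int 0)" by (simp add: string_tape_def)
  show ?thesis
    unfolding l funpow.simps comp_def by (subst s) (use 1 2 in \<open>simp add: accept_state_def reject_state_def\<close>)
qed

end

text \<open>The reading time must be bounded uniformly in the solver. Distinctness allows at most
  \<open>n\<close> entries, and each entry is a number below \<open>n\<close>, written in
  unary.\<close>

lemma length_enc_community:
  assumes "distinct C" "set C \<subseteq> {0..<n}"
  shows "length (enc_list enc_nat C) + 2 \<le> n * (n + 2) + 3"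
proof -
  have "sum_list (map (\<lambda>x. Suc (length (enc_nat x))) C) \<le> sum_list (map (\<lambda>_. n + 2) C)"
    using assms(2) by (intro sum_list_mono) (auto simp: enc_nat_def)
  moreover have "length C \<le> n"
    using assms card_mono[of "{0..<n}" "set C"] distinct_card[of C] by simp
  hence "length C * (n + 2) \<le> n * (n + 2)" by (rule mult_le_mono1)
  ultimately have "sum_list (map (\<lambda>x. Suc (length (enc_nat x))) C) \<le> n * (n + 2)"
    by (simp add: sum_list_triv)
  thus ?thesis by (simp add: enc_list_def length_concat comp_def)
qed

lemma halted_stays:
  assumes "fst ((oracle_step M f ^^ n) c) = q" "q = accept_state \<or> q = reject_state" "n \<le> m"
  shows "fst ((oracle_step M f ^^ m) c) = q"
proof -
  have "fst ((oracle_step M f ^^ (k + n)) c) = q" for k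
  proof (induction k)
    case 0
    show ?case using assms(1) by simp
  next
    case (Suc k)
    let ?c = "(oracle_step M f ^^ (k + n)) c"
    have fixed: "fst d = 1 \<or> fst d = 2 \<Longrightarrow> oracle_step M f d = d" for d
      by (cases d) (auto simp: oracle_step_def step_def halted_def accept_state_def
          reject_state_def query_state_def)
    have "oracle_step M f ?c = ?c"
      by (rule fixed) (use Suc assms(2) in \<open>simp add: accept_state_def reject_state_def\<close>)
    thus ?case using Suc by simp
  qed
  from this[of "m - n"] assms(3) show ?thesis by simp
qed

section \<open>The machine of the reduction\<close>

definition input_counter :: "bool list \<Rightarrow> nat \<Rightarrow> nat" where
  "input_counter x = (\<lambda>_. 0)(0 := length x)"

text \<open>The counter \<open>r0\<close> only serves to bound the number of vertices, and thereby
  the time for reading the answer, by a polynomial in the length of the input.\<close>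

theorem turing_reduces_modularity:
  assumes \<rho>: "\<rho> > 0" and nc: "2 \<le> nc"
    and st: "setup_prog nc st P F" and em: "emits nc (\<lambda>b. [b]) em Z W"
    and PQ: "\<And>x. P (input_counter x)"
      "\<And>x. zeros Z (F (input_counter x))"
    and W: "\<And>x. W x (F (input_counter x)) = enc_graph (nv x) (es x)"
    and es: "\<And>x. valid_edges (nv x) (es x)" "\<And>x. es x \<noteq> []"
    and nv: "\<And>x. nv x \<le> F (input_counter x) r0 * 2"
    and cuts: "\<And>x. if x \<in> L then positive_cut (nv x) (es x) else negative_cuts (nv x) (es x)"
  shows "turing_reduces L (modularity_approximation \<rho>)"
proof -
  obtain ts gs :: "nat poly" where s: "\<And>x c B w. P c \<Longrightarrow> (\<forall>r. c r \<le> B) \<Longrightarrow>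
     triple nc x st (c, w, 0) (poly ts B) (F c, w, 0) \<and> (\<forall>r. F c r \<le> poly gs B)"
    using st unfolding setup_prog_def by blast
  obtain te where e: "\<And>x c B w. zeros Z c \<Longrightarrow> (\<forall>r. c r \<le> B) \<Longrightarrow>
     triple nc x em (c, w, 0) (poly te B) (c, w @ W x c, 0)"
    using em by (simp add: emits_def) blast
  define main where "main = f_scan 0 ;; f_for 0 1 (f_move Move_Left) ;; st ;; em"
  define code where "code = mark_code nc @ main (9 + nc) @ [(0, \<lambda>s. (3, s, Stay))]"
  \<comment> \<open>Scanning takes 3 l + 1 and rewinding 7 l + 2 steps for inputs of length l. The
    output phase works on counters bounded by \<open>gs\<close>, hence the composition.
    \<open>T2\<close> is the bound of \<open>length_enc_community\<close> for at most
    \<open>2 * gs\<close> vertices; in \<open>p\<close> the 2 stands for entering the query state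
    and for the query itself.\<close>
  define T1 where "T1 = [:3, 10:] + ts + pcompose te gs"
  define T2 where "T2 = gs * [:2:] * (gs * [:2:] + [:2:]) + [:3:]"
  let ?M = "tm_of nc code"
  define p where "p = [:nc + 1:] + T1 + [:2:] + T2"
  have marks: "take nc code = mark_code nc" "nc \<le> length code"
    by (simp_all add: code_def mark_code_def)
  have mcode: "code_at code (9 + nc) (main (9 + nc))"
    by (auto simp: code_at_def code_def mark_code_def nth_append)
  have last: "ins_at code (9 + nc + length (main (9 + nc))) = (0, \<lambda>s. (3, s, Stay))"
    by (simp add: ins_at_def code_def mark_code_def nth_append)
  have main: "triple nc x main (\<lambda>_. 0, [], 0) (poly T1 (length x))
      (F (input_counter x), enc_graph (nv x) (es x), 0)" for x
  proof -
    have B: "\<forall>r. input_counter x r \<le> length x" by (simp add: input_counter_def)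
    note s' = s[OF PQ(1) B, of x]
    have scan: "triple nc x (f_scan 0) (\<lambda>_. 0, [], 0) (3 * length x + 1) (input_counter x, [], int (length x))"
      using triple_scan[of 0 nc x "\<lambda>_. 0" "[]"] nc by (simp add: input_counter_def)
    have rew: "triple nc x (f_for 0 1 (f_move Move_Left)) (input_counter x, [], int (length x))
        (length x * 7 + 2) (input_counter x, [], 0)"
      using triple_rewind[of 0 nc 1 "input_counter x" x "[]"] nc by (simp add: input_counter_def)
    have em': "triple nc x em (F (input_counter x), [], 0) (poly te (poly gs (length x)))
        (F (input_counter x), enc_graph (nv x) (es x), 0)"
      using e[OF PQ(2), of x "poly gs (length x)" x "[]"] s' W by simp
    have "triple nc x main (\<lambda>_. 0, [], 0) (3 * length x + 1 + ((length x * 7 + 2) +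
        (poly ts (length x) + poly te (poly gs (length x)))))
        (F (input_counter x), enc_graph (nv x) (es x), 0)"
      unfolding main_def
      by (intro triple_seq[OF scan] triple_seq[OF rew] triple_seq[OF _ em'] s'[THEN conjunct1])
    thus ?thesis by (rule triple_mono) (simp add: T1_def poly_pcompose)
  qed
  have run: "\<exists>n \<le> poly p (length x).
      fst ((oracle_step ?M f ^^ n) (init_config ?M [x])) = (if x \<in> L then accept_state else reject_state)"
    if f: "solves f (modularity_approximation \<rho>)" for f x
  proof -
    let ?st = "oracle_step ?M f" and ?y = "enc_graph (nv x) (es x)"
    define tps where "tps = tapes nc x (F (input_counter x), ?y, 0)"
    obtain a where a: "a \<le> poly T1 (length x)" "(?st ^^ a) (9 + nc, tapes nc x (\<lambda>_. 0, [], 0)) =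
        (9 + nc + length (main (9 + nc)), tps)"
      using tripleD[OF main mcode] unfolding tps_def by metis
    have "?st (9 + nc + length (main (9 + nc)), tps) =
        (3, tps[0 := act (head_symbol (tps ! 0), Stay) (tps ! 0)])"
      using string_tape_sym[of x 0]
      by (intro oracle_step_tm_of[OF last]) (auto simp: tps_def tapes_def head_symbol_def)
    hence to3: "?st (9 + nc + length (main (9 + nc)), tps) = (3, tps)"
      by (simp add: act_head)
    have query: "tape_string (tps ! Suc 0) = ?y"
      using tape_string_string_tape[of ?y] by (simp add: tps_def tapes_def tape_string_def case_prod_beta)
    have upto: "(?st ^^ (1 + (a + (nc + 1)))) (init_config ?M [x]) = (3, tps)"
      unfolding funpow_add[of 1 "a + (nc + 1)"] funpow_add[of a "nc + 1"] comp_def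
        mark_counters[OF marks] a(2)
      by (simp add: to3)
    note ans = solver_answer[OF f \<rho> es cuts, of x]
    show ?thesis
    proof (cases "f ?y")
      case None
      hence "x \<in> L" using ans by simp
      have "?st (3, tps) = (5, tps[2 := string_tape []])"
        using None by (simp add: oracle_step_def query_state_def no_answer_state_def query)
      moreover have "?st (5, tps[2 := string_tape []]) = (1, (tps[2 := string_tape []])
          [0 := act (head_symbol ((tps[2 := string_tape []]) ! 0), Stay) (tps[2 := string_tape []] ! 0)])"
        using string_tape_sym[of x 0]
        by (intro oracle_step_tm_of) (auto simp: ins_at_def tps_def tapes_def head_symbol_def)
      ultimately have "fst ((?st ^^ (2 + (1 + (a + (nc + 1))))) (init_config ?M [x])) = 1"
        unfolding funpow_add[of 2] comp_def upto by (simp add: numeral_2_eq_2)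
      thus ?thesis using \<open>x \<in> L\<close> a(1)
        by (intro exI[of _ "2 + (1 + (a + (nc + 1)))"]) (auto simp: accept_state_def p_def T2_def)
    next
      case (Some y)
      then obtain C Cs where C: "y = enc_communities (C # Cs)" "distinct C" "set C \<subseteq> {0..<nv x}"
          "Cs = [] \<longleftrightarrow> x \<notin> L"
        using ans by auto
      let ?l = "length (enc_list enc_nat C) + 2"
      have "?st (3, tps) = (4, tps[2 := string_tape y])"
        using Some by (simp add: oracle_step_def query_state_def answer_state_def query)
      hence "fst ((?st ^^ (?l + (1 + (1 + (a + (nc + 1)))))) (init_config ?M [x])) =
          (if Cs = [] then reject_state else accept_state)"
        unfolding funpow_add[of ?l] funpow_add[of 1 "1 + (a + (nc + 1))"] comp_def upto
        using answer_run[OF _ C(1), of tps nc code f] by (simp add: tps_def)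
      moreover have "?l \<le> poly T2 (length x)"
      proof -
        have "\<forall>r. input_counter x r \<le> length x" by (simp add: input_counter_def)
        from s[OF PQ(1) this, of x "[]"] have "F (input_counter x) r0 \<le> poly gs (length x)" by blast
        hence "nv x \<le> poly gs (length x) * 2" using nv[of x] by linarith
        hence "nv x * (nv x + 2) + 3 \<le>
            poly gs (length x) * 2 * (poly gs (length x) * 2 + 2) + 3"
          by (intro add_mono mult_mono) auto
        thus ?thesis using length_enc_community[OF C(2,3)] by (simp add: T2_def)
      qed
      ultimately show ?thesis using C(4) a(1)
        by (intro exI[of _ "?l + (1 + (1 + (a + (nc + 1))))"]) (auto simp: p_def)
    qed
  qed
  show ?thesis
    unfolding turing_reduces_def
  proof (intro exI conjI allI impI)
    show "wf_oracle_tm ?M" by (rule wf_tm_of)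
    fix f x assume "solves f (modularity_approximation \<rho>)"
    from run[OF this, of x] obtain n where n: "n \<le> poly p (length x)"
      "fst ((oracle_step ?M f ^^ n) (init_config ?M [x])) = (if x \<in> L then accept_state else reject_state)"
      by blast
    have "fst ((oracle_step ?M f ^^ poly p (length x)) (init_config ?M [x])) =
        (if x \<in> L then accept_state else reject_state)"
      by (rule halted_stays[OF n(2) _ n(1)]) auto
    thus "x \<in> L \<Longrightarrow> oracle_accepts_within ?M f x (poly p (length x))"
      "x \<notin> L \<Longrightarrow> oracle_rejects_within ?M f x (poly p (length x))"
      by (simp_all add: oracle_accepts_within_def oracle_rejects_within_def)
  qed
qed

section \<open>Tableaux of verifiers\<close>

text \<open>One column of all tapes at one time: \<open>tile_syms\<close> and
  \<open>tile_heads\<close> belong to the column, whereas \<open>tile_state\<close> and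
  \<open>tile_reads\<close> repeat a label common to the whole row.\<close>

record tile =
  tile_state :: nat
  tile_reads :: "nat list"
  tile_syms :: "nat list"
  tile_heads :: "bool list"

text \<open>The filter is the link between the guessed label and the tapes: the symbols claimed to
  be scanned are checked in the columns where the heads are.\<close>

definition tiles :: "tm \<Rightarrow> tile list" where
  "tiles M = filter (\<lambda>\<tau>. \<forall>j<num_tapes M. tile_heads \<tau> ! j \<longrightarrow> tile_reads \<tau> ! j = tile_syms \<tau> ! j)
     (concat (map (\<lambda>q. concat (map (\<lambda>rs. concat (map (\<lambda>as. map (\<lambda>hs. \<lparr>tile_state = q, tile_reads = rs,
        tile_syms = as, tile_heads = hs\<rparr>)
        (List.n_lists (num_tapes M) [False, True]))
        (List.n_lists (num_tapes M) [0..<num_symbols M])))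
        (List.n_lists (num_tapes M) [0..<num_symbols M])))
        [0..<num_states M]))"

lemma set_tiles:
  "\<tau> \<in> set (tiles M) \<longleftrightarrow> tile_state \<tau> < num_states M \<and>
     length (tile_reads \<tau>) = num_tapes M \<and> set (tile_reads \<tau>) \<subseteq> {0..<num_symbols M} \<and>
     length (tile_syms \<tau>) = num_tapes M \<and> set (tile_syms \<tau>) \<subseteq> {0..<num_symbols M} \<and>
     length (tile_heads \<tau>) = num_tapes M \<and>
     (\<forall>j<num_tapes M. tile_heads \<tau> ! j \<longrightarrow> tile_reads \<tau> ! j = tile_syms \<tau> ! j)"
  by (cases \<tau>) (auto simp: tiles_def set_n_lists image_iff)

text \<open>Halting states act as the identity, as in \<open>step\<close>, so acceptance at any
  earlier time is still visible in the last row.\<close>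

definition next_acts :: "tm \<Rightarrow> nat \<Rightarrow> nat list \<Rightarrow> nat \<times> (nat \<times> move) list" where
  "next_acts M q rs =
     (if q = accept_state \<or> q = reject_state then (q, map (\<lambda>s. (s, Stay)) rs) else delta M q rs)"

lemma step_next_acts:
  "step M (q, ts) = (fst (next_acts M q (map head_symbol ts)),
     map2 act (snd (next_acts M q (map head_symbol ts))) ts)"
proof -
  have "map2 act (map (\<lambda>s. (s, Stay)) (map head_symbol ts)) ts = ts" for ts
    by (induction ts) (auto simp: act_head)
  thus ?thesis
    by (auto simp: step_def halted_def next_acts_def split: prod.splits)
qed

definition rel_label :: "tile \<Rightarrow> tile \<Rightarrow> bool" where
  "rel_label \<sigma> \<tau> \<longleftrightarrow> tile_state \<sigma> = tile_state \<tau> \<and> tile_reads \<sigma> = tile_reads \<tau>"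

definition tile_acts :: "tm \<Rightarrow> tile \<Rightarrow> (nat \<times> move) list" where
  "tile_acts M \<sigma> = snd (next_acts M (tile_state \<sigma>) (tile_reads \<sigma>))"

text \<open>The label tells every cell how each head moves. A head flag is therefore a copy of the
  flag of one cell in the previous row, in the column that the move determines, and constraints on
  pairs of cells are enough.\<close>

definition rel_move :: "tm \<Rightarrow> move \<Rightarrow> tile \<Rightarrow> tile \<Rightarrow> bool" where
  "rel_move M m \<sigma> \<tau> \<longleftrightarrow>
     (\<forall>j<num_tapes M. snd (tile_acts M \<sigma> ! j) = m \<longrightarrow> tile_heads \<tau> ! j = tile_heads \<sigma> ! j)"

definition rel_below :: "tm \<Rightarrow> tile \<Rightarrow> tile \<Rightarrow> bool" where
  "rel_below M \<sigma> \<tau> \<longleftrightarrow> tile_state \<tau> = fst (next_acts M (tile_state \<sigma>) (tile_reads \<sigma>)) \<and>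
     (\<forall>j<num_tapes M. tile_syms \<tau> ! j =
        (if tile_heads \<sigma> ! j then fst (tile_acts M \<sigma> ! j) else tile_syms \<sigma> ! j)) \<and>
     rel_move M Stay \<sigma> \<tau>"

text \<open>Blanks propagate to the right, so tape 1 initially holds a block of bits followed by
  blanks. Together with \<open>tile_no_certificate\<close> from position \<open>Q\<close> on, this
  bounds the certificate by \<open>Q\<close>.\<close>

definition rel_certificate :: "tile \<Rightarrow> tile \<Rightarrow> bool" where
  "rel_certificate \<sigma> \<tau> \<longleftrightarrow> (tile_syms \<sigma> ! 1 = 0 \<longrightarrow> tile_syms \<tau> ! 1 = 0)"

definition tile_left :: "tm \<Rightarrow> tile \<Rightarrow> bool" where
  "tile_left M \<tau> \<longleftrightarrow> tile_state \<tau> = start_state \<and>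
     (\<forall>j<num_tapes M. tile_syms \<tau> ! j = 0 \<and> \<not> tile_heads \<tau> ! j)"

definition tile_input :: "tm \<Rightarrow> nat \<Rightarrow> tile \<Rightarrow> bool" where
  "tile_input M a \<tau> \<longleftrightarrow> tile_state \<tau> = start_state \<and> tile_syms \<tau> ! 0 = a \<and> tile_syms \<tau> ! 1 < 3 \<and>
     (\<forall>j<num_tapes M. 2 \<le> j \<longrightarrow> tile_syms \<tau> ! j = 0)"

definition tile_head :: "tm \<Rightarrow> bool \<Rightarrow> tile \<Rightarrow> bool" where
  "tile_head M b \<tau> \<longleftrightarrow> (\<forall>j<num_tapes M. tile_heads \<tau> ! j = b)"

definition tile_no_certificate :: "tile \<Rightarrow> bool" where
  "tile_no_certificate \<tau> \<longleftrightarrow> tile_syms \<tau> ! 1 = 0"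

definition tile_accept :: "tile \<Rightarrow> bool" where
  "tile_accept \<tau> \<longleftrightarrow> tile_state \<tau> = accept_state"

definition on_tiles :: "tm \<Rightarrow> (tile \<Rightarrow> bool) \<Rightarrow> nat \<Rightarrow> bool" where
  "on_tiles M U a \<longleftrightarrow> U (tiles M ! a)"

definition on_tiles2 :: "tm \<Rightarrow> (tile \<Rightarrow> tile \<Rightarrow> bool) \<Rightarrow> nat \<Rightarrow> nat \<Rightarrow> bool" where
  "on_tiles2 M R a b \<longleftrightarrow> R (tiles M ! a) (tiles M ! b)"

text \<open>At time t \<le> T a head is in a column between L - t and L + t. With L = 2 T + 2 these
  lie within the columns t + 1 to W - t - 2, the ones that the border cannot influence.\<close>

definition left_width :: "nat \<Rightarrow> nat" where
  "left_width T = 2 * T + 2"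

definition row_width :: "nat \<Rightarrow> nat \<Rightarrow> nat" where
  "row_width T Q = 2 * left_width T + Q"

text \<open>Cell \<open>t * W + c\<close> describes the tape cells \<open>c - L\<close> at time \<open>t\<close>. Nothing is required of the
  border columns, so the tableau is reliable only in the columns from \<open>t + 1\<close> to \<open>W - t - 2\<close>
  of row \<open>t\<close>; the heads stay within them.\<close>

definition transition_items :: "tm \<Rightarrow> nat \<Rightarrow> nat \<Rightarrow> item list" where
  "transition_items M W i =
     [Binary (i + 1) (i + 2) (on_tiles2 M rel_label),
      Binary (i + 1) (i + W + 1) (on_tiles2 M (rel_below M)),
      Binary (i + 1) (i + W) (on_tiles2 M (rel_move M Move_Left)),
      Binary (i + 1) (i + W + 2) (on_tiles2 M (rel_move M Move_Right))]"

text \<open>All loop bounds are separate parameters because the program holds each of them in a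
  counter of its own; only \<open>tableau_items\<close> fixes how they depend on \<open>T\<close>
  and \<open>Q\<close>.\<close>

definition item_list :: "tm \<Rightarrow> bool list \<Rightarrow> nat \<Rightarrow> nat \<Rightarrow> nat \<Rightarrow> nat \<Rightarrow> nat \<Rightarrow> nat \<Rightarrow> item list" where
  "item_list M x W W2 T L R R1 =
     concat (map (\<lambda>t. concat (map (\<lambda>c. transition_items M W (t * W + c)) [0..<W2])) [0..<T]) @
     map (\<lambda>c. Unary c (on_tiles M (tile_left M))) [0..<L] @
     map (\<lambda>p. Unary (p + L) (on_tiles M (tile_input M (input_symbol x p)))) [0..<R] @
     [Unary L (on_tiles M (tile_head M True))] @
     map (\<lambda>p. Unary (p + L + 1) (on_tiles M (tile_head M False))) [0..<R1] @
     map (\<lambda>i. Unary (i + R) (on_tiles M tile_no_certificate)) [0..<L] @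
     map (\<lambda>i. Binary (i + L) (i + L + 1) (on_tiles2 M rel_certificate)) [0..<R1] @
     [Unary (T * W + L) (on_tiles M tile_accept)]"

definition tableau_items :: "tm \<Rightarrow> nat \<Rightarrow> nat \<Rightarrow> bool list \<Rightarrow> item list" where
  "tableau_items M T Q x =
     (let L = left_width T; W = row_width T Q in item_list M x W (W - 2) T L (L + Q) (L + Q - 1))"

lemma tableau_items_within:
  assumes "it \<in> set (tableau_items M T Q x)"
  shows "item_within ((T + 1) * row_width T Q) it"
proof -
  define L where "L = left_width T"
  define W where "W = row_width T Q"
  have LW: "L \<ge> 2" "W = 2 * L + Q" by (auto simp: L_def W_def left_width_def row_width_def)
  have W: "(T + 1) * W = T * W + W" by simp
  have row: "t * W + W \<le> T * W" if "t < T" for t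
    using mult_le_mono1[of "t + 1" T W] that by simp
  have trans: "item_within (T * W + W) it" if "it \<in> set (transition_items M W (t * W + c))"
      "t < T" "c < W - 2" for t c
    using that row[OF that(2)] by (auto simp: transition_items_def)
  have TW: "W \<le> T * W + W" by simp
  show ?thesis
    using assms trans LW unfolding tableau_items_def item_list_def Let_def L_def[symmetric] W_def[symmetric] W
    by (auto simp: less_diff_conv)
qed

lemma list_all_concat_map: "list_all P (concat (map F xs)) \<longleftrightarrow> list_all (\<lambda>a. list_all P (F a)) xs"
  by (induction xs) auto

lemma list_all_upt: "list_all P [0..<n] \<longleftrightarrow> (\<forall>i<n. P i)"
  by (auto simp: list_all_iff)

definition transition_ok :: "tm \<Rightarrow> nat \<Rightarrow> (nat \<Rightarrow> tile) \<Rightarrow> nat \<Rightarrow> bool" where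
  "transition_ok M W D i \<longleftrightarrow> rel_label (D (i + 1)) (D (i + 2)) \<and>
     rel_below M (D (i + 1)) (D (i + W + 1)) \<and> rel_move M Move_Left (D (i + 1)) (D (i + W)) \<and>
     rel_move M Move_Right (D (i + 1)) (D (i + W + 2))"

lemma satisfies_tableau:
  fixes T Q :: nat
  defines "L \<equiv> left_width T" and "W \<equiv> row_width T Q"
  assumes D: "\<And>i. D i = tiles M ! f i"
  shows "(\<forall>it\<in>set (tableau_items M T Q x). item_sat f it) \<longleftrightarrow>
    (\<forall>t<T. \<forall>c<W - 2. transition_ok M W D (t * W + c)) \<and>
    (\<forall>c<L. tile_left M (D c)) \<and>
    (\<forall>p<L + Q. tile_input M (input_symbol x p) (D (p + L))) \<and>
    tile_head M True (D L) \<and>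
    (\<forall>p<L + Q - 1. tile_head M False (D (p + L + 1))) \<and>
    (\<forall>i<L. tile_no_certificate (D (i + L + Q))) \<and>
    (\<forall>i<L + Q - 1. rel_certificate (D (i + L)) (D (i + L + 1))) \<and>
    tile_accept (D (T * W + L))"
  unfolding tableau_items_def item_list_def Let_def L_def[symmetric] W_def[symmetric]
  unfolding list_all_iff[symmetric]
  by (simp add: list_all_concat_map list_all_upt list.pred_map comp_def
      transition_items_def transition_ok_def on_tiles_def on_tiles2_def D add.assoc)


lemma wf_next_acts:
  assumes M: "wf_tm M" and q: "q < num_states M"
    and rs: "length rs = num_tapes M" "set rs \<subseteq> {0..<num_symbols M}"
  shows "fst (next_acts M q rs) < num_states M" "length (snd (next_acts M q rs)) = num_tapes M"
    "\<And>j. j < num_tapes M \<Longrightarrow> fst (snd (next_acts M q rs) ! j) < num_symbols M"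
proof -
  have d: "case delta M q rs of (q', acts) \<Rightarrow> q' < num_states M \<and> length acts = num_tapes M \<and>
           (\<forall>(s, m) \<in> set acts. s < num_symbols M)"
    using M q rs unfolding wf_tm_def by (auto simp: subset_iff)
  show "fst (next_acts M q rs) < num_states M" "length (snd (next_acts M q rs)) = num_tapes M"
    using d q rs by (auto simp: next_acts_def split: prod.splits)
  fix j assume j: "j < num_tapes M"
  show "fst (snd (next_acts M q rs) ! j) < num_symbols M"
  proof (cases "q = accept_state \<or> q = reject_state")
    case True
    have "rs ! j < num_symbols M" using j rs by (metis atLeastLessThan_iff nth_mem subsetD)
    thus ?thesis using True rs j by (auto simp: next_acts_def)
  next
    case False
    obtain q' acts where e: "delta M q rs = (q', acts)" by fastforce
    have "acts ! j \<in> set acts" using d e j by simp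
    moreover have "\<forall>a\<in>set acts. fst a < num_symbols M" using d e by auto
    ultimately show ?thesis using False e by (simp add: next_acts_def)
  qed
qed

section \<open>The run of a verifier as a tableau\<close>

context
  fixes M :: tm and x u :: "bool list"
  assumes M: "wf_tm M" "2 \<le> num_tapes M"
begin

definition conf :: "nat \<Rightarrow> config" where
  "conf t = (step M ^^ t) (init_config M [x, u])"

definition content :: "nat \<Rightarrow> nat \<Rightarrow> int \<Rightarrow> nat" where
  "content t j = fst (snd (conf t) ! j)"

definition hpos :: "nat \<Rightarrow> nat \<Rightarrow> int" where
  "hpos t j = snd (snd (conf t) ! j)"

definition reads_at :: "nat \<Rightarrow> nat list" where
  "reads_at t = map head_symbol (snd (conf t))"

definition acts_at :: "nat \<Rightarrow> (nat \<times> move) list" where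
  "acts_at t = snd (next_acts M (fst (conf t)) (reads_at t))"

lemma conf_0:
  "fst (conf 0) = start_state" "length (snd (conf 0)) = num_tapes M"
  "j < num_tapes M \<Longrightarrow> hpos 0 j = 0"
  "content 0 0 p = (if 0 \<le> p then input_symbol x (nat p) else 0)"
  "content 0 1 p = (if 0 \<le> p then input_symbol u (nat p) else 0)"
  "j < num_tapes M \<Longrightarrow> 2 \<le> j \<Longrightarrow> content 0 j p = 0"
  using M(2)
  by (auto simp: conf_def init_config_def hpos_def content_def string_tape_def input_symbol_def)

lemma conf_invariant:
  "fst (conf t) < num_states M \<and> length (snd (conf t)) = num_tapes M \<and>
   (\<forall>j<num_tapes M. \<forall>p. content t j p < num_symbols M)"
proof (induction t)
  case 0
  have ns: "3 \<le> num_states M" "3 \<le> num_symbols M" using M(1) by (auto simp: wf_tm_def)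
  have i: "input_symbol w p < 3" for w p by (auto simp: input_symbol_def bit_symbol_def)
  have "content 0 j p < num_symbols M" if "j < num_tapes M" for j p
  proof -
    consider "j = 0" | "j = 1" | "2 \<le> j" by linarith
    thus ?thesis using that ns i order_less_le_trans[OF i ns(2)] by cases (auto simp: conf_0 simp del: One_nat_def)
  qed
  thus ?case using ns conf_0 by (auto simp: start_state_def)
next
  case (Suc t)
  obtain q ts where c: "conf t = (q, ts)" by (cases "conf t")
  have len: "length ts = num_tapes M" and q: "q < num_states M" using Suc c by auto
  have cont: "fst (ts ! j) p < num_symbols M" if "j < num_tapes M" for j p
    using Suc that by (auto simp: content_def c)
  have rs: "set (map head_symbol ts) \<subseteq> {0..<num_symbols M}"
  proof
    fix s assume "s \<in> set (map head_symbol ts)"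
    then obtain j where "j < num_tapes M" "s = head_symbol (ts ! j)"
      using len by (auto simp: in_set_conv_nth)
    thus "s \<in> {0..<num_symbols M}"
      using cont[of j "snd (ts ! j)"] by (simp add: head_symbol_def case_prod_beta)
  qed
  note w = wf_next_acts[OF M(1) q _ rs]
  have S: "conf (Suc t) = (fst (next_acts M q (map head_symbol ts)),
     map2 act (snd (next_acts M q (map head_symbol ts))) ts)"
    using c by (simp add: conf_def step_next_acts)
  have "content (Suc t) j p < num_symbols M" if j: "j < num_tapes M" for j p
    using w(2) w(3)[OF _ j] cont[OF j] len j
    by (simp add: content_def S act_def case_prod_unfold)
  thus ?case using w(1,2) len S by auto
qed

lemma length_conf: "length (snd (conf t)) = num_tapes M" "length (reads_at t) = num_tapes M"
  using conf_invariant[of t] by (auto simp: reads_at_def)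

lemma reads_at_nth: "j < num_tapes M \<Longrightarrow> reads_at t ! j = content t j (hpos t j)"
  using length_conf[of t]
  by (simp add: reads_at_def content_def hpos_def head_symbol_def case_prod_unfold)

lemma reads_at_subset: "set (reads_at t) \<subseteq> {0..<num_symbols M}"
  using conf_invariant[of t] length_conf[of t] reads_at_nth[of _ t]
  by (auto simp: in_set_conv_nth)

lemma length_acts_at: "length (acts_at t) = num_tapes M"
  unfolding acts_at_def
  using wf_next_acts(2)[OF M(1) _ length_conf(2) reads_at_subset] conf_invariant[of t] by blast

lemma conf_Suc:
  "fst (conf (Suc t)) = fst (next_acts M (fst (conf t)) (reads_at t))"
  "j < num_tapes M \<Longrightarrow> content (Suc t) j p =
     (if hpos t j = p then fst (acts_at t ! j) else content t j p)"
  "j < num_tapes M \<Longrightarrow> hpos (Suc t) j = move_head (snd (acts_at t ! j)) (hpos t j)"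
proof -
  have S: "conf (Suc t) = (fst (next_acts M (fst (conf t)) (reads_at t)),
     map2 act (acts_at t) (snd (conf t)))"
    using step_next_acts[of M "fst (conf t)" "snd (conf t)"]
    by (simp add: conf_def acts_at_def reads_at_def)
  show "fst (conf (Suc t)) = fst (next_acts M (fst (conf t)) (reads_at t))" by (simp add: S)
  assume "j < num_tapes M"
  thus "content (Suc t) j p = (if hpos t j = p then fst (acts_at t ! j) else content t j p)"
    "hpos (Suc t) j = move_head (snd (acts_at t ! j)) (hpos t j)"
    using length_acts_at[of t] length_conf[of t]
    by (auto simp: S content_def hpos_def act_def case_prod_unfold)
qed

lemma hpos_bound: "j < num_tapes M \<Longrightarrow> \<bar>hpos t j\<bar> \<le> int t"
proof (induction t)
  case 0
  thus ?case by (simp add: conf_0)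
next
  case (Suc t)
  have "\<bar>move_head m h\<bar> \<le> \<bar>h\<bar> + 1" for m h by (cases m) auto
  from this[of "snd (acts_at t ! j)" "hpos t j"] Suc show ?case by (simp add: conf_Suc)
qed

definition tile_at :: "nat \<Rightarrow> int \<Rightarrow> tile" where
  "tile_at t p = \<lparr>tile_state = fst (conf t), tile_reads = reads_at t,
     tile_syms = map (\<lambda>j. content t j p) [0..<num_tapes M],
     tile_heads = map (\<lambda>j. hpos t j = p) [0..<num_tapes M]\<rparr>"

lemma tile_at_in_tiles: "tile_at t p \<in> set (tiles M)"
  using conf_invariant[of t] reads_at_subset[of t] length_conf[of t]
  by (auto simp: set_tiles tile_at_def reads_at_nth)

lemma tile_acts_at: "tile_acts M (tile_at t p) = acts_at t"
  by (simp add: tile_acts_def tile_at_def acts_at_def)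

lemma tile_at_rel:
  "rel_label (tile_at t p) (tile_at t p')"
  "rel_move M m (tile_at t p) (tile_at (Suc t) (move_head m p))"
  "rel_below M (tile_at t p) (tile_at (Suc t) p)"
proof -
  show "rel_label (tile_at t p) (tile_at t p')" by (simp add: rel_label_def tile_at_def)
  have inj: "move_head m a = move_head m b \<longleftrightarrow> a = b" for m a b by (cases m) auto
  show mv: "rel_move M m (tile_at t p) (tile_at (Suc t) (move_head m p))" for m
    unfolding rel_move_def tile_acts_at by (auto simp: tile_at_def conf_Suc inj)
  show "rel_below M (tile_at t p) (tile_at (Suc t) p)"
    using mv[of Stay] unfolding rel_below_def tile_acts_at by (auto simp: tile_at_def conf_Suc)
qed

lemma tableau_complete:
  assumes u: "length u \<le> Q" and acc: "accepts_within M [x, u] T"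
  shows "\<exists>f. satisfies ((T + 1) * row_width T Q) (length (tiles M)) (tableau_items M T Q x) f"
proof -
  define L where "L = left_width T"
  define W where "W = row_width T Q"
  have LW: "L \<ge> 2" "W = 2 * L + Q" by (auto simp: L_def W_def left_width_def row_width_def)
  \<comment> \<open>The tiles of the actual run on two-way infinite tapes; the constraints near the
    border hold because the run simply continues beyond it.\<close>
  define D where "D i = tile_at (i div W) (int (i mod W) - int L)" for i
  have "\<forall>i. \<exists>a<length (tiles M). tiles M ! a = D i"
    unfolding D_def using tile_at_in_tiles by (simp add: in_set_conv_nth)
  then obtain f where f: "\<And>i. f i < length (tiles M)" "\<And>i. D i = tiles M ! f i" by metis
  have cell: "D (t * W + c) = tile_at t (int c - int L)" if "c < W" for t c
  proof -
    have "(t * W + c) div W = t" using that by simp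
    moreover have "(t * W + c) mod W = c" using that by simp
    ultimately show ?thesis by (simp add: D_def)
  qed
  have row0: "D c = tile_at 0 (int c - int L)" if "c < W" for c using cell[of c 0] that by simp
  have trans: "transition_ok M W D (t * W + c)" if c: "c < W - 2" for t c
  proof -
    let ?p = "int (c + 1) - int L"
    have d: "D (t * W + c + 1) = tile_at t ?p" "D (t * W + c + 2) = tile_at t (?p + 1)"
      using cell[of "c + 1" t] cell[of "c + 2" t] c by (simp_all add: algebra_simps)
    have e: "D (t * W + c + W + 1) = tile_at (Suc t) (move_head Stay ?p)"
      "D (t * W + c + W) = tile_at (Suc t) (move_head Move_Left ?p)"
      "D (t * W + c + W + 2) = tile_at (Suc t) (move_head Move_Right ?p)"
      using cell[of "c + 1" "Suc t"] cell[of "c" "Suc t"] cell[of "c + 2" "Suc t"] c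
      by (simp_all add: algebra_simps)
    have b: "rel_below M (tile_at t ?p) (tile_at (Suc t) (move_head Stay ?p))"
      using tile_at_rel(3) by simp
    show ?thesis
      unfolding transition_ok_def d e by (intro conjI b tile_at_rel)
  qed
  have syms: "tile_syms (tile_at 0 p) ! j = content 0 j p" if "j < num_tapes M" for j p
    using that by (simp add: tile_at_def)
  have heads: "tile_heads (tile_at 0 p) ! j \<longleftrightarrow> p = 0" if "j < num_tapes M" for j p
    using that by (auto simp: tile_at_def conf_0)
  have state: "tile_state (tile_at 0 p) = start_state" for p by (simp add: tile_at_def conf_0)
  have left: "tile_left M (D c)" if "c < L" for c
  proof -
    have "content 0 j (int c - int L) = 0" if "j < num_tapes M" for j
    proof -
      consider "j = 0" | "j = 1" | "2 \<le> j" by linarith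
      thus ?thesis using that \<open>c < L\<close> by cases (auto simp: conf_0 simp del: One_nat_def)
    qed
    thus ?thesis using that LW row0[of c] by (auto simp: tile_left_def syms heads state)
  qed
  have inp: "tile_input M (input_symbol x p) (D (p + L))" if "p < L + Q" for p
    using that LW row0[of "p + L"] M(2)
    by (auto simp: tile_input_def syms state conf_0 input_symbol_def bit_symbol_def simp del: One_nat_def)
  have cert: "tile_syms (D (p + L)) ! 1 = input_symbol u p" if "p < L + Q" for p
    using that LW row0[of "p + L"] M(2) by (simp add: syms conf_0 del: One_nat_def)
  have "fst (conf T) = accept_state" using acc by (simp add: accepts_within_def conf_def)
  hence fin: "tile_accept (D (T * W + L))"
    using cell[of L T] LW by (simp add: tile_accept_def tile_at_def)
  have "\<forall>it\<in>set (tableau_items M T Q x). item_sat f it"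
    unfolding satisfies_tableau[of D M f, OF f(2)] L_def[symmetric] W_def[symmetric]
  proof (intro conjI allI impI)
    show "tile_head M True (D L)" using LW row0[of L] by (simp add: tile_head_def heads)
    show "tile_head M False (D (p + L + 1))" if "p < L + Q - 1" for p
      using that LW row0[of "p + L + 1"] by (auto simp: tile_head_def heads)
    show "tile_no_certificate (D (i + L + Q))" if "i < L" for i
    proof -
      have "i + L + Q = (i + Q) + L" by simp
      thus ?thesis unfolding tile_no_certificate_def using cert[of "i + Q"] that u
        by (simp only:) (simp add: input_symbol_def)
    qed
    show "rel_certificate (D (i + L)) (D (i + L + 1))" if "i < L + Q - 1" for i
    proof -
      have "i + L + 1 = (i + 1) + L" by simp
      thus ?thesis unfolding rel_certificate_def using cert[of i] cert[of "i + 1"] that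
        by (simp only:) (auto simp: input_symbol_def bit_symbol_def split: if_splits)
    qed
  qed (use trans left inp fin in auto)
  thus ?thesis using f(1) unfolding satisfies_def by blast
qed

text \<open>A head flag may come from a neighbouring column of the previous row, so each row loses
  one reliable column on either side. The scanned symbols are nevertheless right from column 1 on:
  the column of each head is reliable, its tile fixes the symbol, and equal labels spread it along
  the row.\<close>

lemma tableau_sound_step:
  fixes D :: "nat \<Rightarrow> tile" and T Q :: nat
  defines "L \<equiv> left_width T" and "W \<equiv> row_width T Q"
  assumes D: "\<And>t c. t \<le> T \<Longrightarrow> c < W \<Longrightarrow> D (t * W + c) \<in> set (tiles M)"
    and trans: "\<And>t c. t < T \<Longrightarrow> c < W - 2 \<Longrightarrow> transition_ok M W D (t * W + c)"
    and init: "\<And>c. c < W \<Longrightarrow> tile_state (D c) = start_state \<and>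
       (\<forall>j<num_tapes M. tile_syms (D c) ! j = content 0 j (int c - int L) \<and>
          (tile_heads (D c) ! j \<longleftrightarrow> hpos 0 j = int c - int L))"
    and t: "t \<le> T" and c: "t + 1 \<le> c" "c + t + 2 \<le> W"
  shows "tile_state (D (t * W + c)) = fst (conf t) \<and>
    (\<forall>j<num_tapes M. tile_syms (D (t * W + c)) ! j = content t j (int c - int L) \<and>
       (tile_heads (D (t * W + c)) ! j \<longleftrightarrow> hpos t j = int c - int L))"
  using t c
proof (induction t arbitrary: c)
  case 0
  thus ?case using init[of c] by (simp add: conf_0)
next
  case (Suc t)
  have LW: "L = 2 * T + 2" "W = 2 * L + Q" by (auto simp: L_def W_def left_width_def row_width_def)
  have t: "t < T" using Suc.prems by simp
  \<comment> \<open>The chain starts in column 1, since \<open>transition_ok\<close> at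
    \<open>c\<close> links the columns \<open>c + 1\<close> and \<open>c + 2\<close>.\<close>
  have label: "rel_label (D (t * W + 1)) (D (t * W + (c + 1)))" if "c + 1 < W" for c
    using that
  proof (induction c)
    case 0
    show ?case by (simp add: rel_label_def)
  next
    case (Suc c)
    thus ?case using trans[OF t, of c] by (auto simp: transition_ok_def rel_label_def)
  qed
  have reads: "tile_reads (D (t * W + c)) = reads_at t" if "1 \<le> c" "c < W" for c
  proof (rule nth_equalityI)
    have "length (tile_reads (D (t * W + c))) = num_tapes M"
      using D[of t c] t that by (simp add: set_tiles)
    thus len: "length (tile_reads (D (t * W + c))) = length (reads_at t)"
      using length_conf(2) by simp
    fix j assume "j < length (tile_reads (D (t * W + c)))"
    hence j: "j < num_tapes M" using len length_conf(2) by simp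
    \<comment> \<open>The column of head \<open>j\<close>; \<open>hpos_bound\<close> and the choice
      of \<open>L\<close> put it in the range of the induction hypothesis.\<close>
    define cj where "cj = nat (int L + hpos t j)"
    have "\<bar>hpos t j\<bar> \<le> int t" by (rule hpos_bound[OF j])
    hence cj: "int cj = int L + hpos t j" "t + 1 \<le> cj" "cj + t + 2 \<le> W"
      using t LW by (auto simp: cj_def)
    have "tile_heads (D (t * W + cj)) ! j" and s: "tile_syms (D (t * W + cj)) ! j = content t j (hpos t j)"
      using Suc.IH[of cj] t cj j by auto
    moreover have "D (t * W + cj) \<in> set (tiles M)" using D[of t cj] t cj by simp
    ultimately have "tile_reads (D (t * W + cj)) ! j = reads_at t ! j"
      using j by (simp add: set_tiles reads_at_nth)
    moreover have "rel_label (D (t * W + 1)) (D (t * W + cj))" "rel_label (D (t * W + 1)) (D (t * W + c))"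
      using label[of "cj - 1"] label[of "c - 1"] cj that by auto
    ultimately show "tile_reads (D (t * W + c)) ! j = reads_at t ! j" by (simp add: rel_label_def)
  qed
  have acts: "tile_state (D (t * W + c)) = fst (conf t) \<and> tile_acts M (D (t * W + c)) = acts_at t"
    if "t + 1 \<le> c" "c + t + 2 \<le> W" for c
    using Suc.IH[of c] that t reads[of c] by (simp add: tile_acts_def acts_at_def)
  have "2 \<le> c" using Suc.prems by simp
  then obtain c' where c': "c = c' + 2" using le_Suc_ex[of 2 c] by (auto simp: add.commute)
  have cW: "c' + 4 + t \<le> W - 1" "t \<le> c'" using Suc.prems c' by auto
  have below: "rel_below M (D (t * W + c)) (D (Suc t * W + c))"
    using trans[OF t, of "c' + 1"] cW unfolding c'
    by (simp add: transition_ok_def algebra_simps)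
  have old: "tile_state (D (t * W + c)) = fst (conf t)"
    "\<And>j. j < num_tapes M \<Longrightarrow> tile_syms (D (t * W + c)) ! j = content t j (int c - int L)"
    "\<And>j. j < num_tapes M \<Longrightarrow> tile_heads (D (t * W + c)) ! j \<longleftrightarrow> hpos t j = int c - int L"
    "tile_reads (D (t * W + c)) = reads_at t" "tile_acts M (D (t * W + c)) = acts_at t"
    using Suc.IH[of c] reads[of c] acts[of c] Suc.prems t by auto
  have heads: "tile_heads (D (Suc t * W + c)) ! j \<longleftrightarrow> hpos (Suc t) j = int c - int L"
    if j: "j < num_tapes M" for j
  proof (cases "snd (acts_at t ! j)")
    case Stay
    thus ?thesis using below old(3)[OF j] old(5) j by (auto simp: rel_below_def rel_move_def conf_Suc)
  next
    case Move_Left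
    have "rel_move M Move_Left (D (t * W + (c + 1))) (D (Suc t * W + c))"
      using trans[OF t, of "c' + 2"] cW c' by (simp add: transition_ok_def algebra_simps)
    moreover have "tile_acts M (D (t * W + (c + 1))) = acts_at t"
      "tile_heads (D (t * W + (c + 1))) ! j \<longleftrightarrow> hpos t j = int (c + 1) - int L"
      using acts[of "c + 1"] Suc.IH[of "c + 1"] Suc.prems t j by auto
    ultimately show ?thesis using Move_Left j by (auto simp: rel_move_def conf_Suc)
  next
    case Move_Right
    have "rel_move M Move_Right (D (t * W + (c' + 1))) (D (Suc t * W + c))"
      using trans[OF t, of "c'"] cW c' by (simp add: transition_ok_def algebra_simps)
    moreover have "tile_acts M (D (t * W + (c' + 1))) = acts_at t"
      "tile_heads (D (t * W + (c' + 1))) ! j \<longleftrightarrow> hpos t j = int (c' + 1) - int L"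
      using acts[of "c' + 1"] Suc.IH[of "c' + 1"] cW t j by auto
    ultimately show ?thesis using Move_Right j c' by (auto simp: rel_move_def conf_Suc)
  qed
  show ?case
    using below old heads by (auto simp: rel_below_def conf_Suc)
qed

end


theorem tableau_correct:
  assumes M: "wf_tm M" "2 \<le> num_tapes M"
  shows "(\<exists>f. satisfies ((T + 1) * row_width T Q) (length (tiles M)) (tableau_items M T Q x) f) \<longleftrightarrow>
    (\<exists>u. length u \<le> Q \<and> accepts_within M [x, u] T)"
proof
  assume "\<exists>u. length u \<le> Q \<and> accepts_within M [x, u] T"
  thus "\<exists>f. satisfies ((T + 1) * row_width T Q) (length (tiles M)) (tableau_items M T Q x) f"
    using tableau_complete[OF M] by blast
next
  define L where "L = left_width T"
  define W where "W = row_width T Q"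
  have LW: "L = 2 * T + 2" "W = 2 * L + Q" by (auto simp: L_def W_def left_width_def row_width_def)
  assume "\<exists>f. satisfies ((T + 1) * row_width T Q) (length (tiles M)) (tableau_items M T Q x) f"
  then obtain f where f: "\<And>i. i < (T + 1) * W \<Longrightarrow> f i < length (tiles M)"
      "\<forall>it\<in>set (tableau_items M T Q x). item_sat f it"
    unfolding satisfies_def W_def by blast
  define D where "D i = tiles M ! f i" for i
  note sat = f(2)[unfolded satisfies_tableau[of D M f, OF D_def] L_def[symmetric] W_def[symmetric]]
  from sat have trans: "\<And>t c. t < T \<Longrightarrow> c < W - 2 \<Longrightarrow> transition_ok M W D (t * W + c)" by blast
  from sat have left: "\<And>c. c < L \<Longrightarrow> tile_left M (D c)"
    and inp: "\<And>p. p < L + Q \<Longrightarrow> tile_input M (input_symbol x p) (D (p + L))"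
    and head: "tile_head M True (D L)" "\<And>p. p < L + Q - 1 \<Longrightarrow> tile_head M False (D (p + L + 1))"
    and nocert: "\<And>i. i < L \<Longrightarrow> tile_no_certificate (D (i + L + Q))"
    and cert: "\<And>i. i < L + Q - 1 \<Longrightarrow> rel_certificate (D (i + L)) (D (i + L + 1))"
    and acc: "tile_accept (D (T * W + L))" by blast+
  have D: "D (t * W + c) \<in> set (tiles M)" if "t \<le> T" "c < W" for t c
  proof -
    have "t * W + c < (t + 1) * W" using that by simp
    also have "\<dots> \<le> (T + 1) * W" using that by (intro mult_le_mono1) simp
    finally show ?thesis unfolding D_def using f(1) by simp
  qed
  define g where "g p = tile_syms (D (p + L)) ! 1" for p
  \<comment> \<open>The first blank on the certificate tape in row 0; it occurs at position
    \<open>Q\<close> at the latest, which gives the bound on the length.\<close>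
  define n where "n = (LEAST p. g p = 0)"
  have gQ: "g Q = 0" using nocert[of 0] LW by (simp add: tile_no_certificate_def g_def add.commute)
  hence nQ: "n \<le> Q" and gn: "g n = 0" unfolding n_def by (auto intro: Least_le LeastI)
  have before: "g p \<noteq> 0" if "p < n" for p using not_less_Least that unfolding n_def by blast
  have g0: "g (n + d) = 0" if "n + d < L + Q" for d
    using that
  proof (induction d)
    case 0
    show ?case using gn by simp
  next
    case (Suc d)
    thus ?case using cert[of "n + d"] by (simp add: rel_certificate_def g_def add.commute add.left_commute)
  qed
  have after: "g p = 0" if "n \<le> p" "p < L + Q" for p using that g0[of "p - n"] by simp
  \<comment> \<open>Since \<open>tile_input\<close> restricts this tape to symbols below 3, the
    nonblank cells carry bits, and 2 stands for \<open>True\<close>.\<close>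
  define u where "u = map (\<lambda>p. g p = 2) [0..<n]"
  have gu: "g p = input_symbol u p" if "p < L + Q" for p
  proof (cases "p < n")
    case True
    have "g p < 3" using inp[OF that] by (simp add: tile_input_def g_def)
    hence "g p = 1 \<or> g p = 2" using before[OF True] by linarith
    thus ?thesis using True by (auto simp: u_def input_symbol_def bit_symbol_def)
  next
    case False
    thus ?thesis using after that by (simp add: u_def input_symbol_def)
  qed
  have init: "tile_state (D c) = start_state \<and>
       (\<forall>j<num_tapes M. tile_syms (D c) ! j = content M x u 0 j (int c - int L) \<and>
          (tile_heads (D c) ! j \<longleftrightarrow> hpos M x u 0 j = int c - int L))" if c: "c < W" for c
  proof (cases "c < L")
    case True
    have "content M x u 0 j (int c - int L) = 0" if "j < num_tapes M" for j
    proof -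
      consider "j = 0" | "j = 1" | "2 \<le> j" by linarith
      thus ?thesis using that True M by cases (auto simp: conf_0 simp del: One_nat_def)
    qed
    thus ?thesis using left[OF True] True by (auto simp: tile_left_def conf_0[OF M])
  next
    case False
    then obtain p where p: "c = p + L" by (metis add.commute le_Suc_ex not_less)
    have pL: "p < L + Q" using c LW p by simp
    note i = inp[OF pL]
    have pos: "int c - int L = int p" using p by simp
    have "tile_syms (D c) ! j = content M x u 0 j (int p)" if "j < num_tapes M" for j
    proof -
      consider "j = 0" | "j = 1" | "2 \<le> j" by linarith
      thus ?thesis
      proof cases
        case 1
        thus ?thesis using i p by (simp add: tile_input_def conf_0[OF M])
      next
        case 2
        thus ?thesis using gu[OF pL] p by (simp add: g_def conf_0[OF M] del: One_nat_def)
      next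
        case 3
        thus ?thesis using i p that by (simp add: tile_input_def conf_0[OF M])
      qed
    qed
    moreover have "tile_heads (D c) ! j \<longleftrightarrow> hpos M x u 0 j = int p" if "j < num_tapes M" for j
    proof (cases p)
      case 0
      thus ?thesis using head(1) p that by (simp add: tile_head_def conf_0[OF M])
    next
      case (Suc p')
      thus ?thesis using head(2)[of p'] p pL that by (simp add: tile_head_def conf_0[OF M])
    qed
    moreover have "tile_state (D c) = start_state" using i p by (simp add: tile_input_def)
    ultimately show ?thesis unfolding pos by simp
  qed
  have "tile_state (D (T * W + L)) = fst (conf M x u T)"
    using tableau_sound_step[OF M, where D = D and t = T and T = T and Q = Q and x = x and u = u
        and c = L, folded L_def W_def, OF D trans init] LW by simp
  hence "accepts_within M [x, u] T"
    using acc by (simp add: accepts_within_def tile_accept_def conf_def[OF M])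
  moreover have "length u \<le> Q" using nQ by (simp add: u_def)
  ultimately show "\<exists>u. length u \<le> Q \<and> accepts_within M [x, u] T" by blast
qed

section \<open>Emitting the graph\<close>

text \<open>Vertices and cells are denoted by numbers in terms of the counters, of which counter 3 holds
  the width of a row.\<close>

type_synonym sym_num = "nat list \<times> nat list \<times> nat"

definition sym_value :: "nat \<Rightarrow> (nat \<Rightarrow> nat) \<Rightarrow> sym_num \<Rightarrow> nat" where
  "sym_value s c = (\<lambda>(ts, cs, k). s * (sum_list (map c ts) * c 3 + sum_list (map c cs)) + k)"

definition sym_ok :: "nat \<Rightarrow> sym_num \<Rightarrow> bool" where
  "sym_ok nc = (\<lambda>(ts, cs, k). (\<forall>t\<in>set ts. 4 \<le> t \<and> t < nc) \<and> (\<forall>r\<in>set cs. 3 \<le> r \<and> r < nc))"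

definition f_ones :: "nat \<Rightarrow> frag" where
  "f_ones n = f_seqs (map (\<lambda>_. f_emit True) [0..<n])"

text \<open>The unary number is written by loops: every term of \<open>ts\<close> is multiplied by
  the row width with two nested loops, whose indices are the counters 1 and 2. The factor 2 and
  \<open>b\<close> come from \<open>vertex_id\<close>.\<close>

definition f_vertex :: "nat \<Rightarrow> sym_num \<Rightarrow> nat \<Rightarrow> frag" where
  "f_vertex s = (\<lambda>(ts, cs, k) b.
     f_seqs (map (\<lambda>t. f_for t 1 (f_for 3 2 (f_ones (2 * s)))) ts) ;;
     f_seqs (map (\<lambda>r. f_for r 1 (f_ones (2 * s))) cs) ;; f_ones (2 * k + b) ;; f_emit False)"

lemma concat_replicates:
  "concat (map (\<lambda>i. replicate (F i) b) xs) = replicate (sum_list (map F xs)) b"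
  by (induction xs) (auto simp: replicate_add)

lemma emits_ones: "emits nc (\<lambda>b. [b]) (f_ones n) Z (\<lambda>x c. replicate n True)"
proof -
  have "emits nc (\<lambda>b. [b]) (f_ones n) Z (\<lambda>x c. concat (map (\<lambda>_. replicate 1 True) [0..<n]))"
    unfolding f_ones_def using emits_emit by (intro emits_seqs) simp
  thus ?thesis by (simp add: concat_replicates sum_list_triv del: replicate.simps)
qed

lemma emits_vertex:
  assumes v: "sym_ok nc v" and nc: "3 < nc" and Z: "{1, 2} \<subseteq> Z" "Z \<inter> {1, 2} = Z"
  shows "emits nc (\<lambda>b. [b]) (f_vertex s v b) Z (\<lambda>x c. enc_nat (2 * sym_value s c v + b))"
proof -
  obtain ts cs k where vv: "v = (ts, cs, k)" by (cases v) auto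
  have z: "Z = {1, 2}" using Z by auto
  have t: "emits nc (\<lambda>b. [b]) (f_for t 1 (f_for 3 2 (f_ones (2 * s)))) Z
      (\<lambda>x c. replicate (2 * s * (c t * c 3)) True)" if "t \<in> set ts" for t
  proof -
    have "4 \<le> t" "t < nc" using v that vv by (auto simp: sym_ok_def)
    hence "emits nc (\<lambda>b. [b]) (f_for t 1 (f_for 3 2 (f_ones (2 * s)))) Z
      (\<lambda>x c. concat (map (\<lambda>i. (\<lambda>x c. concat (map (\<lambda>i. replicate (2 * s) True) [0..<c 3])) x
        (c(t := c t - i - 1, 1 := i))) [0..<c t]))"
      unfolding z using nc by (intro emits_for emits_ones) auto
    thus ?thesis using \<open>4 \<le> t\<close>
      by (elim emits_weaken) (auto simp: concat_replicates sum_list_triv algebra_simps)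
  qed
  have r: "emits nc (\<lambda>b. [b]) (f_for r 1 (f_ones (2 * s))) Z
      (\<lambda>x c. replicate (2 * s * c r) True)" if "r \<in> set cs" for r
  proof -
    have "3 \<le> r" "r < nc" using v that vv by (auto simp: sym_ok_def)
    hence "emits nc (\<lambda>b. [b]) (f_for r 1 (f_ones (2 * s))) Z
      (\<lambda>x c. concat (map (\<lambda>i. replicate (2 * s) True) [0..<c r]))"
      unfolding z using nc by (intro emits_for emits_ones) auto
    thus ?thesis by (elim emits_weaken) (auto simp: concat_replicates sum_list_triv algebra_simps)
  qed
  have T: "emits nc (\<lambda>b. [b]) (f_seqs (map (\<lambda>t. f_for t 1 (f_for 3 2 (f_ones (2 * s)))) ts)) Z
      (\<lambda>x c. replicate (\<Sum>t\<leftarrow>ts. 2 * s * (c t * c 3)) True)"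
    using emits_seqs[of ts, OF t] by (simp add: concat_replicates)
  have R: "emits nc (\<lambda>b. [b]) (f_seqs (map (\<lambda>r. f_for r 1 (f_ones (2 * s))) cs)) Z
      (\<lambda>x c. replicate (\<Sum>r\<leftarrow>cs. 2 * s * c r) True)"
    using emits_seqs[of cs, OF r] by (simp add: concat_replicates)
  have "emits nc (\<lambda>b. [b]) (f_vertex s v b) Z
      (\<lambda>x c. replicate (\<Sum>t\<leftarrow>ts. 2 * s * (c t * c 3)) True @
        replicate (\<Sum>r\<leftarrow>cs. 2 * s * c r) True @ replicate (2 * k + b) True @ [False])"
    unfolding vv f_vertex_def prod.case by (intro emits_seq T R emits_ones emits_emit)
  thus ?thesis
  proof (rule emits_weaken)
    fix x c
    have "(\<Sum>t\<leftarrow>ts. 2 * s * (c t * c 3)) = 2 * (s * (sum_list (map c ts) * c 3))"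
      by (induction ts) (auto simp: algebra_simps)
    moreover have "(\<Sum>r\<leftarrow>cs. 2 * s * c r) = 2 * (s * sum_list (map c cs))"
      by (induction cs) (auto simp: algebra_simps)
    ultimately show "replicate (\<Sum>t\<leftarrow>ts. 2 * s * (c t * c 3)) True @
        replicate (\<Sum>r\<leftarrow>cs. 2 * s * c r) True @ replicate (2 * k + b) True @ [False] =
        enc_nat (2 * sym_value s c v + b)"
      by (simp add: enc_nat_def vv sym_value_def replicate_add[symmetric] algebra_simps
          flip: append_assoc)
  qed simp
qed

definition f_edge :: "nat \<Rightarrow> sym_num pedge \<Rightarrow> frag" where
  "f_edge s = (\<lambda>((v, i), (w, j)). f_emit True ;; f_vertex s v i ;; f_vertex s w j)"

definition f_edges :: "nat \<Rightarrow> sym_num pedge list \<Rightarrow> frag" where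
  "f_edges s es = f_seqs (map (f_edge s) es)"

text \<open>Gadgets are polymorphic in the vertices. The same definitions thus serve as program text
  over symbolic numbers and as edges over naturals, and evaluating symbols commutes with building
  gadgets.\<close>

definition map_pedge :: "('a \<Rightarrow> 'b) \<Rightarrow> 'a pedge \<Rightarrow> 'b pedge" where
  "map_pedge g = (\<lambda>((v, i), (w, j)). ((g v, i), (g w, j)))"

definition out_edge :: "nat pedge \<Rightarrow> bool list" where
  "out_edge e = True # enc_pair (edge_id e)"

definition pedge_ok :: "('a \<Rightarrow> bool) \<Rightarrow> 'a pedge \<Rightarrow> bool" where
  "pedge_ok ok = (\<lambda>((v, i), (w, j)). ok v \<and> ok w)"

lemma emits_edges:
  assumes es: "list_all (pedge_ok (sym_ok nc)) es" and nc: "3 < nc" and Z: "{1, 2} \<subseteq> Z"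
  shows "emits nc out_edge (f_edges s es) Z (\<lambda>x c. map (map_pedge (sym_value s c)) es)"
proof -
  have "emits nc out_edge (f_edges s es) {1, 2}
      (\<lambda>x c. concat (map (\<lambda>e. [map_pedge (sym_value s c) e]) es))"
    unfolding f_edges_def
  proof (rule emits_seqs)
    fix e assume "e \<in> set es"
    obtain v i w j where e: "e = ((v, i), (w, j))" by (metis surj_pair)
    have ok: "sym_ok nc v" "sym_ok nc w"
      using es \<open>e \<in> set es\<close> unfolding e by (auto simp: list_all_iff pedge_ok_def)
    have "emits nc (\<lambda>b. [b]) (f_edge s e) {1, 2}
       (\<lambda>x c. [True] @ enc_nat (2 * sym_value s c v + i) @ enc_nat (2 * sym_value s c w + j))"
      unfolding e f_edge_def prod.case
      by (intro emits_seq emits_emit emits_vertex ok nc) auto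
    thus "emits nc out_edge (f_edge s e) {1, 2} (\<lambda>x c. [map_pedge (sym_value s c) e])"
      by (simp add: emits_def e map_pedge_def out_edge_def edge_id_def vertex_id_def enc_pair_def)
  qed
  moreover have "concat (map (\<lambda>e. [g e]) es) = map g es" for g :: "sym_num pedge \<Rightarrow> nat pedge"
    by (induction es) auto
  ultimately show ?thesis using Z by (auto intro: emits_subset)
qed

lemma map_pedge_gadgets:
  "map (map_pedge g) (pen_edges z a b) = pen_edges (g z) (g a) (g b)"
  "map (map_pedge g) (forbid_edges z a) = forbid_edges (g z) (g a)"
  "map (map_pedge g) (reward_edges z z' a) = reward_edges (g z) (g z') (g a)"
  "map (map_pedge g) (bonus_edges z z') = bonus_edges (g z) (g z')"
  "map (map_pedge g) (const_edges z k) = const_edges (g z) k"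
  "map (map_pedge g) (cross_edges a b) = cross_edges (g a) (g b)"
  by (simp_all add: gadget_defs map_pedge_def)

lemma map_pedge_bin: "map (map_pedge g) (bin_edges s z p q R) = bin_edges s (g z) (g \<circ> p) (g \<circ> q) R"
  by (simp add: bin_edges_def map_concat comp_def map_pedge_gadgets)

lemma map_pedge_un: "map (map_pedge g) (un_edges s z p U) = un_edges s (g z) (g \<circ> p) U"
  by (simp add: un_edges_def map_concat comp_def map_pedge_gadgets)

lemma map_pedge_cell: "map (map_pedge g) (cell_edges s z z' p) = cell_edges s (g z) (g z') (g \<circ> p)"
  by (simp add: cell_edges_def map_pedge_bin map_concat comp_def map_pedge_gadgets)

lemma pedge_ok_gadgets:
  "ok z \<Longrightarrow> ok a \<Longrightarrow> ok b \<Longrightarrow> list_all (pedge_ok ok) (pen_edges z a b)"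
  "ok z \<Longrightarrow> ok a \<Longrightarrow> list_all (pedge_ok ok) (forbid_edges z a)"
  "ok z \<Longrightarrow> ok z' \<Longrightarrow> ok a \<Longrightarrow> list_all (pedge_ok ok) (reward_edges z z' a)"
  "ok z \<Longrightarrow> ok z' \<Longrightarrow> list_all (pedge_ok ok) (bonus_edges z z')"
  "ok z \<Longrightarrow> list_all (pedge_ok ok) (const_edges z k)"
  "ok a \<Longrightarrow> ok b \<Longrightarrow> list_all (pedge_ok ok) (cross_edges a b)"
  by (auto simp: gadget_defs pedge_ok_def list_all_iff)

lemma pedge_ok_bin:
  "ok z \<Longrightarrow> (\<And>a. ok (p a)) \<Longrightarrow> (\<And>a. ok (q a)) \<Longrightarrow> list_all (pedge_ok ok) (bin_edges s z p q R)"
  by (auto simp: bin_edges_def list_all_concat intro!: pedge_ok_gadgets)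

lemma pedge_ok_un:
  "ok z \<Longrightarrow> (\<And>a. ok (p a)) \<Longrightarrow> list_all (pedge_ok ok) (un_edges s z p U)"
  by (auto simp: un_edges_def list_all_concat intro!: pedge_ok_gadgets)

lemma pedge_ok_cell:
  "ok z \<Longrightarrow> ok z' \<Longrightarrow> (\<And>a. ok (p a)) \<Longrightarrow> list_all (pedge_ok ok) (cell_edges s z z' p)"
  by (auto simp: cell_edges_def list_all_concat intro!: pedge_ok_gadgets pedge_ok_bin)

text \<open>For a cell denoted by \<open>i\<close> with factor 1, evaluation with factor
  \<open>s\<close> scales the counters but not the constant part. So \<open>d\<close> is scaled
  here, and 2 skips the auxiliary pairs.\<close>

definition sym_pair :: "nat \<Rightarrow> sym_num \<Rightarrow> nat \<Rightarrow> sym_num" where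
  "sym_pair s = (\<lambda>(ts, cs, d) a. (ts, cs, 2 + s * d + a))"

abbreviation "sym_const k \<equiv> (([], [], k) :: sym_num)"

lemma sym_pair_value: "sym_value s c \<circ> sym_pair s i = pair_of s (sym_value 1 c i)"
  by (cases i) (auto simp: fun_eq_iff sym_value_def sym_pair_def pair_of_def algebra_simps)

lemma sym_ok_pair: "sym_ok nc i \<Longrightarrow> sym_ok nc (sym_pair s i a)"
  by (auto simp: sym_ok_def sym_pair_def)

lemma sym_const_value: "sym_value s c (sym_const k) = k"
  by (simp add: sym_value_def)

lemma sym_ok_const: "sym_ok nc (sym_const k)"
  by (simp add: sym_ok_def)

definition out_item :: "nat \<Rightarrow> item \<Rightarrow> bool list" where
  "out_item s it = concat (map out_edge (item_edges s it))"

text \<open>The relation is evaluated when the program is built: its finitely many violations are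
  unrolled into the code, and only the cell numbers depend on counters.\<close>

definition f_binary :: "nat \<Rightarrow> sym_num \<Rightarrow> sym_num \<Rightarrow> (nat \<Rightarrow> nat \<Rightarrow> bool) \<Rightarrow> frag" where
  "f_binary s i j R = f_edges s (bin_edges s (sym_const 0) (sym_pair s i) (sym_pair s j) R)"

definition f_unary :: "nat \<Rightarrow> sym_num \<Rightarrow> (nat \<Rightarrow> bool) \<Rightarrow> frag" where
  "f_unary s i U = f_edges s (un_edges s (sym_const 0) (sym_pair s i) U)"

lemma emits_binary:
  assumes "sym_ok nc i" "sym_ok nc j" "3 < nc" "{1, 2} \<subseteq> Z"
  shows "emits nc (out_item s) (f_binary s i j R) Z
    (\<lambda>x c. [Binary (sym_value 1 c i) (sym_value 1 c j) R])"
proof -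
  have "emits nc out_edge (f_binary s i j R) Z
      (\<lambda>x c. concat (map (item_edges s) [Binary (sym_value 1 c i) (sym_value 1 c j) R]))"
    using emits_edges[of nc "bin_edges s (sym_const 0) (sym_pair s i) (sym_pair s j) R" Z s] assms
    by (simp add: f_binary_def map_pedge_bin sym_pair_value sym_const_value pedge_ok_bin sym_ok_pair
        sym_ok_const)
  from emits_regroup[THEN iffD1, OF this] show ?thesis by (simp add: out_item_def[abs_def])
qed

lemma emits_unary:
  assumes "sym_ok nc i" "3 < nc" "{1, 2} \<subseteq> Z"
  shows "emits nc (out_item s) (f_unary s i U) Z (\<lambda>x c. [Unary (sym_value 1 c i) U])"
proof -
  have "emits nc out_edge (f_unary s i U) Z
      (\<lambda>x c. concat (map (item_edges s) [Unary (sym_value 1 c i) U]))"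
    using emits_edges[of nc "un_edges s (sym_const 0) (sym_pair s i) U" Z s] assms
    by (simp add: f_unary_def map_pedge_un sym_pair_value sym_const_value pedge_ok_un sym_ok_pair
        sym_ok_const)
  from emits_regroup[THEN iffD1, OF this] show ?thesis by (simp add: out_item_def[abs_def])
qed


section \<open>Computing the dimensions of the tableau\<close>

datatype arith_op = AddC nat nat | AddP nat nat nat

fun run_op :: "arith_op \<Rightarrow> (nat \<Rightarrow> nat) \<Rightarrow> nat \<Rightarrow> nat" where
  "run_op (AddC r k) c = c(r := c r + k)"
| "run_op (AddP r a b) c = c(r := c r + c a * c b)"

fun f_op :: "arith_op \<Rightarrow> frag" where
  "f_op (AddC r k) = f_add_const r k"
| "f_op (AddP r a b) = f_add_prod 1 2 r a b"

fun op_ok :: "nat \<Rightarrow> arith_op \<Rightarrow> bool" where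
  "op_ok nc (AddC r k) \<longleftrightarrow> 3 \<le> r \<and> r < nc"
| "op_ok nc (AddP r a b) \<longleftrightarrow> 3 \<le> r \<and> r < nc \<and> a < nc \<and> b < nc \<and> distinct [1, 2, r, a, b]"

lemma setup_ops:
  assumes "list_all (op_ok nc) ops" "2 < nc"
  shows "setup_prog nc (f_seqs (map f_op ops)) (\<lambda>c. c 1 = 0 \<and> c 2 = 0) (fold run_op ops)"
  using assms(1)
proof (induction ops)
  case Nil
  show ?case using setup_skip by (simp add: f_seqs_def id_def)
next
  case (Cons op ops)
  have "setup_prog nc (f_op op) (\<lambda>c. c 1 = 0 \<and> c 2 = 0) (run_op op)"
  proof (cases op)
    case (AddC r k)
    have "run_op op = (\<lambda>c. c(r := c r + k))" using AddC by (auto simp: fun_eq_iff)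
    thus ?thesis using AddC Cons.prems setup_add_const[of r nc k] by simp
  next
    case (AddP r a b)
    have "run_op op = (\<lambda>c. c(r := c r + c a * c b))" using AddP by (auto simp: fun_eq_iff)
    thus ?thesis using AddP Cons.prems setup_add_prod[of 1 nc 2 r a b] assms(2) by simp
  qed
  note op = this
  have "list_all (op_ok nc) ops" using Cons.prems by simp
  note seq = setup_seq[OF op Cons.IH[OF this]]
  have "setup_prog nc (f_op op ;; f_seqs (map f_op ops)) (\<lambda>c. c 1 = 0 \<and> c 2 = 0)
      (\<lambda>c. fold run_op ops (run_op op c))"
  proof (rule seq)
    show "run_op op c 1 = 0 \<and> run_op op c 2 = 0" if "c 1 = 0 \<and> c 2 = 0" for c
      using that Cons.prems by (cases op) auto
  qed
  thus ?case by (simp add: f_seqs_def comp_def)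
qed

text \<open>Horner evaluation at counter 0, the input length. Counters can only be increased, so
  each partial result has a fresh counter; the counter behind the last coefficient stays 0 and is
  the value of the empty polynomial.\<close>

fun horner :: "nat list \<Rightarrow> nat \<Rightarrow> arith_op list" where
  "horner [] d = []"
| "horner (a # as) d = horner as (d + 1) @ [AddP d 0 (d + 1), AddC d a]"

lemma horner_run:
  assumes "\<And>r. d \<le> r \<Longrightarrow> c r = 0" "0 < d"
  shows "fold run_op (horner as d) c d = poly (Poly as) (c 0) \<and>
    (\<forall>r. r < d \<or> d + length as \<le> r \<longrightarrow> fold run_op (horner as d) c r = c r)"
  using assms
proof (induction as arbitrary: d)
  case (Cons a as)
  define c' where "c' = fold run_op (horner as (d + 1)) c"
  have IH: "c' (d + 1) = poly (Poly as) (c 0)"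
    "\<And>r. r < d + 1 \<or> d + 1 + length as \<le> r \<Longrightarrow> c' r = c r"
    using Cons.IH[of "d + 1"] Cons.prems by (auto simp: c'_def)
  have "c' d = 0" "c' 0 = c 0" using IH(2) Cons.prems by auto
  moreover have "fold run_op (horner (a # as) d) c = c'(d := c' d + c' 0 * c' (d + 1) + a)"
    by (auto simp: c'_def fun_eq_iff)
  ultimately show ?case using IH by auto
qed simp

lemma horner_ok:
  "3 \<le> d \<Longrightarrow> d + length as < nc \<Longrightarrow> list_all (op_ok nc) (horner as d)"
  by (induction as arbitrary: d) auto

text \<open>Counters 4 to 8 are loop indices, 9 and 21 to 23 constants; 30 and \<open>q0\<close> hold the time bound
  and the bound on the certificate. The number of vertex pairs is needed four times, for the bounds
  of nested loops.\<close>

definition layout_ops :: "nat \<Rightarrow> nat \<Rightarrow> arith_op list" where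
  "layout_ops s q0 =
     [AddC 9 1, AddC 21 s, AddC 22 2, AddC 23 4,
      AddP 10 9 30, AddP 12 9 q0,
      AddP 11 22 10, AddC 11 2,
      AddP 13 9 11, AddP 13 9 12,
      AddP 14 22 10, AddP 14 9 12, AddC 14 1,
      AddP 15 23 10, AddP 15 9 12, AddC 15 2,
      AddP 3 9 15, AddC 3 2,
      AddP 16 10 3, AddP 16 9 3,
      AddP 17 21 16, AddC 17 2, AddP 18 21 16, AddC 18 2,
      AddP 19 21 16, AddC 19 2, AddP 20 21 16, AddC 20 2]"

lemma layout_ops_ok: "31 \<le> q0 \<Longrightarrow> q0 < nc \<Longrightarrow> list_all (op_ok nc) (layout_ops s q0)"
  by (auto simp: layout_ops_def)

definition layout :: "nat \<Rightarrow> nat \<Rightarrow> nat \<Rightarrow> (nat \<Rightarrow> nat) \<Rightarrow> bool" where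
  "layout s T Q c \<longleftrightarrow>
     (let L = left_width T; W = row_width T Q; m = 2 + (T + 1) * W * s in
      c 3 = W \<and> c 10 = T \<and> c 11 = L \<and> c 13 = L + Q \<and> c 14 = L + Q - 1 \<and> c 15 = W - 2 \<and>
      c 16 = (T + 1) * W \<and> c 17 = m \<and> c 18 = m \<and> c 19 = m \<and> c 20 = m)"

text \<open>Subtraction is avoided by computing L + Q - 1 as 2 T + Q + 1 and W - 2 as 4 T + Q + 2.
  Adding a product with counter 9, which holds 1, copies a counter.\<close>

lemma layout_ops_run:
  fixes s :: nat
  assumes "\<And>r. 0 < r \<Longrightarrow> r < 30 \<Longrightarrow> c r = 0" "31 \<le> q0" "c 30 = T" "c q0 = Q"
  shows "layout s T Q (fold run_op (layout_ops s q0) c)"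
    "\<And>r. r \<in> {1, 2, 4, 5, 6, 7, 8} \<Longrightarrow> fold run_op (layout_ops s q0) c r = 0"
  using assms unfolding layout_ops_def layout_def Let_def row_width_def left_width_def
  by (auto simp: algebra_simps)

text \<open>While the loop over counter 7 runs with index 8, counter 7 holds the number of rounds
  still to come. The larger pair is therefore recovered as the sum of the counters 7 and 8 plus 1.
  The multiplicity arises from three loops around \<open>C\<close> textual copies.\<close>

definition f_base :: "nat \<Rightarrow> frag" where
  "f_base C = f_for 18 4 (f_for 19 5 (f_for 20 6 (f_seqs (map (\<lambda>_. f_for 17 7 (f_for 7 8
     (f_edges 1 (cross_edges ([], [7, 8], 1) ([], [8], 0))))) [0..<C]))))"

lemma concat_map_const: "concat (map (\<lambda>_. xs) [0..<n]) = concat (replicate n xs)"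
  by (simp add: map_replicate_const)

lemma concat_replicate_mult:
  "concat (replicate a (concat (replicate b xs))) = concat (replicate (a * b) xs)"
  by (induction a) (auto simp: replicate_add)

lemma emits_base:
  assumes "24 \<le> nc"
  shows "emits nc out_edge (f_base C) {1, 2, 4, 5, 6, 7, 8}
    (\<lambda>x c. concat (replicate (c 18 * (c 19 * (c 20 * C))) (all_cross (c 17))))"
proof -
  let ?e = "cross_edges ([], [7, 8], 1) ([], [8], 0) :: sym_num pedge list"
  have 1: "emits nc out_edge (f_edges 1 ?e) {1, 2} (\<lambda>x c. cross_edges (c 7 + c 8 + 1) (c 8))"
    using emits_edges[of nc ?e "{1, 2}" 1] assms
    by (simp add: map_pedge_gadgets sym_value_def pedge_ok_gadgets sym_ok_def)
  have "emits nc out_edge (f_for 7 8 (f_edges 1 ?e)) {1, 2, 8}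
    (\<lambda>x c. concat (map (\<lambda>i. (\<lambda>x c. cross_edges (c 7 + c 8 + 1) (c 8)) x (c(7 := c 7 - i - 1, 8 := i))) [0..<c 7]))"
    using assms by (intro emits_for emits_subset[OF 1]) auto
  hence 2: "emits nc out_edge (f_for 7 8 (f_edges 1 ?e)) {1, 2, 8}
    (\<lambda>x c. concat (map (\<lambda>i. cross_edges (c 7) i) [0..<c 7]))"
    by (elim emits_weaken) (auto intro!: arg_cong[of _ _ concat])
  have "emits nc out_edge (f_for 17 7 (f_for 7 8 (f_edges 1 ?e))) {1, 2, 7, 8}
    (\<lambda>x c. concat (map (\<lambda>i. (\<lambda>x c. concat (map (\<lambda>i. cross_edges (c 7) i) [0..<c 7])) x (c(17 := c 17 - i - 1, 7 := i))) [0..<c 17]))"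
    using assms by (intro emits_for emits_subset[OF 2]) auto
  hence 3: "emits nc out_edge (f_for 17 7 (f_for 7 8 (f_edges 1 ?e))) {1, 2, 7, 8} (\<lambda>x c. all_cross (c 17))"
    by (elim emits_weaken) (auto simp: all_cross_def)
  have "emits nc out_edge (f_base C) {1, 2, 4, 5, 6, 7, 8}
    (\<lambda>x c. concat (map (\<lambda>i. (\<lambda>x c. concat (map (\<lambda>i. (\<lambda>x c. concat (map (\<lambda>i.
      (\<lambda>x c. concat (map (\<lambda>_. all_cross (c 17)) [0..<C])) x
      (c(20 := c 20 - i - 1, 6 := i))) [0..<c 20])) x (c(19 := c 19 - i - 1, 5 := i))) [0..<c 19])) x
      (c(18 := c 18 - i - 1, 4 := i))) [0..<c 18]))"
    unfolding f_base_def using assms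
    by (intro emits_for emits_seqs emits_subset[OF 3]) auto
  thus ?thesis by (elim emits_weaken) (auto simp: concat_map_const concat_replicate_mult)
qed

definition f_cells :: "nat \<Rightarrow> frag" where
  "f_cells s = f_for 16 4 (f_edges s (cell_edges s (sym_const 0) (sym_const 1)
     (sym_pair s ([], [4], 0))))"

lemma emits_cells:
  assumes "24 \<le> nc"
  shows "emits nc out_edge (f_cells s) {1, 2, 4}
    (\<lambda>x c. concat (map (\<lambda>i. cell_edges s 0 1 (pair_of s i)) [0..<c 16]))"
proof -
  let ?e = "cell_edges s (sym_const 0) (sym_const 1) (sym_pair s ([], [4], 0))"
  have "list_all (pedge_ok (sym_ok nc)) ?e"
    using assms by (intro pedge_ok_cell sym_ok_const sym_ok_pair) (simp add: sym_ok_def)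
  from emits_edges[OF this, of "{1, 2}" s] assms
  have 1: "emits nc out_edge (f_edges s ?e) {1, 2} (\<lambda>x c. cell_edges s 0 1 (pair_of s (c 4)))"
    by (simp add: map_pedge_cell sym_const_value sym_pair_value sym_value_def[of "Suc 0"])
  have "emits nc out_edge (f_cells s) {1, 2, 4}
    (\<lambda>x c. concat (map (\<lambda>i. (\<lambda>x c. cell_edges s 0 1 (pair_of s (c 4))) x (c(16 := c 16 - i - 1, 4 := i))) [0..<c 16]))"
    unfolding f_cells_def using assms by (intro emits_for emits_subset[OF 1]) auto
  thus ?thesis by (elim emits_weaken) auto
qed

definition f_transition :: "tm \<Rightarrow> nat \<Rightarrow> frag" where
  "f_transition M s =
     f_binary s ([4], [5], 1) ([4], [5], 2) (on_tiles2 M rel_label) ;;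
     f_binary s ([4], [5], 1) ([4], [5, 3], 1) (on_tiles2 M (rel_below M)) ;;
     f_binary s ([4], [5], 1) ([4], [5, 3], 0) (on_tiles2 M (rel_move M Move_Left)) ;;
     f_binary s ([4], [5], 1) ([4], [5, 3], 2) (on_tiles2 M (rel_move M Move_Right))"

definition f_items :: "tm \<Rightarrow> nat \<Rightarrow> frag" where
  "f_items M s =
     f_for 10 4 (f_for 15 5 (f_transition M s)) ;;
     f_for 11 4 (f_unary s ([], [4], 0) (on_tiles M (tile_left M))) ;;
     f_for 13 4 (f_read 4 5
       (f_unary s ([], [4, 11], 0) (on_tiles M (tile_input M 0)))
       (f_unary s ([], [4, 11], 0) (on_tiles M (tile_input M 1)))
       (f_unary s ([], [4, 11], 0) (on_tiles M (tile_input M 2)))) ;;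
     f_unary s ([], [11], 0) (on_tiles M (tile_head M True)) ;;
     f_for 14 4 (f_unary s ([], [4, 11], 1) (on_tiles M (tile_head M False))) ;;
     f_for 11 4 (f_unary s ([], [4, 13], 0) (on_tiles M tile_no_certificate)) ;;
     f_for 14 4 (f_binary s ([], [4, 11], 0) ([], [4, 11], 1) (on_tiles2 M rel_certificate)) ;;
     f_unary s ([10], [11], 0) (on_tiles M tile_accept)"

lemma emits_items:
  assumes "24 \<le> nc"
  shows "emits nc (out_item s) (f_items M s) {1, 2, 4, 5}
    (\<lambda>x c. item_list M x (c 3) (c 15) (c 10) (c 11) (c 13) (c 14))"
proof -
  have ok: "sym_ok nc ([4], [5], k)" "sym_ok nc ([4], [5, 3], k)" "sym_ok nc ([], [4], k)"
    "sym_ok nc ([], [4, 11], k)" "sym_ok nc ([], [11], k)" "sym_ok nc ([], [4, 13], k)"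
    "sym_ok nc ([10], [11], k)" for k
    using assms by (auto simp: sym_ok_def)
  have nc: "3 < nc" using assms by simp
  note un = emits_unary[OF ok(3) nc] emits_unary[OF ok(4) nc] emits_unary[OF ok(5) nc]
    emits_unary[OF ok(6) nc] emits_unary[OF ok(7) nc]
  note bin = emits_binary[OF ok(1) ok(1) nc] emits_binary[OF ok(1) ok(2) nc] emits_binary[OF ok(4) ok(4) nc]
  have 1: "emits nc (out_item s) (f_for 10 4 (f_for 15 5 (f_transition M s)))
      {1, 2, 4, 5} (\<lambda>x c. concat (map (\<lambda>t. concat (map (\<lambda>i.
          transition_items M (c 3) (t * c 3 + i)) [0..<c 15])) [0..<c 10]))"
    (is "emits _ _ (f_for 10 4 (f_for 15 5 ?f)) _ _")
  proof -
    have "emits nc (out_item s) ?f {1, 2} (\<lambda>x c.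
       [Binary (sym_value 1 c ([4], [5], 1)) (sym_value 1 c ([4], [5], 2)) (on_tiles2 M rel_label)] @
       [Binary (sym_value 1 c ([4], [5], 1)) (sym_value 1 c ([4], [5, 3], 1)) (on_tiles2 M (rel_below M))] @
       [Binary (sym_value 1 c ([4], [5], 1)) (sym_value 1 c ([4], [5, 3], 0)) (on_tiles2 M (rel_move M Move_Left))] @
       [Binary (sym_value 1 c ([4], [5], 1)) (sym_value 1 c ([4], [5, 3], 2)) (on_tiles2 M (rel_move M Move_Right))])"
      unfolding f_transition_def by (intro emits_seq bin) auto
    hence f: "emits nc (out_item s) ?f {1, 2} (\<lambda>x c. transition_items M (c 3) (c 4 * c 3 + c 5))"
      by (elim emits_weaken) (auto simp: sym_value_def transition_items_def)
    have "emits nc (out_item s) (f_for 10 4 (f_for 15 5 ?f)) {1, 2, 4, 5}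
      (\<lambda>x c. concat (map (\<lambda>t. (\<lambda>x c. concat (map (\<lambda>i. (\<lambda>x c. transition_items M (c 3) (c 4 * c 3 + c 5)) x
         (c(15 := c 15 - i - 1, 5 := i))) [0..<c 15])) x (c(10 := c 10 - t - 1, 4 := t))) [0..<c 10]))"
      using assms by (intro emits_for emits_subset[OF f]) auto
    thus ?thesis by (elim emits_weaken) auto
  qed
  have loop: "emits nc (out_item s) (f_for r 4 f) {1, 2, 4, 5}
      (\<lambda>x c. map (\<lambda>i. I x (c(r := c r - i - 1, 4 := i))) [0..<c r])"
    if f: "emits nc (out_item s) f {1, 2, 5} (\<lambda>x c. [I x c])" and r: "r < nc" "8 < r" for r f I
  proof -
    have "emits nc (out_item s) (f_for r 4 f) {1, 2, 4, 5}
      (\<lambda>x c. concat (map (\<lambda>i. (\<lambda>x c. [I x c]) x (c(r := c r - i - 1, 4 := i))) [0..<c r]))"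
      using assms r by (intro emits_for emits_subset[OF f]) auto
    thus ?thesis by (simp add: concat_map_singleton)
  qed
  have rd: "emits nc (out_item s) (f_read 4 5
       (f_unary s ([], [4, 11], 0) (on_tiles M (tile_input M 0)))
       (f_unary s ([], [4, 11], 0) (on_tiles M (tile_input M 1)))
       (f_unary s ([], [4, 11], 0) (on_tiles M (tile_input M 2)))) {1, 2, 5}
      (\<lambda>x c. [Unary (c 4 + c 11) (on_tiles M (tile_input M (input_symbol x (c 4))))])"
  proof -
    have "emits nc (out_item s) (f_unary s ([], [4, 11], 0) (on_tiles M (tile_input M a))) {1, 2, 5}
      (\<lambda>x c. [Unary (sym_value 1 c ([], [4, 11], 0)) (on_tiles M (tile_input M a))])" for a
      by (intro un) auto
    from emits_read[of 4 nc 5 "{1, 2, 5}" "out_item s", OF _ _ _ _ this] assms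
    show ?thesis by (simp add: sym_value_def)
  qed
  have sub: "{1, 2} \<subseteq> {1, 2, 5::nat}" "{1, 2} \<subseteq> {1, 2, 4, 5::nat}" by auto
  have r: "11 < nc" "8 < (11::nat)" "13 < nc" "8 < (13::nat)" "14 < nc" "8 < (14::nat)"
    using assms by auto
  note items = emits_seq[OF 1 emits_seq[OF loop[OF un(1)[OF sub(1)] r(1,2)]
    emits_seq[OF loop[OF rd r(3,4)] emits_seq[OF un(3)[OF sub(2)]
    emits_seq[OF loop[OF un(2)[OF sub(1)] r(5,6)] emits_seq[OF loop[OF un(4)[OF sub(1)] r(1,2)]
    emits_seq[OF loop[OF bin(3)[OF sub(1)] r(5,6)] un(5)[OF sub(2)]]]]]]]]
  show ?thesis
    unfolding f_items_def by (rule emits_weaken[OF items]) (auto simp: sym_value_def item_list_def)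
qed

section \<open>The reduction\<close>

lemma length_concat_le:
  assumes "\<And>a. a \<in> set xs \<Longrightarrow> length (F a) \<le> b"
  shows "length (concat (map F xs)) \<le> length xs * b"
  using assms by (induction xs) (auto intro: add_mono)

lemma length_bin_edges: "length (bin_edges s z p q R) \<le> 8 * s\<^sup>2"
proof -
  have "length (violations s R) \<le> s * s"
    unfolding violations_def by (rule order_trans[OF length_filter_le]) simp
  moreover have "length (bin_edges s z p q R) \<le> length (violations s R) * 8"
    unfolding bin_edges_def by (rule length_concat_le) (simp add: gadget_defs)
  ultimately show ?thesis by (simp add: power2_eq_square)
qed

lemma length_un_edges: "length (un_edges s z p U) \<le> 8 * s\<^sup>2"
proof -
  have "length (un_edges s z p U) \<le> length (filter (\<lambda>a. \<not> U a) [0..<s]) * 8"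
    unfolding un_edges_def by (rule length_concat_le) (simp add: gadget_defs)
  also have "\<dots> \<le> s * 8" by (intro mult_le_mono1 order_trans[OF length_filter_le]) simp
  also have "\<dots> \<le> 8 * s\<^sup>2" by (simp add: power2_eq_square)
  finally show ?thesis .
qed

lemma length_csp_edges:
  "length (csp_edges N s items) \<le> N * (8 * s + 8 * s\<^sup>2 + 8) + length items * (8 * s\<^sup>2) + 4"
proof -
  have "length (cell_edges s 0 1 p) \<le> 8 * s + 8 * s\<^sup>2 + 8" for p :: "nat \<Rightarrow> nat"
    using length_concat_le[of "[0..<s]" "\<lambda>a. reward_edges 0 1 (p a)" 8] length_bin_edges[of s 0 p p "(=)"]
    by (simp add: cell_edges_def gadget_defs)
  hence "length (concat (map (\<lambda>i. cell_edges s 0 1 (pair_of s i)) [0..<N])) \<le>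
      length [0..<N] * (8 * s + 8 * s\<^sup>2 + 8)"
    by (intro length_concat_le)
  moreover have "length (item_edges s it) \<le> 8 * s\<^sup>2" for it
    using length_bin_edges length_un_edges by (cases it) auto
  hence "length (concat (map (item_edges s) items)) \<le> length items * (8 * s\<^sup>2)"
    by (intro length_concat_le)
  ultimately show ?thesis by (simp add: csp_edges_def gadget_defs)
qed

text \<open>Each row but the last has at most 4 items per cell, and the remaining 5 L + 3 Q items
  are at most 4 W.\<close>

lemma length_tableau_items:
  "length (tableau_items M T Q x) \<le> 4 * ((T + 1) * row_width T Q)"
proof -
  define L where "L = left_width T"
  define W where "W = row_width T Q"
  have LW: "2 \<le> L" "W = 2 * L + Q" by (auto simp: L_def W_def left_width_def row_width_def)
  have "length (concat (map (\<lambda>t. concat (map (\<lambda>c. transition_items M W (t * W + c)) [0..<W - 2])) [0..<T]))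
      \<le> length [0..<T] * (length [0..<W - 2] * 4)"
    by (intro length_concat_le) (simp add: transition_items_def)
  also have "\<dots> \<le> T * (W * 4)" by simp
  finally have "length (tableau_items M T Q x) \<le> T * (W * 4) + (5 * L + 3 * Q)"
    unfolding tableau_items_def item_list_def Let_def L_def[symmetric] W_def[symmetric] using LW by simp
  also have "\<dots> \<le> 4 * ((T + 1) * W)" using LW by (simp add: algebra_simps)
  finally show ?thesis unfolding W_def .
qed

text \<open>The order is that of \<open>enc_graph\<close>: the number of vertices, which is twice
  counter 17, then the edges, each with its leading \<open>True\<close>, and the
  \<open>False\<close> that ends the list.\<close>

definition f_program :: "tm \<Rightarrow> nat \<Rightarrow> nat \<Rightarrow> frag" where
  "f_program M s C = f_vertex 1 ([], [17], 0) 0 ;; f_base C ;; f_cells s ;; f_items M s ;;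
     f_edges s (bonus_edges (sym_const 0) (sym_const 1)) ;; f_emit False"

lemma emits_regroup_bits:
  "emits nc h f Z I \<Longrightarrow> emits nc (\<lambda>b. [b]) f Z (\<lambda>x c. concat (map h (I x c)))"
  using emits_regroup[of nc "\<lambda>b. [b]" f Z h I] by simp

lemma emits_program:
  assumes nc: "24 \<le> nc"
  shows "\<exists>W. emits nc (\<lambda>b. [b]) (f_program M s C) {1, 2, 4, 5, 6, 7, 8} W \<and>
    (\<forall>x c T Q. layout s T Q c \<longrightarrow> (let N = (T + 1) * row_width T Q; m = 2 + N * s in
       W x c = enc_graph (2 * m) (graph_edges (m * (m * (m * C))) m
         (csp_edges N s (tableau_items M T Q x)))))"
proof -
  let ?Z = "{1, 2, 4, 5, 6, 7, 8}"
  have "emits nc (\<lambda>b. [b]) (f_vertex 1 ([], [17], 0) 0) {1, 2}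
      (\<lambda>x c. enc_nat (2 * sym_value 1 c ([], [17], 0) + 0))"
    using nc by (intro emits_vertex) (auto simp: sym_ok_def)
  hence 1: "emits nc (\<lambda>b. [b]) (f_vertex 1 ([], [17], 0) 0) ?Z (\<lambda>x c. enc_nat (2 * c 17))"
    by (elim emits_weaken) (auto simp: sym_value_def)
  have 2: "emits nc out_edge (f_edges s (bonus_edges (sym_const 0) (sym_const 1))) ?Z
      (\<lambda>x c. bonus_edges 0 1)"
    using emits_edges[of nc "bonus_edges (sym_const 0) (sym_const 1)" ?Z s] nc
    by (simp add: map_pedge_gadgets pedge_ok_gadgets sym_ok_const sym_const_value)
  have 3: "emits nc out_edge (f_cells s) ?Z (\<lambda>x c. concat (map (\<lambda>i. cell_edges s 0 1 (pair_of s i)) [0..<c 16]))"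
    by (rule emits_subset[OF emits_cells[OF nc]]) auto
  have sub: "{1, 2, 4, 5} \<subseteq> ?Z" by auto
  note items = emits_regroup[THEN iffD2, OF emits_subset[OF emits_items[OF nc, unfolded out_item_def[abs_def]] sub]]
  note prog = emits_seq[OF 1 emits_seq[OF emits_regroup_bits[OF emits_base[OF nc, of C]]
    emits_seq[OF emits_regroup_bits[OF 3] emits_seq[OF emits_regroup_bits[OF items[of M s]]
    emits_seq[OF emits_regroup_bits[OF 2] emits_emit[of nc False]]]]], folded f_program_def]
  show ?thesis
    by (rule exI, rule conjI[OF prog], intro allI impI, unfold layout_def Let_def, elim conjE,
        simp only: tableau_items_def item_list_def Let_def enc_graph_def enc_list_def graph_edges_def csp_edges_def
          concat_map_singleton map_append concat_append list.map_ident out_edge_def[abs_def] map_map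
          comp_def append_assoc add.assoc)
qed

theorem theorem2:
  fixes \<rho> :: real
  assumes "\<rho> > 0"
  shows "NP_hard (modularity_approximation \<rho>)"
  unfolding NP_hard_def
proof
  fix Lang assume "Lang \<in> NP"
  then obtain M p q where M: "wf_tm M" "num_tapes M \<ge> 2"
    and Lang: "\<And>x. x \<in> Lang \<longleftrightarrow> (\<exists>u. length u \<le> poly q (length x) \<and>
        accepts_within M [x, u] (poly p (length x)))"
    unfolding NP_def by blast
  define s where "s = length (tiles M)"
  have "tile_at M [] [] 0 0 \<in> set (tiles M)" by (rule tile_at_in_tiles[OF M])
  hence s: "1 \<le> s" unfolding s_def by (cases "tiles M") auto
  \<comment> \<open>Chosen such that \<open>m * (m * (m * C))\<close> is 4 m^2 times the edge bound
    \<open>m * (8 * s + 40 * s\<^sup>2 + 12)\<close>. At most 4 N items with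
    \<open>8 * s\<^sup>2\<close> edges each, added to those within the cells, give 40; the 4 bonus
    edges turn 8 into 12.\<close>
  define C where "C = 4 * (8 * s + 40 * s\<^sup>2 + 12)"
  \<comment> \<open>One more than the space for the coefficients of \<open>p\<close>: the evaluation
    also reads the counter behind the last one, which must remain 0. The same spare counter appears
    in \<open>nc\<close>.\<close>
  define q0 where "q0 = 31 + length (coeffs p)"
  define nc where "nc = q0 + length (coeffs q) + 1"
  have nc: "24 \<le> nc" "q0 < nc" "31 \<le> q0" by (auto simp: nc_def q0_def)
  define ops where "ops = horner (coeffs p) 30 @ horner (coeffs q) q0 @ layout_ops s q0"
  have "30 + length (coeffs p) < nc" "q0 + length (coeffs q) < nc" "3 \<le> q0"
    unfolding nc_def q0_def by linarith+
  hence ok: "list_all (op_ok nc) (horner (coeffs p) 30)" "list_all (op_ok nc) (horner (coeffs q) q0)"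
    by (intro horner_ok; simp)+
  have ok': "list_all (op_ok nc) (layout_ops s q0)"
    by (rule layout_ops_ok[OF nc(3,2)])
  have ops: "list_all (op_ok nc) ops"
    unfolding ops_def list_all_append by (intro conjI ok ok')
  define T where "T x = poly p (length x)" for x :: "bool list"
  define Q where "Q x = poly q (length x)" for x :: "bool list"
  define N where "N x = (T x + 1) * row_width (T x) (Q x)" for x
  define m where "m x = 2 + N x * s" for x
  define items where "items x = tableau_items M (T x) (Q x) x" for x
  define es where "es x = graph_edges (m x * (m x * (m x * C))) (m x) (csp_edges (N x) s (items x))" for x
  define F where "F = fold run_op ops"
  obtain W where em: "emits nc (\<lambda>b. [b]) (f_program M s C) {1, 2, 4, 5, 6, 7, 8} W"
    and W: "\<And>x c T Q. layout s T Q c \<Longrightarrow> (let N = (T + 1) * row_width T Q; m = 2 + N * s in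
       W x c = enc_graph (2 * m) (graph_edges (m * (m * (m * C))) m
         (csp_edges N s (tableau_items M T Q x))))"
    using emits_program[OF nc(1), of M s C] by blast
  have F: "layout s (T x) (Q x) (F (input_counter x))"
    "\<And>r. r \<in> {1, 2, 4, 5, 6, 7, 8} \<Longrightarrow> F (input_counter x) r = 0" for x
  proof -
    define c1 where "c1 = fold run_op (horner (coeffs p) 30) (input_counter x)"
    have c1: "c1 30 = T x" "\<And>r. r < 30 \<or> q0 \<le> r \<Longrightarrow> c1 r = input_counter x r"
      using horner_run[of 30 "input_counter x" "coeffs p"] by (auto simp: c1_def T_def q0_def input_counter_def)
    define c2 where "c2 = fold run_op (horner (coeffs q) q0) c1"
    have c1z: "c1 r = 0" if "q0 \<le> r" for r using c1(2)[of r] that nc by (simp add: input_counter_def)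
    have c2: "c2 q0 = Q x" "\<And>r. r < q0 \<Longrightarrow> c2 r = c1 r"
      using horner_run[of q0 c1 "coeffs q", OF c1z] c1(2)[of 0] nc by (auto simp: c2_def Q_def input_counter_def)
    have z: "c2 r = 0" if "0 < r" "r < 30" for r
      using c2(2)[of r] c1(2)[of r] that nc by (simp add: input_counter_def)
    have "c2 30 = T x" using c2(2)[of 30] c1(1) nc by simp
    note run = layout_ops_run[where s = s, OF z nc(3) this c2(1)]
    have "F (input_counter x) = fold run_op (layout_ops s q0) c2"
      by (simp add: F_def ops_def c1_def c2_def)
    thus "layout s (T x) (Q x) (F (input_counter x))" "\<And>r. r \<in> {1, 2, 4, 5, 6, 7, 8} \<Longrightarrow> F (input_counter x) r = 0"
      using run by simp_all
  qed
  have within: "\<And>it. it \<in> set (items x) \<Longrightarrow> item_within (N x) it" for x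
    unfolding items_def N_def by (rule tableau_items_within)
  have K: "4 * (2 + N x * s)\<^sup>2 * length (csp_edges (N x) s (items x)) \<le> m x * (m x * (m x * C))" for x
  proof -
    have "N x * 1 \<le> N x * s" using s by (rule mult_le_mono2)
    hence Nm: "N x \<le> m x" "1 \<le> m x" unfolding m_def by linarith+
    have "length (csp_edges (N x) s (items x)) \<le>
        N x * (8 * s + 8 * s\<^sup>2 + 8) + length (items x) * (8 * s\<^sup>2) + 4"
      by (rule length_csp_edges)
    also have "\<dots> \<le> N x * (8 * s + 8 * s\<^sup>2 + 8) + (4 * N x) * (8 * s\<^sup>2) + 4"
      using length_tableau_items[of M "T x" "Q x" x] unfolding items_def N_def
      by (intro add_mono mult_le_mono) auto
    also have "\<dots> = N x * (8 * s + 40 * s\<^sup>2 + 8) + 4" by (simp add: algebra_simps)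
    also have "\<dots> \<le> m x * (8 * s + 40 * s\<^sup>2 + 8) + m x * 4"
      using Nm by (intro add_mono mult_le_mono) auto
    finally have len: "length (csp_edges (N x) s (items x)) \<le> m x * (8 * s + 40 * s\<^sup>2 + 12)"
      by (simp add: algebra_simps)
    have "4 * (m x)\<^sup>2 * length (csp_edges (N x) s (items x)) \<le>
        4 * (m x)\<^sup>2 * (m x * (8 * s + 40 * s\<^sup>2 + 12))"
      using len by (intro mult_le_mono2)
    also have "\<dots> = m x * (m x * (m x * C))" by (simp add: C_def power2_eq_square)
    finally show ?thesis by (simp only: m_def)
  qed
  have sat: "(\<exists>f. satisfies (N x) s (items x) f) \<longleftrightarrow> x \<in> Lang" for x
    unfolding N_def s_def items_def tableau_correct[OF M] Lang T_def Q_def ..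
  note graph = csp_graph[OF within K, folded m_def, folded es_def]
  show "turing_reduces Lang (modularity_approximation \<rho>)"
  proof (rule turing_reduces_modularity[OF assms, where nc = nc and st = "f_seqs (map f_op ops)"
        and P = "\<lambda>c. c 1 = 0 \<and> c 2 = 0" and F = F and em = "f_program M s C"
        and Z = "{1, 2, 4, 5, 6, 7, 8}" and W = W and nv = "\<lambda>x. 2 * m x" and es = es and ?r0.0 = 17])
    show "setup_prog nc (f_seqs (map f_op ops)) (\<lambda>c. c 1 = 0 \<and> c 2 = 0) F"
      unfolding F_def by (rule setup_ops[OF ops]) (use nc in simp)
    fix x :: "bool list"
    show "zeros {1, 2, 4, 5, 6, 7, 8} (F (input_counter x))" unfolding zeros_def by (intro ballI F(2))
    show "W x (F (input_counter x)) = enc_graph (2 * m x) (es x)"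
      using W[OF F(1)[of x], of x] by (simp only: Let_def es_def items_def m_def N_def)
    show "2 * m x \<le> F (input_counter x) 17 * 2" using F(1)[of x] by (simp add: layout_def Let_def m_def N_def)
    show "valid_edges (2 * m x) (es x)" by (rule graph(1))
    show "es x \<noteq> []" by (simp add: es_def graph_edges_def csp_edges_def gadget_defs)
    show "if x \<in> Lang then positive_cut (2 * m x) (es x) else negative_cuts (2 * m x) (es x)"
      by (metis graph(3,4) sat)
  qed (use nc em in \<open>auto simp: input_counter_def\<close>)
qed

end
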